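(* Let $k$ be a prime number and let $\alpha$ be a real number. The sequence $$\alpha n\bigl\lfloor \alpha n\bigl\lfloor\cdots\lfloor \alpha n\lfloor\alpha n\rfloor\rfloor\cdots\bigr\rfloor\bigr\rfloor,\qquad n=1,2,\ldots$$ (with exactly $k$ factors $\alpha n$) is uniformly distributed modulo $1$ if and only if $\alpha^k$ is irrational.
   Context: For real $x$, $\lfloor x\rfloor$ is the greatest integer less than or equal to $x$. The nested expression is $(\alpha n)^{:k}$, where for real $x$ one defines $x^{:0}=1$ and $x^{:j}=x\lfloor x^{:(j-1)}\rfloor$ for $j>0$. A sequence of reals is uniformly distributed modulo $1$ if its sequence of fractional parts is uniformly distributed (equidistributed with respect to Lebesgue measure) in $[0,1)$. *)

theory Defs
  imports Complex_Main "HOL-Computational_Algebra.Primes"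
begin

fun nested_floor :: "real \<Rightarrow> nat \<Rightarrow> real" where
  "nested_floor x 0 = 1"
| "nested_floor x (Suc j) = x * of_int \<lfloor>nested_floor x j\<rfloor>"

text \<open>Sequences are indexed by the positive integers; the value \<open>u 0\<close> is irrelevant.\<close>

definition unif_dist_mod1 :: "(nat \<Rightarrow> real) \<Rightarrow> bool" where
  "unif_dist_mod1 u \<longleftrightarrow>
    (\<forall>a b. 0 \<le> a \<and> a < b \<and> b \<le> 1 \<longrightarrow>
      (\<lambda>N. real (card {n \<in> {1..N}. a \<le> frac (u n) \<and> frac (u n) < b}) / real N)
        \<longlonglongrightarrow> b - a)"

end

theory Submission
  imports Defs "HOL-Analysis.Analysis"
begin

text \<open>
  Fix \<open>n\<close>, put \<open>x = \<alpha> n\<close>, and let \<open>a_j\<close> and \<open>r_j\<close> be the integer and the fractional part of the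
  \<open>j\<close>-fold nested expression, with \<open>a_0 = 1\<close>. The recursion \<open>a_j + r_j = x a_(j-1)\<close> says that the
  generating functions satisfy \<open>1 - R(z) = (1 - x z) A(z)\<close>. Taking logarithmic derivatives and
  comparing coefficients of \<open>z^j\<close> gives (\<open>nested_floor_identity\<close>)
  \<open>j (a_j + r_j) = x^j + P_j(-a) - P_j(r)\<close>, where \<open>P_j\<close> is a polynomial with integer coefficients in
  the entries of index below \<open>j\<close>. Modulo 1 the \<open>j\<close>-th expression is therefore \<open>x^j / j\<close>, corrected
  by a function of residues of earlier integer parts and a polynomial in earlier fractional parts.

  \<^bold>\<open>Irrational power.\<close> Let \<open>phase_class d\<close> be the set of bounded sequences in the closure, in
  the seminorm \<open>f \<mapsto> limsup mean |f|\<close>, of the span of all \<open>n \<mapsto> e(p(n))\<close>, where the coefficients of the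
  real polynomial \<open>p\<close> of degree above \<open>d\<close> are rational. It is an algebra closed under \<open>exp\<close>, and by
  Weyl's theorem all of its elements are orthogonal to \<open>e(\<theta> n^j)\<close> for \<open>j > d\<close> and irrational
  \<open>\<theta>\<close>. If \<open>r_i\<close> and the residues of \<open>a_i\<close> lie in these classes for \<open>i < k\<close>, and \<open>\<alpha>^k\<close> is
  irrational, then all Weyl sums of the \<open>k\<close>-th expression vanish in the limit. That they do lie there,
  for irrational \<open>\<alpha>\<close>, is \<open>parts_in_class_all\<close>. The induction meets one obstacle: the fractional part jumps at integers, so
  one has to exclude that the expressions concentrate near integers. For irrational \<open>\<alpha>^j\<close> this
  follows from the Weyl sums. For rational \<open>\<alpha>^j\<close> a fixed multiple of the expression is congruent to
  a multiple of \<open>P_j(r)\<close>, which for \<open>j \<ge> 3\<close> contains the term \<open>j r_1 r_(j-1)\<close> and is otherwise a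
  polynomial in \<open>r_1, \<dots>, r_(j-2)\<close>. As \<open>r_(j-1)\<close> is uniform and independent of those, averaging
  over it spreads the values out.

  \<^bold>\<open>Rational power.\<close> If \<open>\<alpha>\<close> is rational, the values lie in a fixed lattice. Otherwise, because
  \<open>k\<close> is prime, all lower powers of \<open>\<alpha>\<close> are irrational and \<open>r_1, \<dots>, r_(k-1)\<close> are
  asymptotically independent and uniform. Uniform distribution would force the Weyl sums of
  \<open>q P_k(r)\<close> to vanish for a denominator \<open>q\<close> of \<open>\<alpha>^k\<close>. For \<open>k = 2\<close> this is \<open>q r_1\<^sup>2\<close>, which is
  too often close to 0. For \<open>k = 2 s + 1\<close> one has \<open>P_k(r) = S + k \<Sum> b_i r_(k-i)\<close>
  (\<open>psum_lower_high\<close>), the sum running over \<open>1 \<le> i \<le> s\<close>, with \<open>S\<close> and \<open>b_i = r_i + \<dots>\<close>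
  polynomials in \<open>r_1, \<dots>, r_s\<close> only. Averaging over the \<open>s\<close> high variables turns the Weyl sum
  of frequency \<open>m\<close> into the mean of a constant times \<open>m^(-s) e(m q S) \<Prod> (e(m c b_i) - 1) / b_i\<close>,
  where \<open>c = k q\<close>.
  Clearing \<open>m^(-s)\<close> and summing with the weights of the Fejer kernel of order \<open>M\<close> gives a function,
  \<open>edge_kernel\<close>, whose mean would have to vanish. However, up to the sign \<open>(-1)^s\<close> it is about
  \<open>\<Prod> 1 / b_i\<close> where all \<open>b_i\<close> lie between \<open>1/M\<close> and \<open>1/sqrt M\<close>, so that this region
  contributes a multiple of \<open>(log M)^s\<close>, while its negative part contributes at most
  \<open>O((log M)^(s-1))\<close>, since there the bound for at least one variable is a weight with bounded
  integral (\<open>edge_kernel_lower\<close>). Letting \<open>M\<close> grow gives the contradiction.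
\<close>

section \<open>Cesaro means and van der Corput's inequality\<close>

definition ee :: "real \<Rightarrow> complex" where "ee t = cis (2 * pi * t)"

lemma ee_add: "ee (s + t) = ee s * ee t"
  by (simp add: ee_def distrib_left cis_mult)

lemma ee_minus: "ee (- t) = cnj (ee t)"
  by (simp add: ee_def cis_cnj)

lemma ee_diff: "ee (s - t) = ee s * cnj (ee t)"
  using ee_add[of s "- t"] by (simp add: ee_minus)

lemma norm_ee [simp]: "cmod (ee t) = 1"
  by (simp add: ee_def)

lemma ee_0 [simp]: "ee 0 = 1"
  by (simp add: ee_def)

lemma ee_mult_nat: "ee (real m * t) = ee t ^ m"
  by (simp add: ee_def Complex.DeMoivre mult.left_commute)

lemma ee_sum: "finite A \<Longrightarrow> ee (\<Sum>i\<in>A. f i) = (\<Prod>i\<in>A. ee (f i))"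
  by (induction A rule: finite_induct) (auto simp: ee_add)

lemma ee_eq_1_iff: "ee t = 1 \<longleftrightarrow> t \<in> \<int>"
proof -
  have "ee t = 1 \<longleftrightarrow> (\<exists>n::int. 2 * pi * t = of_int n * 2 * pi)"
    unfolding ee_def cis_conv_exp exp_eq_1 by simp
  also have "\<dots> \<longleftrightarrow> (\<exists>n::int. t = of_int n)"
    by (auto simp: mult.commute)
  also have "\<dots> \<longleftrightarrow> t \<in> \<int>"
    by (auto simp: Ints_def)
  finally show ?thesis .
qed

lemma ee_cong_Ints: "s - t \<in> \<int> \<Longrightarrow> ee s = ee t"
  using ee_eq_1_iff[of "s - t"] ee_add[of "s - t" t] by simp

lemma ee_frac: "ee (frac t) = ee t"
  by (rule ee_cong_Ints) (simp add: frac_def)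

definition mean :: "(nat \<Rightarrow> 'a::real_normed_field) \<Rightarrow> nat \<Rightarrow> 'a" where
  "mean f N = (\<Sum>n=1..N. f n) / of_nat N"

lemma mean_add: "mean (\<lambda>n. f n + g n) N = mean f N + mean g N"
  by (simp add: mean_def sum.distrib add_divide_distrib)

lemma mean_diff: "mean (\<lambda>n. f n - g n) N = mean f N - mean g N"
  by (simp add: mean_def sum_subtractf diff_divide_distrib)

lemma mean_cmult: "mean (\<lambda>n. c * f n) N = c * mean f N"
  by (simp add: mean_def sum_distrib_left)

lemma mean_sum: "mean (\<lambda>n. \<Sum>i\<in>A. f i n) N = (\<Sum>i\<in>A. mean (f i) N)"
  unfolding mean_def by (subst sum.swap) (simp add: sum_divide_distrib)

lemma mean_mono: "(\<And>n. f n \<le> g n) \<Longrightarrow> mean f N \<le> (mean g N :: real)"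
  unfolding mean_def by (intro divide_right_mono sum_mono) auto

lemma mean_const: "N > 0 \<Longrightarrow> mean (\<lambda>n. c) N = c"
  by (simp add: mean_def)

lemma tendsto_mean_const: "mean (\<lambda>n. c) \<longlonglongrightarrow> c"
  by (rule tendsto_eventually) (auto simp: eventually_sequentially mean_const intro!: exI[of _ 1])

lemma norm_mean_le: "norm (mean f N) \<le> mean (\<lambda>n. norm (f n)) N"
  unfolding mean_def norm_divide norm_of_nat by (intro divide_right_mono sum_norm_le) auto

lemma mean_bound:
  assumes "\<And>n. norm (f n) \<le> B" "0 \<le> B"
  shows "norm (mean f N) \<le> B"
proof (cases "N = 0")
  case False
  have "norm (mean f N) \<le> mean (\<lambda>n. norm (f n)) N" by (rule norm_mean_le)
  also have "\<dots> \<le> mean (\<lambda>n. B) N" by (rule mean_mono) (rule assms)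
  finally show ?thesis using False by (simp add: mean_const)
qed (use assms in \<open>simp add: mean_def\<close>)

lemma mean_of_real: "mean (\<lambda>n. of_real (f n)) N = (of_real (mean f N) :: complex)"
  by (simp add: mean_def)

lemma sum_shift_bound:
  fixes f :: "nat \<Rightarrow> complex"
  assumes B: "\<And>n. cmod (f n) \<le> B"
  shows "cmod ((\<Sum>n=1..N. f (n + h)) - (\<Sum>n=1..N. f n)) \<le> 2 * real h * B"
proof (induction h)
  case (Suc h)
  have eq: "(\<Sum>n=1..N. f (n + Suc h)) - (\<Sum>n=1..N. f (n + h)) = f (N + Suc h) - f (Suc h)"
    using sum_Suc_diff[of 1 N "\<lambda>n. f (n + h)"] by (simp add: sum_subtractf)
  have "(\<Sum>n=1..N. f (n + Suc h)) - (\<Sum>n=1..N. f n)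
     = ((\<Sum>n=1..N. f (n + h)) - (\<Sum>n=1..N. f n)) + f (N + Suc h) - f (Suc h)"
    using eq by (simp only: diff_eq_eq) (simp add: algebra_simps)
  also have "cmod \<dots> \<le> 2 * real h * B + B + B"
    by (intro order.trans[OF norm_triangle_ineq4] order.trans[OF norm_triangle_ineq] add_mono Suc.IH B)
  finally show ?case by (simp add: algebra_simps)
qed simp

lemma tendsto_bounded_over_nat:
  fixes s :: "nat \<Rightarrow> complex"
  assumes "\<And>N. cmod (s N) \<le> C"
  shows "(\<lambda>N. s N / of_nat N) \<longlonglongrightarrow> 0"
proof (rule Lim_null_comparison)
  show "\<forall>\<^sub>F N in sequentially. norm (s N / of_nat N) \<le> C / real N"
    by (intro always_eventually allI) (use assms in \<open>auto simp: norm_divide intro!: divide_right_mono\<close>)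
  show "(\<lambda>N. C / real N) \<longlonglongrightarrow> 0"
    by (rule lim_const_over_n)
qed

lemma mean_shift:
  fixes f :: "nat \<Rightarrow> complex"
  assumes B: "\<And>n. cmod (f n) \<le> B"
  shows "(\<lambda>N. mean (\<lambda>n. f (n + h)) N - mean f N) \<longlonglongrightarrow> 0"
  using tendsto_bounded_over_nat[of "\<lambda>N. (\<Sum>n=1..N. f (n + h)) - (\<Sum>n=1..N. f n)" "2 * real h * B"]
    sum_shift_bound[of f B, OF B]
  by (simp add: mean_def diff_divide_distrib)

lemma mean_cauchy_schwarz:
  fixes f :: "nat \<Rightarrow> complex"
  shows "(cmod (mean f N))\<^sup>2 \<le> mean (\<lambda>n. (cmod (f n))\<^sup>2) N"
proof (cases "N = 0")
  case False
  have "(cmod (\<Sum>n=1..N. f n))\<^sup>2 \<le> (\<Sum>n=1..N. 1 * cmod (f n))\<^sup>2"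
    by (intro power_mono) (auto intro: sum_norm_le)
  also have "\<dots> \<le> (\<Sum>n=1..N. 1\<^sup>2) * (\<Sum>n=1..N. (cmod (f n))\<^sup>2)"
    by (rule Cauchy_Schwarz_ineq_sum)
  finally have "(cmod (\<Sum>n=1..N. f n))\<^sup>2 \<le> real N * (\<Sum>n=1..N. (cmod (f n))\<^sup>2)"
    by simp
  then show ?thesis using False
    by (simp add: mean_def norm_divide power_divide field_simps power2_eq_square)
qed (simp add: mean_def)

text \<open>
  Replacing \<open>u\<close> by its average over \<open>H\<close> consecutive shifts changes the mean by \<open>o(1)\<close>. After
  Cauchy-Schwarz only the diagonal of the resulting double sum survives, so the mean is
  \<open>O(1 / sqrt H)\<close>.
\<close>

lemma van_der_corput:
  fixes u :: "nat \<Rightarrow> complex"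
  assumes u1: "\<And>n. cmod (u n) \<le> 1"
    and corr: "\<And>h. h \<ge> 1 \<Longrightarrow> mean (\<lambda>n. u (n + h) * cnj (u n)) \<longlonglongrightarrow> 0"
  shows "mean u \<longlonglongrightarrow> 0"
proof -
  have pair: "mean (\<lambda>n. u (n + i) * cnj (u (n + j))) \<longlonglongrightarrow> 0" if "j < i" for i j
  proof -
    let ?f = "\<lambda>n. u (n + (i - j)) * cnj (u n)"
    have "(\<lambda>N. mean (\<lambda>n. ?f (n + j)) N - mean ?f N) \<longlonglongrightarrow> 0"
      by (rule mean_shift[where B = 1]) (auto simp: norm_mult intro!: mult_le_one u1)
    from tendsto_add[OF this corr[of "i - j"]] that show ?thesis
      by (simp add: add.assoc add.commute[of j])
  qed
  have pair': "mean (\<lambda>n. u (n + i) * cnj (u (n + j))) \<longlonglongrightarrow> 0" if "i \<noteq> j" for i j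
  proof (cases "j < i")
    case False
    then have "(\<lambda>N. cnj (mean (\<lambda>n. u (n + j) * cnj (u (n + i))) N)) \<longlonglongrightarrow> cnj 0"
      using that by (intro tendsto_cnj pair) auto
    then show ?thesis by (simp add: mean_def[abs_def] mult.commute)
  qed (rule pair)
  have main: "\<forall>\<^sub>F N in sequentially. (cmod (mean u N)) \<le> 4 / sqrt (real H)" if H: "H \<ge> 1" for H :: nat
  proof -
    define V where "V n = (\<Sum>h<H. u (n + h))" for n
    have V2: "of_real ((cmod (V n))\<^sup>2) = (\<Sum>i<H. \<Sum>j<H. u (n + i) * cnj (u (n + j)))" for n
      by (simp only: complex_norm_square V_def cnj_sum sum_product)
    have split: "(\<Sum>i<H. \<Sum>j<H. u (n + i) * cnj (u (n + j))) =
       (\<Sum>i<H. u (n + i) * cnj (u (n + i))) + (\<Sum>i<H. \<Sum>j\<in>{..<H}-{i}. u (n + i) * cnj (u (n + j)))" for n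
      by (subst sum.distrib[symmetric], rule sum.cong[OF refl], subst sum.remove[of "{..<H}"]) auto
    define D where "D N = mean (\<lambda>n. \<Sum>i<H. u (n + i) * cnj (u (n + i))) N" for N
    define E where "E N = (\<Sum>i<H. \<Sum>j\<in>{..<H}-{i}. mean (\<lambda>n. u (n + i) * cnj (u (n + j))) N)" for N
    have mV: "of_real (mean (\<lambda>n. (cmod (V n))\<^sup>2) N) = D N + E N" for N
      by (simp only: mean_of_real[symmetric] V2 split mean_add D_def E_def mean_sum)
    have "E \<longlonglongrightarrow> (\<Sum>i<H. \<Sum>j\<in>{..<H}-{i}. 0)"
      unfolding E_def[abs_def] by (intro tendsto_sum pair') auto
    then have evE: "\<forall>\<^sub>F N in sequentially. cmod (E N) < 1"
      by (auto simp: tendsto_iff)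
    have D: "cmod (D N) \<le> real H" for N
      unfolding D_def
      by (intro mean_bound order.trans[OF norm_sum] order.trans[OF sum_bounded_above[where K = 1]])
        (auto simp: norm_mult intro!: mult_le_one u1)
    have sh: "(\<lambda>N. mean V N - of_nat H * mean u N) \<longlonglongrightarrow> 0"
    proof -
      have "(\<lambda>N. \<Sum>h<H. (mean (\<lambda>n. u (n + h)) N - mean u N)) \<longlonglongrightarrow> (\<Sum>h<H. 0)"
        by (intro tendsto_sum mean_shift[where B = 1] u1)
      then show ?thesis by (simp add: V_def[abs_def] mean_sum sum_subtractf)
    qed
    then have "\<forall>\<^sub>F N in sequentially. cmod (mean V N - of_nat H * mean u N) < 1"
      by (auto simp: tendsto_iff)
    with evE show ?thesis
    proof eventually_elim
      case (elim N)
      have "(cmod (mean V N))\<^sup>2 \<le> mean (\<lambda>n. (cmod (V n))\<^sup>2) N"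
        by (rule mean_cauchy_schwarz)
      also have "\<dots> \<le> cmod (of_real (mean (\<lambda>n. (cmod (V n))\<^sup>2) N))"
        by simp
      also have "\<dots> \<le> real H + 1"
        unfolding mV using elim(1) D[of N] norm_triangle_ineq[of "D N" "E N"] by linarith
      also have "\<dots> \<le> (2 * sqrt (real H))\<^sup>2" using H by (simp add: power_mult_distrib)
      finally have "cmod (mean V N) \<le> 2 * sqrt (real H)"
        by (rule power2_le_imp_le) simp
      then have "cmod (of_nat H * mean u N) \<le> 2 * sqrt (real H) + 1"
        using elim(2) norm_triangle_ineq3[of "mean V N" "of_nat H * mean u N"] by linarith
      also have "\<dots> \<le> 4 * sqrt (real H)"
      proof -
        have "1 \<le> sqrt (real H)" using H by simp
        then show ?thesis by linarith
      qed
      finally have "real H * cmod (mean u N) \<le> 4 * sqrt (real H)" by (simp add: norm_mult)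
      moreover have "real H = sqrt (real H) * sqrt (real H)" by simp
      ultimately have "sqrt (real H) * (sqrt (real H) * cmod (mean u N)) \<le> sqrt (real H) * 4"
        by (simp add: mult.assoc[symmetric])
      then have "sqrt (real H) * cmod (mean u N) \<le> 4"
        using H by (subst (asm) mult_le_cancel_left_pos) auto
      then show ?case using H by (simp add: field_simps)
    qed
  qed
  show ?thesis
  proof (rule tendstoI)
    fix e :: real assume e: "e > 0"
    define H where "H = nat \<lceil>(4 / e)\<^sup>2\<rceil> + 1"
    have H: "H \<ge> 1" "real H > (4 / e)\<^sup>2"
      unfolding H_def by (simp, linarith)
    have "4 / e < sqrt (real H)" using H(2) by (rule real_less_rsqrt)
    then have "4 / sqrt (real H) < e"
      using e H(1) by (simp add: field_simps)
    with main[OF H(1)] show "\<forall>\<^sub>F N in sequentially. dist (mean u N) 0 < e"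
      by (auto elim!: eventually_mono)
  qed
qed

section \<open>Weyl's theorem for polynomials\<close>

lemma coeff_shift_Rats:
  assumes "\<forall>i. coeff p i \<in> \<rat>" "h \<in> \<rat>"
  shows "coeff (pcompose p [:h, 1:]) i \<in> (\<rat> :: real set)"
  using assms(1)
proof (induction p arbitrary: i)
  case (pCons a p)
  have "\<forall>i. coeff p i \<in> \<rat>" "a \<in> \<rat>"
    using pCons.prems by (metis coeff_pCons_Suc, metis coeff_pCons_0)
  with pCons.IH assms(2) show ?case
    by (cases i) (simp_all add: pcompose_pCons del: coeff_pcompose_0)
qed auto

text \<open>
  Modulo rationals, the part of \<open>p\<close> above degree \<open>d\<close> is invisible, also after a rational shift.
  Hence the difference \<open>p(x + h) - p(x)\<close> has its topmost irrational coefficient exactly one degree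
  lower, namely \<open>d h\<close> times the old one.
\<close>

lemma coeff_shift_mod_Rats:
  fixes p :: "real poly"
  assumes "\<forall>i>d. coeff p i \<in> \<rat>" "h \<in> \<rat>"
  shows "(\<forall>i>d. coeff (pcompose p [:h, 1:]) i \<in> \<rat>) \<and>
         coeff (pcompose p [:h, 1:]) d - coeff p d \<in> \<rat> \<and>
         (d \<ge> 1 \<longrightarrow> coeff (pcompose p [:h, 1:]) (d - 1) - coeff p (d - 1) - real d * h * coeff p d \<in> \<rat>)"
  using assms(1)
proof (induction p arbitrary: d)
  case (pCons a p)
  let ?T = "\<lambda>i. coeff (pcompose p [:h, 1:]) i"
  have T0: "coeff (pcompose (pCons a p) [:h, 1:]) 0 = a + h * ?T 0"
    and TS: "\<And>i. coeff (pcompose (pCons a p) [:h, 1:]) (Suc i) = h * ?T (Suc i) + ?T i"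
    by (auto simp: pcompose_pCons)
  show ?case
  proof (cases d)
    case 0
    have "\<forall>i. coeff p i \<in> \<rat>" using pCons.prems 0
      by (metis coeff_pCons_Suc zero_less_Suc)
    then have T: "?T i \<in> \<rat>" for i using coeff_shift_Rats assms(2) by blast
    have "coeff (pcompose (pCons a p) [:h, 1:]) i \<in> \<rat>" if "i > 0" for i
      using that T assms(2) by (cases i) (auto simp: TS)
    then show ?thesis using 0 T[of 0] assms(2) by (simp add: T0 del: coeff_pcompose_0)
  next
    case (Suc d')
    have "\<forall>i>d'. coeff p i \<in> \<rat>" using pCons.prems Suc
      by (metis Suc_less_eq coeff_pCons_Suc)
    note IH = pCons.IH[OF this]
    have hi: "coeff (pcompose (pCons a p) [:h, 1:]) i \<in> \<rat>" if "i > d" for i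
      using that IH assms(2) Suc by (cases i) (auto simp: TS)
    have "h * ?T (Suc d') + (?T d' - coeff p d') \<in> \<rat>"
      using IH assms(2) by auto
    then have mid: "coeff (pcompose (pCons a p) [:h, 1:]) d - coeff (pCons a p) d \<in> \<rat>"
      using Suc by (simp add: TS add_diff_eq)
    have lo: "coeff (pcompose (pCons a p) [:h, 1:]) (d - 1) - coeff (pCons a p) (d - 1)
        - real d * h * coeff (pCons a p) d \<in> \<rat>"
    proof (cases d')
      case 0
      have "h * (?T 0 - coeff p 0) \<in> \<rat>" using IH assms(2) 0 by auto
      then show ?thesis using Suc 0 by (simp add: T0 algebra_simps)
    next
      case (Suc d'')
      have "h * (?T d' - coeff p d') + (?T d'' - coeff p d'' - real d' * h * coeff p d') \<in> \<rat>"
        using IH assms(2) Suc by auto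
      then show ?thesis using Suc \<open>d = Suc d'\<close> by (simp add: TS algebra_simps)
    qed
    show ?thesis using hi mid lo by blast
  qed
qed auto

text \<open>
  The quantifier over multiples of \<open>Q\<close> and the second conjunct are there for the induction: the
  periodicity of \<open>a + x r(x)\<close> needs both for \<open>r\<close>, at a multiple of the period of \<open>r\<close>.
\<close>

lemma rational_poly_periodic:
  assumes "\<forall>i. coeff r i \<in> (\<rat> :: real set)"
  shows "\<exists>Q\<ge>1. \<forall>K n :: nat. poly r (real (n + Q * K)) - poly r (real n) \<in> \<int> \<and> real (Q * K) * poly r (real n) \<in> \<int>"
  using assms
proof (induction r)
  case 0
  then show ?case by (auto intro!: exI[of _ 1])
next
  case (pCons a r)
  have "\<forall>i. coeff r i \<in> \<rat>" and a: "a \<in> \<rat>"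
    using pCons.prems by (metis coeff_pCons_Suc, metis coeff_pCons_0)
  with pCons.IH obtain Q where Q: "Q \<ge> 1"
    "\<And>K n :: nat. poly r (real (n + Q * K)) - poly r (real n) \<in> \<int>"
    "\<And>K n :: nat. real (Q * K) * poly r (real n) \<in> \<int>" by blast
  from a obtain u :: int and v :: nat where v: "v \<noteq> 0" "a = of_int u / of_nat v"
    by (metis Rats_cases' of_int_of_nat_eq nat_0_le less_le less_imp_of_nat_less of_nat_0 order.strict_implies_order of_nat_0_less_iff)
  have va: "real v * a \<in> \<int>" using v by simp
  show ?case
  proof (intro exI[of _ "Q * v"] conjI allI)
    show "Q * v \<ge> 1" using Q v by simp
    fix K n :: nat
    have "real n * (poly r (real (n + Q * (v * K))) - poly r (real n))
        + real (Q * (v * K)) * poly r (real (n + Q * (v * K))) \<in> \<int>"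
      by (intro Ints_add Ints_mult Q) auto
    then show "poly (pCons a r) (real (n + Q * v * K)) - poly (pCons a r) (real n) \<in> \<int>"
      by (simp add: algebra_simps)
    have "real (Q * K) * (real v * a) + real n * (real (Q * (v * K)) * poly r (real n)) \<in> \<int>"
      by (intro Ints_add Ints_mult Q va) auto
    then show "real (Q * v * K) * poly (pCons a r) (real n) \<in> \<int>"
      by (simp add: algebra_simps)
  qed
qed

lemma irrational_add_rational: "x \<notin> \<rat> \<Longrightarrow> y \<in> \<rat> \<Longrightarrow> x + y \<notin> (\<rat> :: real set)"
  by (metis Rats_diff add_diff_cancel_right')

lemma irrational_mult_rational: "x \<notin> \<rat> \<Longrightarrow> y \<in> \<rat> \<Longrightarrow> y \<noteq> 0 \<Longrightarrow> y * x \<notin> (\<rat> :: real set)"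
  by (metis Rats_divide nonzero_mult_div_cancel_left)

text \<open>
  Modulo 1 the part of degree at least 2 is periodic with some period \<open>Q\<close>, so a shift by \<open>Q\<close>
  multiplies the sequence by a constant different from 1, and a shift does not change means.
\<close>

lemma weyl_linear:
  fixes p :: "real poly"
  assumes "coeff p 1 \<notin> \<rat>" "\<forall>i>1. coeff p i \<in> \<rat>"
  shows "mean (\<lambda>n. ee (poly p (real n))) \<longlonglongrightarrow> 0"
proof -
  define r where "r = p - [:coeff p 0, coeff p 1:]"
  have "coeff r i \<in> \<rat>" for i
    unfolding r_def using assms(2) by (cases i rule: nat.exhaust[case_names 0 Suc]; cases "i - 1")
      (auto simp: coeff_pCons split: nat.splits)
  with rational_poly_periodic[of r] obtain Q where Q: "Q \<ge> 1"
    "\<And>K n :: nat. poly r (real (n + Q * K)) - poly r (real n) \<in> \<int>" by blast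
  define u where "u n = ee (poly p (real n))" for n :: nat
  let ?z = "ee (coeff p 1 * real Q)"
  have p: "poly p x = poly r x + coeff p 0 + coeff p 1 * x" for x
    by (simp add: r_def)
  have step: "u (n + Q) = ?z * u n" for n
  proof -
    have "poly p (real (n + Q)) - (coeff p 1 * real Q + poly p (real n)) \<in> \<int>"
      using Q(2)[of n 1] by (simp add: p algebra_simps)
    then show ?thesis unfolding u_def by (metis ee_cong_Ints ee_add)
  qed
  have "real Q * coeff p 1 \<notin> \<rat>"
    using assms(1) Q(1) by (intro irrational_mult_rational) auto
  then have z: "?z \<noteq> 1"
    using Ints_subset_Rats by (auto simp: ee_eq_1_iff mult.commute)
  have "(\<lambda>N. mean (\<lambda>n. u (n + Q)) N - mean u N) \<longlonglongrightarrow> 0"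
    by (rule mean_shift[where B = 1]) (simp add: u_def)
  moreover have "mean (\<lambda>n. u (n + Q)) N - mean u N = (?z - 1) * mean u N" for N
    by (simp only: step mean_cmult left_diff_distrib mult_1_left)
  ultimately have "(\<lambda>N. (?z - 1) * mean u N) \<longlonglongrightarrow> (?z - 1) * 0" by simp
  then have "mean u \<longlonglongrightarrow> 0" using z
    by (simp only: tendsto_mult_left_iff right_minus_eq not_False_eq_True)
  then show ?thesis by (simp add: u_def[abs_def])
qed

text \<open>
  Differencing in van der Corput's inequality lowers \<open>d\<close> by one and keeps all higher coefficients
  rational. Allowing rational coefficients above the irrational one is what later makes sums of phases
  of different degrees harmless.
\<close>

theorem weyl_polynomial:
  fixes p :: "real poly"
  assumes "d \<ge> 1" "coeff p d \<notin> \<rat>" "\<forall>i>d. coeff p i \<in> \<rat>"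
  shows "mean (\<lambda>n. ee (poly p (real n))) \<longlonglongrightarrow> 0"
  using assms
proof (induction d arbitrary: p rule: nat_induct_at_least)
  case base
  then show ?case by (intro weyl_linear) auto
next
  case (Suc d)
  show ?case
  proof (rule van_der_corput)
    fix h :: nat assume h: "h \<ge> 1"
    define q where "q = pcompose p [:real h, 1:] - p"
    have *: "(\<forall>i>Suc d. coeff (pcompose p [:real h, 1:]) i \<in> \<rat>)"
       "coeff (pcompose p [:real h, 1:]) (Suc d) - coeff p (Suc d) \<in> \<rat>"
       "coeff (pcompose p [:real h, 1:]) d - coeff p d - real (Suc d) * real h * coeff p (Suc d) \<in> \<rat>"
      using coeff_shift_mod_Rats[of "Suc d" p "real h"] Suc.prems by auto
    have "mean (\<lambda>n. ee (poly q (real n))) \<longlonglongrightarrow> 0"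
    proof (rule Suc.IH)
      have "(real (Suc d) * real h) * coeff p (Suc d) \<notin> \<rat>"
        using Suc.prems h by (intro irrational_mult_rational) auto
      from irrational_add_rational[OF this *(3)] show "coeff q d \<notin> \<rat>"
        by (simp add: q_def)
      show "\<forall>i>d. coeff q i \<in> \<rat>"
      proof (intro allI impI)
        fix i assume "d < i"
        then consider "i = Suc d" | "i > Suc d" by linarith
        then show "coeff q i \<in> \<rat>"
          using * Suc.prems by cases (auto simp: q_def)
      qed
    qed
    then show "mean (\<lambda>n. ee (poly p (real (n + h))) * cnj (ee (poly p (real n)))) \<longlonglongrightarrow> 0"
      by (simp add: q_def poly_pcompose ee_diff add.commute)
  qed simp
qed

section \<open>The closed algebra generated by polynomial phases\<close>

text \<open>
  Only the coefficients above degree \<open>d\<close> are restricted. Thus multiplying a phase of this span by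
  \<open>e(\<theta> n^j)\<close> with \<open>j > d\<close> and \<open>\<theta>\<close> irrational always leaves an irrational coefficient.
\<close>

inductive_set phase_span :: "nat \<Rightarrow> (nat \<Rightarrow> complex) set" for d where
  phase: "(\<forall>i>d. coeff p i \<in> \<rat>) \<Longrightarrow> (\<lambda>n. c * ee (poly p (real n))) \<in> phase_span d"
| add: "f \<in> phase_span d \<Longrightarrow> g \<in> phase_span d \<Longrightarrow> (\<lambda>n. f n + g n) \<in> phase_span d"

lemma phase_span_bounded: "f \<in> phase_span d \<Longrightarrow> \<exists>B\<ge>0. \<forall>n. cmod (f n) \<le> B"
proof (induction rule: phase_span.induct)
  case (phase p c)
  then show ?case by (intro exI[of _ "cmod c"]) (simp add: norm_mult)
next
  case (add f g)
  then obtain A B where "A \<ge> 0" "B \<ge> 0" "\<forall>n. cmod (f n) \<le> A" "\<forall>n. cmod (g n) \<le> B" by blast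
  then show ?case
    by (intro exI[of _ "A + B"]) (auto intro: order.trans[OF norm_triangle_ineq] add_mono)
qed

lemma phase_span_mult:
  assumes "f \<in> phase_span d" "g \<in> phase_span d"
  shows "(\<lambda>n. f n * g n) \<in> phase_span d"
  using assms
proof (induction rule: phase_span.induct)
  case (phase p c)
  from phase(2) show ?case
  proof (induction rule: phase_span.induct)
    case (phase q c')
    then have "\<forall>i>d. coeff (p + q) i \<in> \<rat>" using \<open>\<forall>i>d. coeff p i \<in> \<rat>\<close> by auto
    from phase_span.phase[OF this, of "c * c'"] show ?case by (simp add: ee_add mult_ac)
  next
    case (add f g)
    from phase_span.add[OF add.IH] show ?case by (simp add: distrib_left)
  qed
next
  case (add f h)
  from phase_span.add[OF add.IH] add.prems show ?case by (simp add: distrib_right)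
qed

lemma phase_span_cnj: "f \<in> phase_span d \<Longrightarrow> (\<lambda>n. cnj (f n)) \<in> phase_span d"
proof (induction rule: phase_span.induct)
  case (phase p c)
  then have "\<forall>i>d. coeff (- p) i \<in> \<rat>" by auto
  from phase_span.phase[OF this, of "cnj c"] show ?case by (simp add: ee_minus)
next
  case (add f g)
  from phase_span.add[OF add.IH] show ?case by simp
qed

lemma phase_span_const: "(\<lambda>n. c) \<in> phase_span d"
  using phase_span.phase[of d 0 c] by simp

lemma phase_span_mono: "f \<in> phase_span d \<Longrightarrow> d \<le> d' \<Longrightarrow> f \<in> phase_span d'"
  by (induction rule: phase_span.induct) (auto intro: phase_span.intros)

text \<open>
  Boundedness is required in addition to approximability in mean, since products would otherwise
  leave the class.
\<close>

definition phase_class :: "nat \<Rightarrow> (nat \<Rightarrow> complex) set" where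
  "phase_class d = {f. (\<exists>B. \<forall>n. cmod (f n) \<le> B) \<and>
     (\<forall>\<epsilon>>0. \<exists>g\<in>phase_span d. \<forall>\<^sub>F N in sequentially. mean (\<lambda>n. cmod (f n - g n)) N \<le> \<epsilon>)}"

lemma phase_class_bounded: "f \<in> phase_class d \<Longrightarrow> \<exists>B>0. \<forall>n. cmod (f n) \<le> B"
proof -
  assume "f \<in> phase_class d"
  then obtain B where "\<And>n. cmod (f n) \<le> B" by (auto simp: phase_class_def)
  then have "cmod (f n) \<le> max B 1" for n by (simp add: le_max_iff_disj)
  then show ?thesis by (intro exI[of _ "max B 1"]) auto
qed

lemma phase_class_approx:
  "f \<in> phase_class d \<Longrightarrow> \<epsilon> > 0 \<Longrightarrow>
    \<exists>g\<in>phase_span d. \<forall>\<^sub>F N in sequentially. mean (\<lambda>n. cmod (f n - g n)) N \<le> \<epsilon>"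
  by (auto simp: phase_class_def)

lemma phase_class_span: "f \<in> phase_span d \<Longrightarrow> f \<in> phase_class d"
  using phase_span_bounded[of f d] unfolding phase_class_def
  by (auto intro!: bexI[of _ f] simp: mean_def)

lemma phase_class_phase:
  "(\<forall>i>d. coeff p i \<in> \<rat>) \<Longrightarrow> (\<lambda>n. ee (poly p (real n))) \<in> phase_class d"
  using phase_class_span[OF phase_span.phase[of d p 1]] by simp

lemma phase_class_const: "(\<lambda>n. c) \<in> phase_class d"
  by (intro phase_class_span phase_span_const)

lemma phase_class_mono: "f \<in> phase_class d \<Longrightarrow> d \<le> d' \<Longrightarrow> f \<in> phase_class d'"
  unfolding phase_class_def using phase_span_mono by blast

lemma phase_class_closed:
  assumes bd: "\<And>n. cmod (f n) \<le> B"
    and ap: "\<And>\<epsilon>. \<epsilon> > 0 \<Longrightarrow> \<exists>g\<in>phase_class d. \<forall>\<^sub>F N in sequentially. mean (\<lambda>n. cmod (f n - g n)) N \<le> \<epsilon>"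
  shows "f \<in> phase_class d"
  unfolding phase_class_def
proof (intro CollectI conjI allI impI)
  fix \<epsilon> :: real assume "\<epsilon> > 0"
  then have e: "\<epsilon> / 2 > 0" by simp
  from ap[OF e] obtain g where g: "g \<in> phase_class d"
    "\<forall>\<^sub>F N in sequentially. mean (\<lambda>n. cmod (f n - g n)) N \<le> \<epsilon> / 2" by blast
  from phase_class_approx[OF g(1) e] obtain h where h: "h \<in> phase_span d"
    "\<forall>\<^sub>F N in sequentially. mean (\<lambda>n. cmod (g n - h n)) N \<le> \<epsilon> / 2" by blast
  from g(2) h(2) have "\<forall>\<^sub>F N in sequentially. mean (\<lambda>n. cmod (f n - h n)) N \<le> \<epsilon>"
  proof eventually_elim
    case (elim N)
    have "mean (\<lambda>n. cmod (f n - h n)) N \<le> mean (\<lambda>n. cmod (f n - g n) + cmod (g n - h n)) N"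
      by (rule mean_mono) (metis norm_triangle_ineq diff_add_cancel add_diff_eq)
    then show ?case using elim by (simp add: mean_add)
  qed
  then show "\<exists>g\<in>phase_span d. \<forall>\<^sub>F N in sequentially. mean (\<lambda>n. cmod (f n - g n)) N \<le> \<epsilon>"
    using h(1) by blast
qed (use bd in blast)

lemma phase_class_uniform:
  assumes ap: "\<And>\<epsilon>. \<epsilon> > 0 \<Longrightarrow> \<exists>g\<in>phase_class d. \<forall>n. cmod (f n - g n) \<le> \<epsilon>"
  shows "f \<in> phase_class d"
proof -
  from ap[of 1] obtain g where g: "g \<in> phase_class d" "\<forall>n. cmod (f n - g n) \<le> 1" by auto
  from phase_class_bounded[OF g(1)] obtain B where B: "\<And>n. cmod (g n) \<le> B" by blast
  show ?thesis
  proof (rule phase_class_closed)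
    show "cmod (f n) \<le> 1 + B" for n
      using g(2) B[of n] norm_triangle_ineq[of "f n - g n" "g n"] by (smt (verit) diff_add_cancel)
    fix \<epsilon> :: real assume "\<epsilon> > 0"
    from ap[OF this] obtain h where h: "h \<in> phase_class d" "\<forall>n. cmod (f n - h n) \<le> \<epsilon>" by blast
    have "mean (\<lambda>n. cmod (f n - h n)) N \<le> \<epsilon>" for N
      using mean_bound[of "\<lambda>n. cmod (f n - h n)" \<epsilon> N] h(2) \<open>\<epsilon> > 0\<close> by auto
    then show "\<exists>g\<in>phase_class d. \<forall>\<^sub>F N in sequentially. mean (\<lambda>n. cmod (f n - g n)) N \<le> \<epsilon>"
      by (intro bexI[OF _ h(1)] always_eventually allI)
  qed
qed

lemma phase_class_add:
  assumes f: "f \<in> phase_class d" and g: "g \<in> phase_class d"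
  shows "(\<lambda>n. f n + g n) \<in> phase_class d"
  unfolding phase_class_def
proof (intro CollectI conjI allI impI)
  from phase_class_bounded[OF f] phase_class_bounded[OF g] obtain A B
    where "\<And>n. cmod (f n) \<le> A" "\<And>n. cmod (g n) \<le> B" by blast
  then show "\<exists>C. \<forall>n. cmod (f n + g n) \<le> C"
    by (intro exI[of _ "A + B"]) (auto intro: order.trans[OF norm_triangle_ineq] add_mono)
  fix \<epsilon> :: real assume "\<epsilon> > 0"
  then have e: "\<epsilon> / 2 > 0" by simp
  from phase_class_approx[OF f e] obtain f' where f': "f' \<in> phase_span d"
    "\<forall>\<^sub>F N in sequentially. mean (\<lambda>n. cmod (f n - f' n)) N \<le> \<epsilon> / 2" by blast
  from phase_class_approx[OF g e] obtain g' where g': "g' \<in> phase_span d"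
    "\<forall>\<^sub>F N in sequentially. mean (\<lambda>n. cmod (g n - g' n)) N \<le> \<epsilon> / 2" by blast
  from f'(2) g'(2) have "\<forall>\<^sub>F N in sequentially. mean (\<lambda>n. cmod (f n + g n - (f' n + g' n))) N \<le> \<epsilon>"
  proof eventually_elim
    case (elim N)
    have "mean (\<lambda>n. cmod (f n + g n - (f' n + g' n))) N \<le> mean (\<lambda>n. cmod (f n - f' n) + cmod (g n - g' n)) N"
      by (rule mean_mono) (rule norm_diff_triangle_ineq)
    then show ?case using elim by (simp add: mean_add)
  qed
  then show "\<exists>h\<in>phase_span d. \<forall>\<^sub>F N in sequentially. mean (\<lambda>n. cmod (f n + g n - h n)) N \<le> \<epsilon>"
    using phase_span.add[OF f'(1) g'(1)] by (intro bexI) auto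
qed

lemma phase_class_mult:
  assumes f: "f \<in> phase_class d" and g: "g \<in> phase_class d"
  shows "(\<lambda>n. f n * g n) \<in> phase_class d"
  unfolding phase_class_def
proof (intro CollectI conjI allI impI)
  from phase_class_bounded[OF f] obtain A where A: "A > 0" "\<And>n. cmod (f n) \<le> A" by blast
  from phase_class_bounded[OF g] obtain B where B: "B > 0" "\<And>n. cmod (g n) \<le> B" by blast
  show "\<exists>C. \<forall>n. cmod (f n * g n) \<le> C"
    using A B by (intro exI[of _ "A * B"]) (auto simp: norm_mult intro!: mult_mono)
  fix \<epsilon> :: real assume eps: "\<epsilon> > 0"
  from phase_class_approx[OF g, of "\<epsilon> / (2 * A)"] A eps obtain g' where g': "g' \<in> phase_span d"
    "\<forall>\<^sub>F N in sequentially. mean (\<lambda>n. cmod (g n - g' n)) N \<le> \<epsilon> / (2 * A)" by auto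
  from phase_span_bounded[OF g'(1)] obtain B0 where B0: "B0 \<ge> 0" "\<And>n. cmod (g' n) \<le> B0" by blast
  define B' where "B' = B0 + 1"
  have B': "B' > 0" "cmod (g' n) \<le> B'" for n
    using B0(1) B0(2)[of n] by (auto simp: B'_def)
  from phase_class_approx[OF f, of "\<epsilon> / (2 * B')"] B' eps obtain f' where f': "f' \<in> phase_span d"
    "\<forall>\<^sub>F N in sequentially. mean (\<lambda>n. cmod (f n - f' n)) N \<le> \<epsilon> / (2 * B')" by auto
  from f'(2) g'(2) have "\<forall>\<^sub>F N in sequentially. mean (\<lambda>n. cmod (f n * g n - f' n * g' n)) N \<le> \<epsilon>"
  proof eventually_elim
    case (elim N)
    have "mean (\<lambda>n. cmod (f n * g n - f' n * g' n)) N
       \<le> mean (\<lambda>n. A * cmod (g n - g' n) + B' * cmod (f n - f' n)) N"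
    proof (rule mean_mono)
      fix n
      have "f n * g n - f' n * g' n = f n * (g n - g' n) + g' n * (f n - f' n)"
        by (simp add: algebra_simps)
      also have "cmod \<dots> \<le> cmod (f n) * cmod (g n - g' n) + cmod (g' n) * cmod (f n - f' n)"
        by (metis norm_triangle_ineq norm_mult)
      also have "\<dots> \<le> A * cmod (g n - g' n) + B' * cmod (f n - f' n)"
        by (intro add_mono mult_right_mono A B') auto
      finally show "cmod (f n * g n - f' n * g' n) \<le> A * cmod (g n - g' n) + B' * cmod (f n - f' n)" .
    qed
    also have "\<dots> = A * mean (\<lambda>n. cmod (g n - g' n)) N + B' * mean (\<lambda>n. cmod (f n - f' n)) N"
      by (simp add: mean_add mean_cmult)
    also have "\<dots> \<le> A * (\<epsilon> / (2 * A)) + B' * (\<epsilon> / (2 * B'))"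
      using elim A B' by (intro add_mono mult_left_mono) auto
    also have "\<dots> = \<epsilon>" using A B' by simp
    finally show ?case .
  qed
  then show "\<exists>h\<in>phase_span d. \<forall>\<^sub>F N in sequentially. mean (\<lambda>n. cmod (f n * g n - h n)) N \<le> \<epsilon>"
    using phase_span_mult[OF f'(1) g'(1)] by (intro bexI) auto
qed

lemma phase_class_cnj:
  assumes f: "f \<in> phase_class d"
  shows "(\<lambda>n. cnj (f n)) \<in> phase_class d"
  unfolding phase_class_def
proof (intro CollectI conjI allI impI)
  from phase_class_bounded[OF f] show "\<exists>C. \<forall>n. cmod (cnj (f n)) \<le> C" by auto
  fix \<epsilon> :: real assume "\<epsilon> > 0"
  from phase_class_approx[OF f this] obtain f' where f': "f' \<in> phase_span d"
    "\<forall>\<^sub>F N in sequentially. mean (\<lambda>n. cmod (f n - f' n)) N \<le> \<epsilon>" by blast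
  then show "\<exists>h\<in>phase_span d. \<forall>\<^sub>F N in sequentially. mean (\<lambda>n. cmod (cnj (f n) - h n)) N \<le> \<epsilon>"
    using phase_span_cnj[OF f'(1)]
    by (intro bexI[of _ "\<lambda>n. cnj (f' n)"]) (simp_all flip: complex_cnj_diff)
qed

lemma phase_class_cmult: "f \<in> phase_class d \<Longrightarrow> (\<lambda>n. c * f n) \<in> phase_class d"
  using phase_class_mult[OF phase_class_const] .

lemma phase_class_sum:
  "(\<And>i. i \<in> A \<Longrightarrow> f i \<in> phase_class d) \<Longrightarrow> (\<lambda>n. \<Sum>i\<in>A. f i n) \<in> phase_class d"
  by (induction A rule: infinite_finite_induct) (auto intro: phase_class_add phase_class_const)

lemma phase_class_prod:
  "(\<And>i. i \<in> A \<Longrightarrow> f i \<in> phase_class d) \<Longrightarrow> (\<lambda>n. \<Prod>i\<in>A. f i n) \<in> phase_class d"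
  by (induction A rule: infinite_finite_induct) (auto intro: phase_class_mult phase_class_const)

lemma phase_class_power: "f \<in> phase_class d \<Longrightarrow> (\<lambda>n. f n ^ k) \<in> phase_class d"
  by (induction k) (auto intro: phase_class_mult phase_class_const)

lemma power_series_uniform:
  fixes a :: "nat \<Rightarrow> complex"
  assumes a: "\<And>z. summable (\<lambda>k. norm (a k * z ^ k))" and B: "B > 0" and \<epsilon>: "\<epsilon> > 0"
  shows "\<forall>\<^sub>F K in sequentially. \<forall>z. cmod z \<le> B \<longrightarrow> cmod ((\<Sum>k. a k * z ^ k) - (\<Sum>k<K. a k * z ^ k)) \<le> \<epsilon>"
proof -
  have "uniform_limit (cball 0 B) (\<lambda>K z. \<Sum>k<K. a k * z ^ k) (\<lambda>z. \<Sum>k. a k * z ^ k) sequentially"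
  proof (rule Weierstrass_m_test)
    show "summable (\<lambda>k. norm (a k * of_real B ^ k))" by (rule a)
    show "norm (a k * z ^ k) \<le> norm (a k * of_real B ^ k)" if "z \<in> cball 0 B" for k z
      using that B by (auto simp: norm_mult norm_power intro!: mult_left_mono power_mono)
  qed
  from uniform_limitD[OF this \<epsilon>] show ?thesis
    by (rule eventually_mono) (auto simp: dist_norm norm_minus_commute intro: less_imp_le)
qed

lemma phase_class_power_series:
  assumes f: "f \<in> phase_class d" and a: "\<And>z. summable (\<lambda>k. norm (a k * z ^ k))"
  shows "(\<lambda>n. \<Sum>k. a k * f n ^ k :: complex) \<in> phase_class d"
proof (rule phase_class_uniform)
  fix \<epsilon> :: real assume "\<epsilon> > 0"
  from phase_class_bounded[OF f] obtain B where B: "B > 0" "\<And>n. cmod (f n) \<le> B" by blast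
  from eventually_happens'[OF sequentially_bot power_series_uniform[OF a B(1) \<open>\<epsilon> > 0\<close>]]
  obtain K where K: "\<And>z. cmod z \<le> B \<Longrightarrow> cmod ((\<Sum>k. a k * z ^ k) - (\<Sum>k<K. a k * z ^ k)) \<le> \<epsilon>"
    by blast
  show "\<exists>g\<in>phase_class d. \<forall>n. cmod ((\<Sum>k. a k * f n ^ k) - g n) \<le> \<epsilon>"
    by (intro bexI[of _ "\<lambda>n. \<Sum>k<K. a k * f n ^ k"] allI K B phase_class_sum phase_class_cmult phase_class_power f)
qed

lemma phase_class_exp:
  assumes "f \<in> phase_class d"
  shows "(\<lambda>n. exp (f n)) \<in> phase_class d"
proof -
  have "(\<lambda>n. \<Sum>k. inverse (fact k) * f n ^ k) \<in> phase_class d"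
  proof (rule phase_class_power_series[OF assms])
    show "summable (\<lambda>k. norm (inverse (fact k) * z ^ k))" for z :: complex
      using summable_norm_exp[of z] by (simp add: norm_mult norm_inverse)
  qed
  then show ?thesis by (simp add: exp_def scaleR_conv_of_real)
qed

lemma phase_class_ee:
  assumes "(\<lambda>n. of_real (u n)) \<in> phase_class d"
  shows "(\<lambda>n. ee (c * u n)) \<in> phase_class d"
proof -
  have "(\<lambda>n. exp ((2 * pi * c * \<i>) * of_real (u n))) \<in> phase_class d"
    by (intro phase_class_exp phase_class_cmult assms)
  then show ?thesis by (simp add: ee_def cis_conv_exp mult_ac)
qed

text \<open>
  By Stone-Weierstrass it is enough to treat polynomials, and these are generated by linear
  functionals. Both the circle and the unit interval are used below.
\<close>

lemma phase_class_continuous: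
  fixes w :: "nat \<Rightarrow> 'a::euclidean_space" and G :: "'a \<Rightarrow> real"
  assumes S: "compact S" "\<And>n. w n \<in> S" and G: "continuous_on S G"
    and lin: "\<And>L :: 'a \<Rightarrow> real. bounded_linear L \<Longrightarrow> (\<lambda>n. of_real (L (w n))) \<in> phase_class d"
  shows "(\<lambda>n. of_real (G (w n))) \<in> phase_class d"
proof (rule phase_class_uniform)
  have pol: "(\<lambda>n. of_real (P (w n))) \<in> phase_class d" if "real_polynomial_function P" for P
    using that
    by induction (auto intro: lin phase_class_const phase_class_add phase_class_mult)
  fix \<epsilon> :: real assume "\<epsilon> > 0"
  from Stone_Weierstrass_real_polynomial_function[OF S(1) G this] obtain P where
    P: "real_polynomial_function P" "\<And>x. x \<in> S \<Longrightarrow> \<bar>G x - P x\<bar> < \<epsilon>" by blast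
  show "\<exists>g\<in>phase_class d. \<forall>n. cmod (of_real (G (w n)) - g n) \<le> \<epsilon>"
    using P(2)[OF S(2)]
    by (intro bexI[OF _ pol[OF P(1)]] allI) (auto simp flip: of_real_diff intro: less_imp_le)
qed

lemma bounded_linear_complex_to_real:
  assumes "bounded_linear (L :: complex \<Rightarrow> real)"
  obtains a b :: complex where "\<And>z. of_real (L z) = a * z + b * cnj z"
proof
  fix z
  note lin = bounded_linear.linear[OF assms]
  have "z = Re z *\<^sub>R 1 + Im z *\<^sub>R \<i>" by (simp add: complex_eq_iff)
  then have "L z = L (Re z *\<^sub>R 1 + Im z *\<^sub>R \<i>)" by (rule arg_cong)
  also have "\<dots> = Re z * L 1 + Im z * L \<i>"
    by (simp only: linear_add[OF lin] linear_cmul[OF lin] real_scaleR_def)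
  finally show "of_real (L z) = ((L 1 - \<i> * L \<i>) / 2) * z + ((L 1 + \<i> * L \<i>) / 2) * cnj z"
    by (simp only:) (simp add: complex_eq_iff field_simps)
qed

lemma phase_class_continuous_circle:
  assumes y: "(\<lambda>n. ee (y n)) \<in> phase_class d" and G: "continuous_on (sphere 0 1) G"
  shows "(\<lambda>n. of_real (G (ee (y n)) :: real)) \<in> phase_class d"
proof (rule phase_class_continuous[OF _ _ G])
  fix L :: "complex \<Rightarrow> real" assume "bounded_linear L"
  from bounded_linear_complex_to_real[OF this] obtain a b :: complex
    where L: "\<And>z. of_real (L z) = a * z + b * cnj z" by blast
  show "(\<lambda>n. of_real (L (ee (y n)))) \<in> phase_class d"
    unfolding L by (intro phase_class_add phase_class_cmult phase_class_cnj y)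
qed auto

lemma phase_class_continuous_Icc:
  assumes v: "(\<lambda>n. of_real (v n)) \<in> phase_class d" "\<And>n. v n \<in> {0..1}"
    and g: "continuous_on {0..1} g"
  shows "(\<lambda>n. of_real (g (v n) :: real)) \<in> phase_class d"
proof (rule phase_class_continuous[OF _ v(2) g])
  fix L :: "real \<Rightarrow> real" assume L: "bounded_linear L"
  define a where "a = L 1"
  have "L x = a * x" for x
    using linear_cmul[OF bounded_linear.linear[OF L], of x 1] by (simp add: a_def)
  then show "(\<lambda>n. of_real (L (v n))) \<in> phase_class d"
    using phase_class_cmult[OF v(1), of "of_real a"] by simp
qed auto

text \<open>
  The orthogonality relation on which all equidistribution statements rest.
\<close>

lemma phase_class_weyl:
  assumes f: "f \<in> phase_class d" and "d < j" and \<theta>: "\<theta> \<notin> \<rat>"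
  shows "mean (\<lambda>n. f n * ee (\<theta> * real n ^ j)) \<longlonglongrightarrow> 0"
proof (rule tendstoI)
  have span: "mean (\<lambda>n. g n * ee (\<theta> * real n ^ j)) \<longlonglongrightarrow> 0" if "g \<in> phase_span d" for g
    using that
  proof induction
    case (phase p c)
    have "mean (\<lambda>n. ee (poly (p + monom \<theta> j) (real n))) \<longlonglongrightarrow> 0"
    proof (rule weyl_polynomial)
      show "coeff (p + monom \<theta> j) j \<notin> \<rat>"
        using irrational_add_rational[OF \<theta>, of "coeff p j"] phase \<open>d < j\<close> by (simp add: add.commute)
    qed (use phase \<open>d < j\<close> in auto)
    from tendsto_mult_right_zero[OF this, of c] show ?case
      by (simp add: mean_cmult[symmetric, abs_def] poly_monom ee_add mult_ac)
  next
    case (add f g)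
    from tendsto_add[OF add.IH] show ?case
      by (simp add: distrib_right mean_add[symmetric])
  qed
  fix e :: real assume "e > 0"
  then have "e / 2 > 0" by simp
  from phase_class_approx[OF f this] obtain g where g: "g \<in> phase_span d"
    "\<forall>\<^sub>F N in sequentially. mean (\<lambda>n. cmod (f n - g n)) N \<le> e / 2" by blast
  have "\<forall>\<^sub>F N in sequentially. cmod (mean (\<lambda>n. g n * ee (\<theta> * real n ^ j)) N) < e / 2"
    using tendstoD[OF span[OF g(1)] \<open>e / 2 > 0\<close>] by simp
  with g(2) show "\<forall>\<^sub>F N in sequentially. dist (mean (\<lambda>n. f n * ee (\<theta> * real n ^ j)) N) 0 < e"
  proof eventually_elim
    case (elim N)
    have "cmod (mean (\<lambda>n. f n * ee (\<theta> * real n ^ j)) N - mean (\<lambda>n. g n * ee (\<theta> * real n ^ j)) N)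
       \<le> mean (\<lambda>n. cmod (f n * ee (\<theta> * real n ^ j) - g n * ee (\<theta> * real n ^ j))) N"
      unfolding mean_diff[symmetric] by (rule norm_mean_le)
    also have "\<dots> = mean (\<lambda>n. cmod (f n - g n)) N"
      by (simp add: left_diff_distrib[symmetric] norm_mult)
    finally show ?case using elim
      norm_triangle_sub[of "mean (\<lambda>n. f n * ee (\<theta> * real n ^ j)) N" "mean (\<lambda>n. g n * ee (\<theta> * real n ^ j)) N"]
      by simp
  qed
qed

section \<open>The Fejer kernel and concentration near integers\<close>

text \<open>
  Normalised to have maximum 1 (at the integers) and mean \<open>1 / M\<close>. It is used both as a majorant
  of neighbourhoods of the integers and, later, as a bump function all of whose Fourier coefficients
  are nonnegative.
\<close>

definition fejer :: "nat \<Rightarrow> real \<Rightarrow> real" where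
  "fejer M t = (cmod ((\<Sum>m<M. ee (real m * t)) / of_nat M))\<^sup>2"

lemma fejer_nonneg: "fejer M t \<ge> 0"
  by (simp add: fejer_def)

lemma fejer_expand:
  "of_real (fejer M t) = (\<Sum>i<M. \<Sum>j<M. ee ((real i - real j) * t)) / of_nat M ^ 2"
proof -
  let ?S = "\<Sum>m<M. ee (real m * t)"
  have "?S * cnj ?S = (\<Sum>i<M. \<Sum>j<M. ee ((real i - real j) * t))"
    by (simp add: sum_product ee_diff left_diff_distrib)
  then show ?thesis
    unfolding fejer_def complex_norm_square by (simp add: power2_eq_square)
qed

lemma fejer_ge:
  assumes "real M * cmod (ee t - 1) \<le> 1 / 2" "M > 0"
  shows "fejer M t \<ge> 1 / 4"
proof -
  let ?S = "\<Sum>m<M. ee (real m * t)"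
  have "cmod (?S - of_nat M) = cmod (\<Sum>m<M. (ee t ^ m - 1 ^ m))"
    by (simp add: ee_mult_nat sum_subtractf)
  also have "\<dots> \<le> (\<Sum>m<M. real M * cmod (ee t - 1))"
  proof (rule sum_norm_le)
    fix m assume "m \<in> {..<M}"
    have "cmod (ee t ^ m - 1 ^ m) \<le> real m * cmod (ee t - 1)"
      by (rule norm_power_diff) auto
    also have "\<dots> \<le> real M * cmod (ee t - 1)"
      using \<open>m \<in> {..<M}\<close> by (intro mult_right_mono) auto
    finally show "cmod (ee t ^ m - 1 ^ m) \<le> real M * cmod (ee t - 1)" .
  qed
  also have "\<dots> \<le> real M * (1 / 2)"
    using assms by (simp add: mult_left_mono)
  finally have "cmod ?S \<ge> real M / 2"
    using norm_triangle_sub[of "of_nat M" ?S] by (simp add: norm_minus_commute)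
  then have "cmod (?S / of_nat M) \<ge> 1 / 2"
    using assms(2) by (simp add: norm_divide field_simps)
  then have "(1 / 2)\<^sup>2 \<le> (cmod (?S / of_nat M))\<^sup>2"
    by (intro power_mono) auto
  then show ?thesis by (simp add: fejer_def power2_eq_square)
qed

lemma mean_cdivide: "mean (\<lambda>n. f n / c) N = mean f N / c"
  by (simp add: mean_def sum_divide_distrib field_simps)

lemma mean_fejer:
  "complex_of_real (mean (\<lambda>n. fejer M (y n)) N) =
     (\<Sum>i<M. \<Sum>j<M. mean (\<lambda>n. ee ((real i - real j) * y n)) N) / of_nat M ^ 2"
  by (simp only: mean_of_real[symmetric] fejer_expand mean_cdivide mean_sum)

text \<open>
  The limiting distribution modulo 1, if it exists, has no atom at the point where the fractional
  part jumps.
\<close>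

definition no_concentration :: "(nat \<Rightarrow> real) \<Rightarrow> bool" where
  "no_concentration y \<longleftrightarrow> (\<forall>\<epsilon>>0. \<exists>\<delta>>0. \<forall>\<^sub>F N in sequentially.
     mean (\<lambda>n. of_bool (cmod (ee (y n) - 1) < \<delta>)) N \<le> (\<epsilon>::real))"

text \<open>
  Four times the kernel of order \<open>M\<close> majorises the neighbourhood of the integers of radius
  \<open>1 / (2 M)\<close>, measured on the circle.
\<close>

lemma fejer_no_concentration:
  assumes "\<And>\<epsilon>. \<epsilon> > 0 \<Longrightarrow> \<exists>M>0. \<forall>\<^sub>F N in sequentially. mean (\<lambda>n. fejer M (y n)) N \<le> \<epsilon>"
  shows "no_concentration y"
  unfolding no_concentration_def
proof (intro allI impI)
  fix \<epsilon> :: real assume "\<epsilon> > 0"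
  then obtain M where M: "M > 0" "\<forall>\<^sub>F N in sequentially. mean (\<lambda>n. fejer M (y n)) N \<le> \<epsilon> / 4"
    using assms[of "\<epsilon> / 4"] by auto
  let ?d = "1 / (2 * real M)"
  have le: "of_bool (cmod (ee t - 1) < ?d) \<le> 4 * fejer M t" for t
    using fejer_ge[of M t] M(1) fejer_nonneg[of M t] by (auto simp: field_simps)
  have "\<forall>\<^sub>F N in sequentially. mean (\<lambda>n. of_bool (cmod (ee (y n) - 1) < ?d)) N \<le> \<epsilon>"
    using M(2)
  proof eventually_elim
    case (elim N)
    have "mean (\<lambda>n. of_bool (cmod (ee (y n) - 1) < ?d)) N \<le> mean (\<lambda>n. 4 * fejer M (y n)) N"
      by (rule mean_mono) (rule le)
    then show ?case using elim by (simp add: mean_cmult)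
  qed
  then show "\<exists>\<delta>>0. \<forall>\<^sub>F N in sequentially. mean (\<lambda>n. of_bool (cmod (ee (y n) - 1) < \<delta>)) N \<le> \<epsilon>"
    using M(1) by (intro exI[of _ ?d]) auto
qed

lemma card_near_diagonal: "card {p \<in> {..<M} \<times> {..<M}. \<bar>int (fst p) - int (snd p)\<bar> < int m} \<le> M * (2 * m)"
proof -
  have "{p \<in> {..<M} \<times> {..<M}. \<bar>int (fst p) - int (snd p)\<bar> < int m}
      \<subseteq> (\<lambda>(i, l). (i, nat (int i + l - int m))) ` ({..<M} \<times> {0..<int (2 * m)})"
  proof
    fix p assume p: "p \<in> {p \<in> {..<M} \<times> {..<M}. \<bar>int (fst p) - int (snd p)\<bar> < int m}"
    then show "p \<in> (\<lambda>(i, l). (i, nat (int i + l - int m))) ` ({..<M} \<times> {0..<int (2 * m)})"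
      by (intro image_eqI[of _ _ "(fst p, int (snd p) - int (fst p) + int m)"]) (auto simp: prod_eq_iff)
  qed
  then have "card {p \<in> {..<M} \<times> {..<M}. \<bar>int (fst p) - int (snd p)\<bar> < int m}
      \<le> card ((\<lambda>(i, l). (i, nat (int i + l - int m))) ` ({..<M} \<times> {0..<int (2 * m)}))"
    by (intro card_mono) auto
  also have "\<dots> \<le> card ({..<M} \<times> {0..<int (2 * m)})"
    by (rule card_image_le) auto
  finally show ?thesis by (simp add: card_cartesian_product nat_mult_distrib)
qed

text \<open>
  An instance of Wiener's principle that atoms are detected by high frequencies: in the Fejer
  kernel of large order, the share of the frequencies below \<open>m0\<close> is negligible.
\<close>

lemma weyl_sums_no_concentration:
  assumes "\<And>\<epsilon>. \<epsilon> > 0 \<Longrightarrow> \<exists>m0. \<forall>m::int. \<bar>m\<bar> \<ge> int m0 \<longrightarrow>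
     (\<forall>\<^sub>F N in sequentially. cmod (mean (\<lambda>n. ee (of_int m * y n)) N) \<le> \<epsilon>)"
  shows "no_concentration y"
proof (rule fejer_no_concentration)
  fix \<epsilon> :: real assume eps: "\<epsilon> > 0"
  then obtain m0 where m0: "\<And>m::int. \<bar>m\<bar> \<ge> int m0 \<Longrightarrow>
     (\<forall>\<^sub>F N in sequentially. cmod (mean (\<lambda>n. ee (of_int m * y n)) N) \<le> \<epsilon> / 2)"
    using assms[of "\<epsilon> / 2"] by auto
  define M where "M = nat \<lceil>4 * real m0 / \<epsilon>\<rceil> + 1"
  have M: "M > 0" "real M \<ge> 4 * real m0 / \<epsilon>" unfolding M_def by (simp, linarith)
  define I where "I = {..<M} \<times> {..<M}"
  define near where "near p \<longleftrightarrow> \<bar>int (fst p) - int (snd p)\<bar> < int m0" for p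
  define W where "W p N = mean (\<lambda>n. ee ((real (fst p) - real (snd p)) * y n)) N" for p N
  have fI: "finite I" by (simp add: I_def)
  have "\<forall>\<^sub>F N in sequentially. \<forall>p\<in>I. \<not> near p \<longrightarrow> cmod (W p N) \<le> \<epsilon> / 2"
  proof (intro eventually_ball_finite fI ballI)
    fix p assume "p \<in> I"
    show "\<forall>\<^sub>F N in sequentially. \<not> near p \<longrightarrow> cmod (W p N) \<le> \<epsilon> / 2"
      using m0[of "int (fst p) - int (snd p)"] by (cases "near p") (auto simp: near_def W_def)
  qed
  then have "\<forall>\<^sub>F N in sequentially. mean (\<lambda>n. fejer M (y n)) N \<le> \<epsilon>"
  proof eventually_elim
    case (elim N)
    have W1: "cmod (W p N) \<le> 1" for p unfolding W_def by (rule mean_bound) auto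
    have "mean (\<lambda>n. fejer M (y n)) N \<le> cmod (of_real (mean (\<lambda>n. fejer M (y n)) N))"
      by simp
    also have "\<dots> = cmod (\<Sum>p\<in>I. W p N) / real M ^ 2"
      unfolding mean_fejer by (simp add: I_def sum.cartesian_product W_def norm_divide norm_power case_prod_unfold)
    also have "cmod (\<Sum>p\<in>I. W p N) \<le> (\<Sum>p\<in>I. of_bool (near p) + \<epsilon> / 2)"
      using elim W1 eps by (intro sum_norm_le) (auto simp: add_increasing2)
    also have "\<dots> = real (card {p\<in>I. near p}) + real (card I) * \<epsilon> / 2"
      using fI by (simp add: sum.distrib Int_def)
    also have "\<dots> \<le> real (M * (2 * m0)) + real M ^ 2 * \<epsilon> / 2"
      using card_near_diagonal[of M m0] unfolding near_def I_def
      by (intro add_mono of_nat_mono) (auto simp: card_cartesian_product power2_eq_square)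
    finally have "mean (\<lambda>n. fejer M (y n)) N \<le> (real (M * (2 * m0)) + real M ^ 2 * \<epsilon> / 2) / real M ^ 2"
      by (simp add: divide_right_mono)
    also have "\<dots> = 2 * real m0 / real M + \<epsilon> / 2"
      using M(1) by (simp add: field_simps power2_eq_square)
    also have "2 * real m0 / real M \<le> \<epsilon> / 2"
      using M eps by (simp add: field_simps)
    finally show ?case by simp
  qed
  with M(1) show "\<exists>M>0. \<forall>\<^sub>F N in sequentially. mean (\<lambda>n. fejer M (y n)) N \<le> \<epsilon>" by blast
qed

text \<open>
  All off-diagonal terms of the expanded kernel vanish in the limit.
\<close>

lemma tendsto_fejer_mean:
  assumes "\<And>m::int. m \<noteq> 0 \<Longrightarrow> mean (\<lambda>n. ee (of_int m * y n)) \<longlonglongrightarrow> 0" "M > 0"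
  shows "mean (\<lambda>n. fejer M (y n)) \<longlonglongrightarrow> 1 / real M"
proof -
  have *: "mean (\<lambda>n. ee ((real i - real j) * y n)) \<longlonglongrightarrow> of_bool (i = j)" for i j
    using assms(1)[of "int i - int j"] tendsto_mean_const[of "1::complex"] by (cases "i = j") auto
  have "(\<lambda>N. (\<Sum>i<M. \<Sum>j<M. mean (\<lambda>n. ee ((real i - real j) * y n)) N) / of_nat M ^ 2)
     \<longlonglongrightarrow> (\<Sum>i<M. \<Sum>j<M. of_bool (i = j)) / of_nat M ^ 2"
    by (intro tendsto_intros *) (use assms in auto)
  also have "(\<Sum>i<M. \<Sum>j<M. of_bool (i = j)) / of_nat M ^ 2 = complex_of_real (1 / real M)"
    using assms(2) by (simp add: power2_eq_square of_bool_def)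
  finally show ?thesis
    unfolding mean_fejer[symmetric] tendsto_of_real_iff .
qed

lemma Arg2pi_ee: "Arg2pi (ee t) = 2 * pi * frac t"
proof (rule Arg2pi_unique[of 1])
  show "of_real 1 * exp (\<i> * of_real (2 * pi * frac t)) = ee t"
    using ee_frac[of t] by (simp add: ee_def cis_conv_exp)
qed (use frac_lt_1[of t] in auto)

text \<open>
  A tent function around 1 on the circle. A function of the angle becomes continuous on the circle
  after multiplication by \<open>1 - damp\<close>, since the factor vanishes at the jump.
\<close>

definition damp :: "real \<Rightarrow> complex \<Rightarrow> real" where
  "damp \<delta> z = max 0 (1 - cmod (z - 1) / \<delta>)"

lemma damp_bounds: "\<delta> > 0 \<Longrightarrow> 0 \<le> damp \<delta> z \<and> damp \<delta> z \<le> 1"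
  by (simp add: damp_def)

lemma damp_le_of_bool: "\<delta> > 0 \<Longrightarrow> damp \<delta> z \<le> of_bool (cmod (z - 1) < \<delta>)"
  by (auto simp: damp_def field_simps)

lemma continuous_damp: "\<delta> > 0 \<Longrightarrow> continuous_on S (damp \<delta>)"
  unfolding damp_def by (intro continuous_intros) auto

text \<open>
  Away from 1 the angle is continuous; at 1 the damping factor squeezes the product to 0, as \<open>g\<close> is
  bounded.
\<close>

lemma continuous_damped_angle:
  assumes g: "continuous_on {0..1} g" and d: "\<delta> > 0"
  shows "continuous_on (sphere 0 1) (\<lambda>z. g (Arg2pi z / (2 * pi)) * (1 - damp \<delta> z))"
  unfolding continuous_on_def
proof
  fix z :: complex assume z: "z \<in> sphere 0 1"
  have rng: "Arg2pi w / (2 * pi) \<in> {0..1}" for w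
    using Arg2pi[of w] by (auto simp: field_simps)
  show "((\<lambda>z. g (Arg2pi z / (2 * pi)) * (1 - damp \<delta> z)) \<longlongrightarrow> g (Arg2pi z / (2 * pi)) * (1 - damp \<delta> z)) (at z within sphere 0 1)"
  proof (cases "z = 1")
    case True
    from g have "bounded (g ` {0..1})" by (intro compact_imp_bounded compact_continuous_image) auto
    then obtain B where B: "\<And>t. t \<in> {0..1} \<Longrightarrow> \<bar>g t\<bar> \<le> B" by (fastforce simp: bounded_iff)
    have "continuous_on UNIV (\<lambda>z. B * (1 - damp \<delta> z))"
      by (intro continuous_intros continuous_damp d)
    then have "((\<lambda>z. B * (1 - damp \<delta> z)) \<longlongrightarrow> B * (1 - damp \<delta> 1)) (at 1 within sphere 0 1)"
      by (meson continuous_on_def UNIV_I subset_UNIV tendsto_within_subset)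
    then have "((\<lambda>z. B * (1 - damp \<delta> z)) \<longlongrightarrow> 0) (at 1 within sphere 0 1)"
      by (simp add: damp_def)
    then have "((\<lambda>z. g (Arg2pi z / (2 * pi)) * (1 - damp \<delta> z)) \<longlongrightarrow> 0) (at 1 within sphere 0 1)"
    proof (rule Lim_null_comparison[rotated], intro always_eventually allI)
      fix w
      have "norm (g (Arg2pi w / (2 * pi)) * (1 - damp \<delta> w)) = \<bar>g (Arg2pi w / (2 * pi))\<bar> * (1 - damp \<delta> w)"
        using damp_bounds[OF d, of w] by (simp add: abs_mult)
      also have "\<dots> \<le> B * (1 - damp \<delta> w)"
        using B[OF rng] damp_bounds[OF d, of w] by (intro mult_right_mono) auto
      finally show "norm (g (Arg2pi w / (2 * pi)) * (1 - damp \<delta> w)) \<le> B * (1 - damp \<delta> w)" .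
    qed
    then show ?thesis using True by (simp add: damp_def)
  next
    case False
    have "z \<notin> \<real>\<^sub>\<ge>\<^sub>0"
    proof
      assume "z \<in> \<real>\<^sub>\<ge>\<^sub>0"
      then obtain r where "z = of_real r" "r \<ge> 0" by (auto elim: nonneg_Reals_cases)
      then show False using z False by simp
    qed
    then have "((\<lambda>z. Arg2pi z / (2 * pi)) \<longlongrightarrow> Arg2pi z / (2 * pi)) (at z within sphere 0 1)"
      using continuous_at_Arg2pi[of z] by (intro tendsto_intros) (auto simp: continuous_at intro: tendsto_within_subset)
    then have "((\<lambda>z. g (Arg2pi z / (2 * pi))) \<longlongrightarrow> g (Arg2pi z / (2 * pi))) (at z within sphere 0 1)"
      by (intro continuous_on_tendsto_compose[OF g]) (use rng in auto)
    moreover have "(damp \<delta> \<longlongrightarrow> damp \<delta> z) (at z within sphere 0 1)"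
      using continuous_damp[OF d] z by (auto simp: continuous_on_def)
    ultimately show ?thesis by (intro tendsto_intros)
  qed
qed

lemma damped_angle_error:
  assumes "\<bar>g (frac t)\<bar> \<le> B" "\<delta> > 0"
  shows "\<bar>g (frac t) - g (Arg2pi (ee t) / (2 * pi)) * (1 - damp \<delta> (ee t))\<bar> \<le> B * damp \<delta> (ee t)"
proof -
  have "g (frac t) - g (Arg2pi (ee t) / (2 * pi)) * (1 - damp \<delta> (ee t)) = g (frac t) * damp \<delta> (ee t)"
    by (simp add: Arg2pi_ee algebra_simps)
  then show ?thesis
    using assms damp_bounds[of \<delta> "ee t"] by (simp add: abs_mult mult_right_mono)
qed

text \<open>
  The damped angle is a continuous function on the circle, and it differs from the fractional part
  only near integers, which are rarely visited.
\<close>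

lemma phase_class_frac:
  assumes y: "(\<lambda>n. ee (y n)) \<in> phase_class d" and nc: "no_concentration y"
  shows "(\<lambda>n. of_real (frac (y n))) \<in> phase_class d"
proof (rule phase_class_closed)
  show "cmod (of_real (frac (y n))) \<le> 1" for n
    using frac_lt_1[of "y n"] by simp
  fix \<epsilon> :: real assume "\<epsilon> > 0"
  with nc obtain \<delta> where \<delta>: "\<delta> > 0"
    "\<forall>\<^sub>F N in sequentially. mean (\<lambda>n. of_bool (cmod (ee (y n) - 1) < \<delta>)) N \<le> \<epsilon>"
    by (auto simp: no_concentration_def)
  define G where "G z = (Arg2pi z / (2 * pi)) * (1 - damp \<delta> z)" for z
  have "continuous_on (sphere 0 1) G"
    unfolding G_def using continuous_damped_angle[of "\<lambda>t. t"] \<delta> by simp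
  then have 1: "(\<lambda>n. of_real (G (ee (y n)))) \<in> phase_class d"
    by (rule phase_class_continuous_circle[OF y])
  have "\<forall>\<^sub>F N in sequentially. mean (\<lambda>n. cmod (of_real (frac (y n)) - of_real (G (ee (y n))))) N \<le> \<epsilon>"
    using \<delta>(2)
  proof eventually_elim
    case (elim N)
    have "mean (\<lambda>n. cmod (of_real (frac (y n)) - of_real (G (ee (y n))))) N
       \<le> mean (\<lambda>n. of_bool (cmod (ee (y n) - 1) < \<delta>)) N"
    proof (rule mean_mono)
      fix n
      have "cmod (of_real (frac (y n)) - of_real (G (ee (y n)))) \<le> 1 * damp \<delta> (ee (y n))"
        using damped_angle_error[of "\<lambda>t. t" "y n" 1 \<delta>] \<delta>(1) frac_lt_1[of "y n"]
        unfolding of_real_diff[symmetric] norm_of_real by (simp add: G_def)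
      then show "cmod (of_real (frac (y n)) - of_real (G (ee (y n)))) \<le> of_bool (cmod (ee (y n) - 1) < \<delta>)"
        using damp_le_of_bool[OF \<delta>(1), of "ee (y n)"] by simp
    qed
    with elim show ?case by simp
  qed
  with 1 show "\<exists>g\<in>phase_class d. \<forall>\<^sub>F N in sequentially. mean (\<lambda>n. cmod (of_real (frac (y n)) - g n)) N \<le> \<epsilon>"
    by (intro bexI)
qed


section \<open>Equidistribution against a weight\<close>

lemma tendsto_zero_by_approx:
  fixes s :: "nat \<Rightarrow> complex"
  assumes "\<And>\<epsilon>. \<epsilon> > 0 \<Longrightarrow> \<exists>t. t \<longlonglongrightarrow> 0 \<and> (\<forall>\<^sub>F N in sequentially. cmod (s N - t N) \<le> \<epsilon>)"
  shows "s \<longlonglongrightarrow> 0"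
proof (rule tendstoI)
  fix e :: real assume "e > 0"
  then obtain t where t: "t \<longlonglongrightarrow> 0" "\<forall>\<^sub>F N in sequentially. cmod (s N - t N) \<le> e / 2"
    using assms[of "e / 2"] by auto
  from tendstoD[OF t(1), of "e / 2"] \<open>e > 0\<close> have "\<forall>\<^sub>F N in sequentially. cmod (t N) < e / 2" by simp
  with t(2) show "\<forall>\<^sub>F N in sequentially. dist (s N) 0 < e"
  proof eventually_elim
    case (elim N)
    then show ?case using norm_triangle_sub[of "s N" "t N"] by simp
  qed
qed

lemma continuous_ee: "continuous_on S f \<Longrightarrow> continuous_on S (\<lambda>t. ee (f t))"
  unfolding ee_def cis_conv_exp by (intro continuous_intros)

lemma integral_ee:
  assumes "m \<noteq> (0::int)"
  shows "integral {0..1} (\<lambda>t. ee (of_int m * t)) = 0"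
proof -
  have "((\<lambda>t. ee (of_int m * t)) has_integral (ee (of_int m * 1) / (2 * pi * \<i> * of_int m) - ee (of_int m * 0) / (2 * pi * \<i> * of_int m))) {0..1}"
  proof (rule fundamental_theorem_of_calculus)
    fix t :: real
    have "((\<lambda>z. exp (\<i> * (2 * pi * (of_int m * z))) / (2 * pi * \<i> * of_int m)) has_field_derivative exp (\<i> * (2 * pi * (of_int m * of_real t)))) (at (of_real t))"
      using assms by (auto intro!: derivative_eq_intros simp: field_simps)
    from has_vector_derivative_real_field[OF this]
    show "((\<lambda>t. ee (of_int m * t) / (2 * pi * \<i> * of_int m)) has_vector_derivative ee (of_int m * t)) (at t within {0..1})"
      by (simp add: ee_def cis_conv_exp has_vector_derivative_at_within)
  qed simp
  then show ?thesis using ee_eq_1_iff[of "of_int m"] by (simp add: integral_unique)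
qed

text \<open>
  Under the weight \<open>f\<close> the sequence \<open>y\<close> is distributed like a uniform variable, as far as the
  1-periodic test function \<open>F\<close> can see.
\<close>

definition indep_rel :: "(nat \<Rightarrow> complex) \<Rightarrow> (nat \<Rightarrow> real) \<Rightarrow> (real \<Rightarrow> complex) \<Rightarrow> bool" where
  "indep_rel f y F \<longleftrightarrow>
     (\<lambda>N. mean (\<lambda>n. f n * F (y n)) N - mean f N * integral {0..1} F) \<longlonglongrightarrow> 0"

lemma indep_rel_add:
  assumes "indep_rel f y F" "indep_rel f y G" "continuous_on UNIV F" "continuous_on UNIV G"
  shows "indep_rel f y (\<lambda>t. F t + G t)"
proof -
  have "integral {0..1} (\<lambda>t. F t + G t) = integral {0..1} F + integral {0..1} G"
    using assms by (intro integral_add integrable_continuous_interval) (auto intro: continuous_on_subset)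
  then show ?thesis
    using tendsto_add[OF assms(1,2)[unfolded indep_rel_def]]
    by (simp add: indep_rel_def distrib_left mean_add algebra_simps)
qed

lemma indep_rel_cmult:
  assumes "indep_rel f y F"
  shows "indep_rel f y (\<lambda>t. c * F t)"
  using tendsto_mult_right_zero[OF assms[unfolded indep_rel_def], of c]
  by (simp add: indep_rel_def mean_cmult[symmetric] right_diff_distrib mult_ac)

text \<open>
  Instead of expanding polynomials on the circle into characters, consider the test functions all of
  whose twists by characters satisfy the relation. This is a module over the characters, hence over
  all polynomials, and it contains 1.
\<close>

lemma equidistributed_circle:
  assumes f: "\<And>n. cmod (f n) \<le> B"
    and orth: "\<And>m::int. m \<noteq> 0 \<Longrightarrow> mean (\<lambda>n. f n * ee (of_int m * y n)) \<longlonglongrightarrow> 0"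
    and G: "continuous_on (sphere 0 1) (G :: complex \<Rightarrow> real)"
  shows "indep_rel f y (\<lambda>t. of_real (G (ee t)))"
proof -
  define R where "R F \<longleftrightarrow> continuous_on UNIV F \<and> (\<forall>m::int. indep_rel f y (\<lambda>t. F t * ee (of_int m * t)))" for F
  have R1: "R (\<lambda>t. 1)"
    unfolding R_def indep_rel_def
  proof (intro conjI allI)
    fix m :: int
    show "(\<lambda>N. mean (\<lambda>n. f n * (1 * ee (of_int m * y n))) N
         - mean f N * integral {0..1} (\<lambda>t. 1 * ee (of_int m * t))) \<longlonglongrightarrow> 0"
      using orth[of m] integral_ee[of m] by (cases "m = 0") auto
  qed simp
  have Radd: "R (\<lambda>t. F t + H t)" if "R F" "R H" for F H
    unfolding R_def distrib_right
    by (intro conjI allI indep_rel_add continuous_intros continuous_ee) (use that in \<open>auto simp: R_def\<close>)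
  have Rmul: "R (\<lambda>t. c * F t)" if "R F" for F c
    using that unfolding R_def mult.assoc by (auto intro!: continuous_intros indep_rel_cmult)
  have Ree: "R (\<lambda>t. ee (of_int l * t) * F t)" if "R F" for F l
    unfolding R_def
  proof (intro conjI allI)
    show "continuous_on UNIV (\<lambda>t. ee (of_int l * t) * F t)"
      using that by (auto simp: R_def intro!: continuous_intros continuous_ee)
    fix m :: int
    have "indep_rel f y (\<lambda>t. F t * ee (of_int (l + m) * t))" using that unfolding R_def by blast
    then show "indep_rel f y (\<lambda>t. ee (of_int l * t) * F t * ee (of_int m * t))"
      unfolding of_int_add distrib_right ee_add by (simp add: mult_ac)
  qed
  have pol: "\<forall>F. R F \<longrightarrow> R (\<lambda>t. of_real (P (ee t)) * F t)" if "real_polynomial_function P" for P :: "complex \<Rightarrow> real"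
    using that
  proof induction
    case (linear L)
    from bounded_linear_complex_to_real[OF linear] obtain A B :: complex
      where *: "\<And>z. of_real (L z) = A * z + B * cnj z" by blast
    have "of_real (L (ee t)) * F t = A * (ee (of_int 1 * t) * F t) + B * (ee (of_int (- 1) * t) * F t)" for t F
      by (simp add: * ee_minus distrib_right mult.assoc)
    then show ?case by (simp only:) (intro allI impI Radd Rmul Ree)
  next
    case (const c)
    show ?case by (intro allI impI Rmul)
  next
    case (add p q)
    show ?case unfolding of_real_add distrib_right
      by (intro allI impI Radd add.IH[rule_format])
  next
    case (mult p q)
    show ?case unfolding of_real_mult mult.assoc
      by (intro allI impI mult.IH[rule_format])
  qed
  have B: "B \<ge> 0" using f[of 0] norm_ge_zero order_trans by blast
  have contG: "continuous_on {0..1} (\<lambda>t. complex_of_real (G (ee t)))"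
    by (intro continuous_on_of_real continuous_on_compose2[OF G] continuous_ee continuous_on_id) auto
  show ?thesis
    unfolding indep_rel_def
  proof (rule tendsto_zero_by_approx)
    fix \<epsilon> :: real assume eps: "\<epsilon> > 0"
    define \<eta> where "\<eta> = \<epsilon> / (2 * B + 1)"
    have \<eta>: "\<eta> > 0" "2 * B * \<eta> \<le> \<epsilon>" using eps B by (auto simp: \<eta>_def field_simps)
    from Stone_Weierstrass_real_polynomial_function[OF _ G \<eta>(1)] obtain P where
      P: "real_polynomial_function P" "\<And>z. z \<in> sphere 0 1 \<Longrightarrow> \<bar>G z - P z\<bar> < \<eta>" by auto
    let ?g = "\<lambda>t. complex_of_real (G (ee t))" and ?p = "\<lambda>t. complex_of_real (P (ee t))"
    have le: "cmod (?g t - ?p t) \<le> \<eta>" for t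
      using P(2)[of "ee t"] by (simp flip: of_real_diff)
    have "R (\<lambda>t. ?p t * 1)" using pol[OF P(1)] R1 by blast
    then have Rp: "indep_rel f y ?p" "continuous_on {0..1} ?p"
      unfolding R_def by (auto dest: spec[of _ 0] intro: continuous_on_subset)
    have "cmod (mean (\<lambda>n. f n * ?g (y n)) N - mean f N * integral {0..1} ?g
        - (mean (\<lambda>n. f n * ?p (y n)) N - mean f N * integral {0..1} ?p)) \<le> \<epsilon>" for N
    proof -
      have 1: "cmod (mean (\<lambda>n. f n * (?g (y n) - ?p (y n))) N) \<le> B * \<eta>"
        using f le B \<eta> by (intro mean_bound) (auto simp: norm_mult intro!: mult_mono)
      have "cmod (integral {0..1} (\<lambda>t. ?g t - ?p t)) \<le> \<eta> * (1 - 0)"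
        by (intro integral_bound) (auto intro!: continuous_intros contG Rp le)
      then have 2: "cmod (mean f N * integral {0..1} (\<lambda>t. ?g t - ?p t)) \<le> B * \<eta>"
        using mean_bound[of f B N] f B by (auto simp: norm_mult intro!: mult_mono)
      have "integral {0..1} (\<lambda>t. ?g t - ?p t) = integral {0..1} ?g - integral {0..1} ?p"
        by (intro integral_diff integrable_continuous_interval contG Rp)
      then have "mean (\<lambda>n. f n * ?g (y n)) N - mean f N * integral {0..1} ?g
        - (mean (\<lambda>n. f n * ?p (y n)) N - mean f N * integral {0..1} ?p)
        = mean (\<lambda>n. f n * (?g (y n) - ?p (y n))) N - mean f N * integral {0..1} (\<lambda>t. ?g t - ?p t)"
        by (simp add: right_diff_distrib mean_diff)
      then show ?thesis
        using 1 2 \<eta>(2) norm_triangle_ineq4[of "mean (\<lambda>n. f n * (?g (y n) - ?p (y n))) N" "mean f N * integral {0..1} (\<lambda>t. ?g t - ?p t)"]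
        by simp
    qed
    with Rp(1) show "\<exists>t. t \<longlonglongrightarrow> 0 \<and> (\<forall>\<^sub>F N in sequentially.
      cmod (mean (\<lambda>n. f n * ?g (y n)) N - mean f N * integral {0..1} ?g - t N) \<le> \<epsilon>)"
      unfolding indep_rel_def by (intro exI[of _ "\<lambda>N. mean (\<lambda>n. f n * ?p (y n)) N - mean f N * integral {0..1} ?p"]) auto
  qed
qed

text \<open>
  The tent lies below four times the Fejer kernel, whose integral is the coefficient \<open>1 / M\<close>
  of frequency 0.
\<close>

lemma integral_damp_le:
  assumes "M > 0"
  shows "integral {0..1} (\<lambda>t. damp (1 / (2 * real M)) (ee t)) \<le> 4 / real M"
proof -
  let ?d = "1 / (2 * real M)"
  have cf: "continuous_on {0..1} (fejer M)"
    unfolding fejer_def by (intro continuous_intros continuous_ee) (use assms in auto)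
  have "complex_of_real (integral {0..1} (fejer M)) = integral {0..1} (\<lambda>t. of_real (fejer M t))"
    using integral_linear[OF integrable_continuous_interval[OF cf] bounded_linear_of_real[where 'a = complex]] by (simp add: o_def)
  also have "\<dots> = integral {0..1} (\<lambda>t. (\<Sum>i<M. \<Sum>j<M. ee (of_int (int i - int j) * t)) / of_nat M ^ 2)"
    by (simp only: fejer_expand of_int_diff of_int_of_nat_eq)
  also have "\<dots> = (\<Sum>i<M. \<Sum>j<M. integral {0..1} (\<lambda>t. ee (of_int (int i - int j) * t))) / of_nat M ^ 2"
    unfolding integral_divide
    by (subst integral_sum, (auto intro!: integrable_continuous_interval continuous_intros continuous_ee)[2],
        intro arg_cong2[where f = "(/)"] sum.cong refl,
        subst integral_sum, (auto intro!: integrable_continuous_interval continuous_intros continuous_ee)[2], simp)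
  also have "\<dots> = (\<Sum>i<M. \<Sum>j<M. of_bool (i = j)) / of_nat M ^ 2"
  proof (intro arg_cong2[where f = "(/)"] sum.cong refl)
    fix i j
    show "integral {0..1} (\<lambda>t. ee (of_int (int i - int j) * t)) = of_bool (i = j)"
      using integral_ee[of "int i - int j"] by (cases "i = j") auto
  qed
  also have "\<dots> = complex_of_real (1 / real M)"
    using assms by (simp add: power2_eq_square of_bool_def)
  finally have i: "integral {0..1} (fejer M) = 1 / real M"
    by (simp only: of_real_eq_iff)
  have "integral {0..1} (\<lambda>t. damp ?d (ee t)) \<le> integral {0..1} (\<lambda>t. 4 * fejer M t)"
  proof (rule integral_le)
    show "(\<lambda>t. damp ?d (ee t)) integrable_on {0..1}"
      using assms by (intro integrable_continuous_interval continuous_on_compose2[OF continuous_damp[of ?d UNIV]] continuous_ee continuous_on_id) auto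
    show "(\<lambda>t. 4 * fejer M t) integrable_on {0..1}"
      by (intro integrable_continuous_interval continuous_intros cf)
    show "damp ?d (ee t) \<le> 4 * fejer M t" for t
      using damp_le_of_bool[of ?d "ee t"] fejer_ge[of M t] assms fejer_nonneg[of M t]
      by (cases "cmod (ee t - 1) < ?d") (auto simp: field_simps)
  qed
  then show ?thesis using i by simp
qed

text \<open>
  The test function need not agree at 0 and 1. The Weyl sums of \<open>y\<close> itself bound how often \<open>y\<close>
  falls into the region where the damping is felt.
\<close>

theorem equidistributed_frac:
  assumes f: "\<And>n. cmod (f n) \<le> B"
    and orth: "\<And>m::int. m \<noteq> 0 \<Longrightarrow> mean (\<lambda>n. f n * ee (of_int m * y n)) \<longlonglongrightarrow> 0"
    and unif: "\<And>m::int. m \<noteq> 0 \<Longrightarrow> mean (\<lambda>n. ee (of_int m * y n)) \<longlonglongrightarrow> 0"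
    and g: "continuous_on {0..1} (g :: real \<Rightarrow> real)"
  shows "(\<lambda>N. mean (\<lambda>n. f n * of_real (g (frac (y n)))) N - mean f N * of_real (integral {0..1} g)) \<longlonglongrightarrow> 0"
proof (rule tendsto_zero_by_approx)
  fix \<epsilon> :: real assume eps: "\<epsilon> > 0"
  have B: "B \<ge> 0" using f[of 0] norm_ge_zero order_trans by blast
  from g have "bounded (g ` {0..1})" by (intro compact_imp_bounded compact_continuous_image) auto
  then obtain C where C: "C > 0" "\<And>t. t \<in> {0..1} \<Longrightarrow> \<bar>g t\<bar> \<le> C"
    by (metis bounded_pos imageI real_norm_def)
  define M where "M = nat \<lceil>10 * B * C / \<epsilon>\<rceil> + 1"
  have M: "M > 0" "10 * B * C \<le> \<epsilon> * real M"
  proof -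
    have "10 * B * C / \<epsilon> \<le> real M" unfolding M_def by linarith
    then show "10 * B * C \<le> \<epsilon> * real M" using eps by (simp add: field_simps)
  qed (simp add: M_def)
  let ?d = "1 / (2 * real M)"
  have d: "?d > 0" using M by simp
  define G where "G z = g (Arg2pi z / (2 * pi)) * (1 - damp ?d z)" for z
  have cG: "continuous_on (sphere 0 1) G"
    unfolding G_def by (rule continuous_damped_angle[OF g d])
  have cGe: "continuous_on {0..1} (\<lambda>t. G (ee t))"
    by (intro continuous_on_compose2[OF cG] continuous_ee continuous_on_id) auto
  have cde: "continuous_on {0..1} (\<lambda>t. damp ?d (ee t))"
    by (intro continuous_on_compose2[OF continuous_damp[OF d, of UNIV]] continuous_ee continuous_on_id) auto
  have err: "\<bar>g (frac t) - G (ee t)\<bar> \<le> C * damp ?d (ee t)" for t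
    unfolding G_def using C(2)[of "frac t"] frac_lt_1[of t] by (intro damped_angle_error d) auto
  have err': "\<bar>g t - G (ee t)\<bar> \<le> C * damp ?d (ee t)" if t: "t \<in> {0..1}" for t
  proof (cases "t = 1")
    case True
    have "ee 1 = 1" using ee_eq_1_iff[of 1] by simp
    then show ?thesis using C(2)[of 1] True by (simp add: G_def damp_def)
  next
    case False
    then have "frac t = t" using t by (simp add: frac_eq)
    then show ?thesis using err[of t] by simp
  qed
  have Ic: "\<bar>integral {0..1} g - integral {0..1} (\<lambda>t. G (ee t))\<bar> \<le> C * (4 / real M)"
  proof -
    have "\<bar>integral {0..1} (\<lambda>t. g t - G (ee t))\<bar> \<le> integral {0..1} (\<lambda>t. C * damp ?d (ee t))"
      unfolding real_norm_def[symmetric]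
      by (rule integral_norm_bound_integral)
        (auto intro!: integrable_continuous_interval continuous_intros g cGe cde simp: err'[simplified])
    also have "\<dots> \<le> C * (4 / real M)"
      using mult_left_mono[OF integral_damp_le[OF M(1)], of C] C(1) by simp
    also have "integral {0..1} (\<lambda>t. g t - G (ee t)) = integral {0..1} g - integral {0..1} (\<lambda>t. G (ee t))"
      by (intro integral_diff integrable_continuous_interval g cGe)
    finally show ?thesis .
  qed
  have "mean (\<lambda>n. fejer M (y n)) \<longlonglongrightarrow> 1 / real M"
    by (rule tendsto_fejer_mean[OF unif M(1)])
  from order_tendstoD(2)[OF this, of "1.25 / real M"] M(1)
  have "\<forall>\<^sub>F N in sequentially. mean (\<lambda>n. fejer M (y n)) N < 1.25 / real M" by (simp add: field_simps)
  then have "\<forall>\<^sub>F N in sequentially. cmod (mean (\<lambda>n. f n * of_real (g (frac (y n)))) N - mean f N * of_real (integral {0..1} g) -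
    (mean (\<lambda>n. f n * of_real (G (ee (y n)))) N - mean f N * of_real (integral {0..1} (\<lambda>t. G (ee t))))) \<le> \<epsilon>"
  proof eventually_elim
    case (elim N)
    let ?a = "mean (\<lambda>n. f n * of_real (g (frac (y n)) - G (ee (y n)))) N"
    let ?b = "mean f N * of_real (integral {0..1} g - integral {0..1} (\<lambda>t. G (ee t)))"
    have "cmod ?a \<le> mean (\<lambda>n. cmod (f n * of_real (g (frac (y n)) - G (ee (y n))))) N"
      by (rule norm_mean_le)
    also have "\<dots> \<le> mean (\<lambda>n. B * C * (4 * fejer M (y n))) N"
    proof (rule mean_mono)
      fix n
      have "damp ?d (ee (y n)) \<le> 4 * fejer M (y n)"
        using damp_le_of_bool[of ?d "ee (y n)"] fejer_ge[of M "y n"] M(1) fejer_nonneg[of M "y n"]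
        by (cases "cmod (ee (y n) - 1) < ?d") (auto simp: field_simps)
      then have "C * damp ?d (ee (y n)) \<le> C * (4 * fejer M (y n))"
        using C(1) by simp
      then have "cmod (f n) * \<bar>g (frac (y n)) - G (ee (y n))\<bar> \<le> B * (C * (4 * fejer M (y n)))"
        using err[of "y n"] by (intro mult_mono f B) auto
      then show "cmod (f n * of_real (g (frac (y n)) - G (ee (y n)))) \<le> B * C * (4 * fejer M (y n))"
        unfolding norm_mult norm_of_real by (simp add: mult_ac)
    qed
    also have "\<dots> = 4 * (B * C) * mean (\<lambda>n. fejer M (y n)) N"
      by (simp add: mean_cmult)
    also have "\<dots> \<le> 4 * (B * C) * (1.25 / real M)"
      using elim B C(1) by (intro mult_left_mono) auto
    finally have 1: "cmod ?a \<le> 5 * B * C / real M" by simp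
    have "C * (4 / real M) \<le> C * (5 / real M)"
      using C(1) by (intro mult_left_mono divide_right_mono) auto
    from order.trans[OF Ic this] have "cmod ?b \<le> B * (C * (5 / real M))"
      unfolding norm_mult norm_of_real by (intro mult_mono mean_bound f B) auto
    then have "cmod ?b \<le> 5 * B * C / real M" by (simp add: mult_ac)
    with 1 have "cmod (?a - ?b) \<le> 10 * B * C / real M"
      using norm_triangle_ineq4[of ?a ?b] by simp
    also have "\<dots> \<le> \<epsilon>" using M by (simp add: field_simps)
    also have "?a - ?b = mean (\<lambda>n. f n * of_real (g (frac (y n)))) N - mean f N * of_real (integral {0..1} g) -
      (mean (\<lambda>n. f n * of_real (G (ee (y n)))) N - mean f N * of_real (integral {0..1} (\<lambda>t. G (ee t))))"
      by (simp add: right_diff_distrib mean_diff)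
    finally show ?case .
  qed
  moreover have "complex_of_real (integral {0..1} (\<lambda>t. G (ee t))) = integral {0..1} (\<lambda>t. of_real (G (ee t)))"
    using integral_linear[OF integrable_continuous_interval[OF cGe] bounded_linear_of_real[where 'a = complex]] by (simp add: o_def)
  ultimately show "\<exists>t. t \<longlonglongrightarrow> 0 \<and> (\<forall>\<^sub>F N in sequentially.
      cmod (mean (\<lambda>n. f n * of_real (g (frac (y n)))) N - mean f N * of_real (integral {0..1} g) - t N) \<le> \<epsilon>)"
    using equidistributed_circle[OF f orth cG, unfolded indep_rel_def] by auto
qed

section \<open>Uniform distribution and exponential sums\<close>

lemma mean_of_bool: "mean (\<lambda>n. of_bool (P n)) N = real (card {n \<in> {1..N}. P n}) / real N"
proof -
  have "(\<Sum>n=1..N. of_bool (P n)) = real (card {n \<in> {1..N}. P n})"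
    by (simp add: of_bool_def sum.If_cases Int_def)
  then show ?thesis by (simp add: mean_def)
qed

lemma unif_dist_mod1_mean:
  "unif_dist_mod1 u \<longleftrightarrow> (\<forall>a b. 0 \<le> a \<and> a < b \<and> b \<le> 1 \<longrightarrow>
     mean (\<lambda>n. of_bool (a \<le> frac (u n) \<and> frac (u n) < b)) \<longlonglongrightarrow> b - a)"
  unfolding unif_dist_mod1_def mean_of_bool[abs_def] ..

lemma tendsto_mean_frac:
  assumes "\<And>m::int. m \<noteq> 0 \<Longrightarrow> mean (\<lambda>n. ee (of_int m * u n)) \<longlonglongrightarrow> 0"
    and "continuous_on {0..1} (g :: real \<Rightarrow> real)"
  shows "mean (\<lambda>n. g (frac (u n))) \<longlonglongrightarrow> integral {0..1} g"
proof -
  have "(\<lambda>N. mean (\<lambda>n. of_real (g (frac (u n)))) N - mean (\<lambda>n. 1) N * complex_of_real (integral {0..1} g)) \<longlonglongrightarrow> 0"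
    using equidistributed_frac[of "\<lambda>n. 1" 1 u g] assms by simp
  from tendsto_add[OF this tendsto_mult_right[OF tendsto_mean_const[of 1], of "complex_of_real (integral {0..1} g)"]]
  have "(\<lambda>N. complex_of_real (mean (\<lambda>n. g (frac (u n))) N)) \<longlonglongrightarrow> of_real (integral {0..1} g)"
    by (simp add: mean_of_real)
  then show ?thesis by (simp only: tendsto_of_real_iff)
qed

text \<open>
  Lower bounds alone are enough for uniform distribution, because the proportions of three
  complementary intervals add up to 1.
\<close>

lemma eventually_mean_interval_ge:
  assumes W: "\<And>m::int. m \<noteq> 0 \<Longrightarrow> mean (\<lambda>n. ee (of_int m * u n)) \<longlonglongrightarrow> 0"
    and ab: "0 \<le> a" "b \<le> 1" and e: "e > 0"
  shows "\<forall>\<^sub>F N in sequentially. mean (\<lambda>n. of_bool (a \<le> frac (u n) \<and> frac (u n) < b)) N \<ge> b - a - e"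
proof (cases "b - a > e")
  case True
  \<comment> \<open>A trapezoidal minorant of the indicator function with slopes of width \<open>\<eta>\<close>.\<close>
  define \<eta> where "\<eta> = e / 4"
  define l where "l t = max 0 (min 1 (min (t - a) (b - t) / \<eta>))" for t
  have eta: "\<eta> > 0" using e by (simp add: \<eta>_def)
  have cl: "continuous_on S l" for S
    unfolding l_def using eta by (intro continuous_intros) auto
  have le: "l t \<le> of_bool (a \<le> t \<and> t < b)" for t
    using eta by (auto simp: l_def field_simps min_def)
  have "b - a - 2 * \<eta> = integral {a + \<eta>..b - \<eta>} (\<lambda>t. 1)"
    using True e by (simp add: \<eta>_def)
  also have "\<dots> \<le> integral {a + \<eta>..b - \<eta>} l"
    using eta by (intro integral_le integrable_continuous_interval cl continuous_on_const) (auto simp: l_def field_simps)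
  also have "\<dots> \<le> integral {0..1} l"
    using eta ab by (intro integral_subset_le integrable_continuous_interval cl) (auto simp: l_def)
  finally have "b - a - e < integral {0..1} l" using e by (simp add: \<eta>_def)
  moreover have "mean (\<lambda>n. l (frac (u n))) \<longlonglongrightarrow> integral {0..1} l"
    by (rule tendsto_mean_frac[OF W cl])
  ultimately have "\<forall>\<^sub>F N in sequentially. b - a - e < mean (\<lambda>n. l (frac (u n))) N"
    by (simp add: order_tendsto_iff)
  then show ?thesis
  proof eventually_elim
    case (elim N)
    have "mean (\<lambda>n. l (frac (u n))) N \<le> mean (\<lambda>n. of_bool (a \<le> frac (u n) \<and> frac (u n) < b)) N"
      by (rule mean_mono) (rule le)
    with elim show ?case by simp
  qed
next
  case False
  have "0 \<le> mean (\<lambda>n. of_bool (a \<le> frac (u n) \<and> frac (u n) < b) :: real) N" for N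
    by (simp add: mean_of_bool)
  with False show ?thesis by (intro always_eventually allI) (smt (verit))
qed

theorem weyl_sums_imp_unif_dist:
  assumes W: "\<And>m::int. m \<noteq> 0 \<Longrightarrow> mean (\<lambda>n. ee (of_int m * u n)) \<longlonglongrightarrow> 0"
  shows "unif_dist_mod1 u"
  unfolding unif_dist_mod1_mean
proof (intro allI impI, elim conjE)
  fix a b :: real assume ab: "0 \<le> a" "a < b" "b \<le> 1"
  let ?I = "\<lambda>a b N. mean (\<lambda>n. of_bool (a \<le> frac (u n) \<and> frac (u n) < b) :: real) N"
  show "?I a b \<longlonglongrightarrow> b - a"
  proof (rule tendstoI)
    fix e :: real assume "e > 0"
    then have e: "e / 3 > 0" by simp
    have "\<forall>\<^sub>F N in sequentially. ?I 0 a N \<ge> a - 0 - e / 3"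
      "\<forall>\<^sub>F N in sequentially. ?I a b N \<ge> b - a - e / 3"
      "\<forall>\<^sub>F N in sequentially. ?I b 1 N \<ge> 1 - b - e / 3"
      using ab e by (intro eventually_mean_interval_ge W; simp)+
    then show "\<forall>\<^sub>F N in sequentially. dist (?I a b N) (b - a) < e"
      using eventually_gt_at_top[of 0]
    proof eventually_elim
      case (elim N)
      have "of_bool (0 \<le> frac x \<and> frac x < a) + of_bool (a \<le> frac x \<and> frac x < b)
        + of_bool (b \<le> frac x \<and> frac x < 1) = (1::real)" for x :: real
        using ab frac_lt_1[of x] frac_ge_0[of x] by auto
      then have "?I 0 a N + ?I a b N + ?I b 1 N = mean (\<lambda>n. 1) N"
        by (simp only: mean_add[symmetric])
      also have "\<dots> = 1" using elim by (simp add: mean_const)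
      finally show ?case using elim \<open>e > 0\<close> unfolding dist_real_def by (simp add: abs_if)
    qed
  qed
qed

lemma dist_ee_le: "cmod (ee s - ee t) \<le> 2 * pi * \<bar>s - t\<bar>"
proof -
  have "ee s - ee t = ee t * (ee (s - t) - 1)"
    by (simp add: right_diff_distrib ee_add[symmetric])
  then have "cmod (ee s - ee t) = cmod (ee (s - t) - 1)" by (simp add: norm_mult)
  also have "\<dots> = 2 * \<bar>sin (2 * pi * (s - t) / 2)\<bar>"
    unfolding ee_def cis_conv_exp dist_exp_i_1 ..
  also have "\<dots> \<le> 2 * \<bar>2 * pi * (s - t) / 2\<bar>"
    by (intro mult_left_mono abs_sin_x_le_abs_x) auto
  finally show ?thesis by (simp add: abs_mult)
qed

text \<open>
  On the intervals \<open>[i/K, (i+1)/K)\<close> the character is constant up to \<open>O(1/K)\<close>, and its values at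
  the left end points run through roots of unity with vanishing sum as soon as \<open>K > |m|\<close>.
\<close>

theorem unif_dist_imp_weyl_sums:
  assumes u: "unif_dist_mod1 u" and m: "m \<noteq> (0::int)"
  shows "mean (\<lambda>n. ee (of_int m * u n)) \<longlonglongrightarrow> 0"
proof (rule tendsto_zero_by_approx)
  fix \<epsilon> :: real assume eps: "\<epsilon> > 0"
  define K where "K = nat \<lceil>2 * pi * \<bar>of_int m\<bar> / \<epsilon>\<rceil> + nat \<bar>m\<bar> + 1"
  have K: "real K > \<bar>of_int m\<bar>" "K > 0" "2 * pi * \<bar>of_int m\<bar> \<le> \<epsilon> * real K"
  proof -
    have "real (nat \<bar>m\<bar>) = \<bar>of_int m\<bar>" by simp
    then show "real K > \<bar>of_int m\<bar>" unfolding K_def by linarith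
    have "2 * pi * \<bar>of_int m\<bar> / \<epsilon> \<le> real K" unfolding K_def by linarith
    then show "2 * pi * \<bar>of_int m\<bar> \<le> \<epsilon> * real K" using eps by (simp add: field_simps)
  qed (simp add: K_def)
  define I where "I i x = (of_bool (real i / real K \<le> frac x \<and> frac x < real (Suc i) / real K) :: real)" for i x
  define S where "S x = (\<Sum>i<K. ee (of_int m * (real i / real K)) * of_real (I i x))" for x
  have near: "cmod (ee (of_int m * x) - S x) \<le> \<epsilon>" for x
  proof -
    define i0 where "i0 = nat \<lfloor>real K * frac x\<rfloor>"
    have fl: "real i0 \<le> real K * frac x" "real K * frac x < real i0 + 1"
    proof -
      have "real i0 = of_int \<lfloor>real K * frac x\<rfloor>" by (simp add: i0_def)
      then show "real i0 \<le> real K * frac x" "real K * frac x < real i0 + 1" by linarith+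
    qed
    have "real K * frac x < real K" using K(2) frac_lt_1[of x] by simp
    then have i0K: "i0 < K" using fl by linarith
    have Ii: "I i x = of_bool (i = i0)" for i
    proof -
      have "real i / real K \<le> frac x \<and> frac x < real (Suc i) / real K \<longleftrightarrow>
         real i \<le> real K * frac x \<and> real K * frac x < real i + 1"
        using K(2) by (auto simp: field_simps)
      also have "\<dots> \<longleftrightarrow> i = i0"
        using fl by linarith
      finally show ?thesis by (simp add: I_def)
    qed
    have "S x = (\<Sum>i<K. if i = i0 then ee (of_int m * (real i / real K)) else 0)"
      unfolding S_def Ii by (intro sum.cong) auto
    also have "\<dots> = ee (of_int m * (real i0 / real K))"
      using i0K by simp
    finally have "S x = ee (of_int m * (real i0 / real K))" .
    moreover have "ee (of_int m * x) = ee (of_int m * frac x)"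
      by (rule ee_cong_Ints) (simp add: frac_def algebra_simps)
    ultimately have "cmod (ee (of_int m * x) - S x) \<le> 2 * pi * \<bar>of_int m * (frac x - real i0 / real K)\<bar>"
      using dist_ee_le[of "of_int m * frac x" "of_int m * (real i0 / real K)"] by (simp add: right_diff_distrib)
    also have "\<dots> = 2 * pi * \<bar>of_int m\<bar> * \<bar>frac x - real i0 / real K\<bar>" by (simp add: abs_mult)
    also have "frac x - real i0 / real K = (real K * frac x - real i0) / real K"
      using K(2) by (simp add: field_simps)
    also have "2 * pi * \<bar>of_int m\<bar> * \<bar>(real K * frac x - real i0) / real K\<bar> \<le> 2 * pi * \<bar>of_int m\<bar> * (1 / real K)"
      unfolding abs_divide using fl K(2) by (intro mult_left_mono divide_right_mono mult_nonneg_nonneg frac_le) auto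
    also have "\<dots> \<le> \<epsilon>" using K by (simp add: field_simps)
    finally show ?thesis .
  qed
  have "mean (\<lambda>n. S (u n)) \<longlonglongrightarrow> 0"
  proof -
    have mI: "mean (\<lambda>n. I i (u n)) \<longlonglongrightarrow> 1 / real K" if "i < K" for i
    proof -
      have "mean (\<lambda>n. I i (u n)) \<longlonglongrightarrow> real (Suc i) / real K - real i / real K"
        using u[unfolded unif_dist_mod1_mean, rule_format, of "real i / real K" "real (Suc i) / real K"] that K
        unfolding I_def by (simp add: divide_strict_right_mono)
      moreover have "real (Suc i) / real K - real i / real K = 1 / real K"
        by (simp add: diff_divide_distrib[symmetric])
      ultimately show ?thesis by (simp only:)
    qed
    have "(\<lambda>N. \<Sum>i<K. ee (of_int m * (real i / real K)) * of_real (mean (\<lambda>n. I i (u n)) N))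
      \<longlonglongrightarrow> (\<Sum>i<K. ee (of_int m * (real i / real K)) * of_real (1 / real K))"
      by (intro tendsto_intros mI) auto
    moreover have "(\<Sum>i<K. ee (of_int m * (real i / real K)) * of_real (1 / real K)) = 0"
    proof -
      let ?z = "ee (of_int m / real K)"
      have "?z ^ K = ee (real K * (of_int m / real K))" by (rule ee_mult_nat[symmetric])
      also have "\<dots> = 1" using K(2) by (simp add: ee_eq_1_iff)
      finally have zK: "?z ^ K = 1" .
      have "?z \<noteq> 1"
      proof
        assume "?z = 1"
        then obtain l :: int where "of_int m / real K = of_int l" by (auto simp: ee_eq_1_iff elim: Ints_cases)
        then have l: "of_int m = real_of_int l * real K" using K(2) by (simp add: field_simps)
        with m have "l \<noteq> 0" by auto
        then have "\<bar>real_of_int l\<bar> \<ge> 1" by linarith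
        then have "\<bar>real_of_int l\<bar> * real K \<ge> 1 * real K" by (intro mult_right_mono) auto
        then have "\<bar>real_of_int m\<bar> \<ge> real K" unfolding l by (simp add: abs_mult)
        with K(1) show False by simp
      qed
      then have "(\<Sum>i<K. ?z ^ i) = 0" using zK by (simp add: geometric_sum)
      moreover have "ee (of_int m * (real i / real K)) = ?z ^ i" for i
        unfolding ee_mult_nat[symmetric] by (simp add: mult.commute)
      ultimately show ?thesis by (simp only: sum_distrib_right[symmetric] mult_zero_left)
    qed
    moreover have "mean (\<lambda>n. S (u n)) = (\<lambda>N. \<Sum>i<K. ee (of_int m * (real i / real K)) * of_real (mean (\<lambda>n. I i (u n)) N))"
      by (rule ext) (simp only: S_def mean_sum mean_cmult mean_of_real)
    ultimately show ?thesis by (simp only:)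
  qed
  moreover have "cmod (mean (\<lambda>n. ee (of_int m * u n)) N - mean (\<lambda>n. S (u n)) N) \<le> \<epsilon>" for N
    unfolding mean_diff[symmetric] using near eps by (intro mean_bound) auto
  ultimately show "\<exists>t. t \<longlonglongrightarrow> 0 \<and> (\<forall>\<^sub>F N in sequentially. cmod (mean (\<lambda>n. ee (of_int m * u n)) N - t N) \<le> \<epsilon>)"
    by (intro exI[of _ "mean (\<lambda>n. S (u n))"]) auto
qed

section \<open>Asymptotically independent uniform sequences\<close>

text \<open>
  Asymptotically, \<open>v\<close> is uniform on the unit interval and independent of everything in
  \<open>phase_class d\<close>.
\<close>

definition unif_indep :: "nat \<Rightarrow> (nat \<Rightarrow> real) \<Rightarrow> bool" where
  "unif_indep d v \<longleftrightarrow> (\<forall>n. v n \<in> {0..1}) \<and>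
     (\<forall>f\<in>phase_class d. \<forall>g. continuous_on {0..1} g \<longrightarrow>
        (\<lambda>N. mean (\<lambda>n. f n * of_real (g (v n))) N - mean f N * of_real (integral {0..1} g)) \<longlonglongrightarrow> 0)"

lemma unif_indepD:
  "unif_indep d v \<Longrightarrow> f \<in> phase_class d \<Longrightarrow> continuous_on {0..1} g \<Longrightarrow>
    (\<lambda>N. mean (\<lambda>n. f n * of_real (g (v n))) N - mean f N * of_real (integral {0..1} g)) \<longlonglongrightarrow> 0"
  by (auto simp: unif_indep_def)

lemma unif_indep_frac:
  assumes "\<And>f m. f \<in> phase_class d \<Longrightarrow> m \<noteq> (0::int) \<Longrightarrow> mean (\<lambda>n. f n * ee (of_int m * y n)) \<longlonglongrightarrow> 0"
  shows "unif_indep d (\<lambda>n. frac (y n))"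
  unfolding unif_indep_def
proof (intro conjI allI ballI impI)
  show "frac (y n) \<in> {0..1}" for n using frac_lt_1[of "y n"] by simp
  fix f and g :: "real \<Rightarrow> real"
  assume f: "f \<in> phase_class d" and g: "continuous_on {0..1} g"
  from phase_class_bounded[OF f] obtain B where B: "\<And>n. cmod (f n) \<le> B" by blast
  show "(\<lambda>N. mean (\<lambda>n. f n * of_real (g (frac (y n)))) N - mean f N * of_real (integral {0..1} g)) \<longlonglongrightarrow> 0"
    by (rule equidistributed_frac[OF B assms[OF f] _ g]) (use assms[OF phase_class_const[of 1]] in auto)
qed

text \<open>
  This is \<open>(exp u - 1) / u\<close>, that is, the integral of \<open>exp (u t)\<close> over the unit interval. The power series
  covers \<open>u = 0\<close> and shows that the phase classes are closed under it.
\<close>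

definition exp_avg :: "complex \<Rightarrow> complex" where
  "exp_avg u = (\<Sum>k. inverse (fact (Suc k)) * u ^ k)"

lemma summable_exp_avg: "summable (\<lambda>k. norm (inverse (fact (Suc k)) * u ^ k :: complex))"
proof (rule summable_comparison_test')
  show "summable (\<lambda>k. norm (inverse (fact k) * u ^ k :: complex))"
    using summable_norm_exp[of u] by (simp add: norm_mult norm_inverse)
  show "norm (norm (inverse (fact (Suc k)) * u ^ k :: complex)) \<le> norm (inverse (fact k) * u ^ k :: complex)" if "k \<ge> 0" for k
    by (auto simp: norm_mult norm_inverse norm_power simp del: fact_Suc intro!: mult_right_mono le_imp_inverse_le fact_mono)
qed

lemma exp_avg_mult: "u * exp_avg u = exp u - 1"
proof -
  have "u * exp_avg u = (\<Sum>k. u * (inverse (fact (Suc k)) * u ^ k))"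
    unfolding exp_avg_def using summable_norm_cancel[OF summable_exp_avg] by (rule suminf_mult[symmetric])
  also have "\<dots> = exp u - 1"
    by (subst exp_first_term) (simp add: scaleR_conv_of_real mult_ac del: fact_Suc)
  finally show ?thesis .
qed

lemma exp_avg_0 [simp]: "exp_avg 0 = 1"
  unfolding exp_avg_def by (subst suminf_finite[of "{0}"]) auto

lemma exp_avg_ii_bound: "\<bar>x\<bar> * cmod (exp_avg (\<i> * of_real x)) \<le> min 2 \<bar>x\<bar>"
proof -
  have "cmod (\<i> * of_real x * exp_avg (\<i> * of_real x)) = cmod (ee (x / (2 * pi)) - ee 0)"
    by (simp only: exp_avg_mult) (simp add: ee_def cis_conv_exp)
  also have "\<dots> \<le> min 2 \<bar>x\<bar>"
    using dist_ee_le[of "x / (2 * pi)" 0] norm_triangle_ineq4[of "ee (x / (2 * pi))" "ee 0"] by simp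
  finally show ?thesis by (simp add: norm_mult)
qed

lemma exp_avg_ii_le_1: "cmod (exp_avg (\<i> * of_real x)) \<le> 1"
proof (cases "x = 0")
  case False
  then have "\<bar>x\<bar> * cmod (exp_avg (\<i> * of_real x)) \<le> \<bar>x\<bar> * 1"
    using exp_avg_ii_bound[of x] by simp
  with False show ?thesis by (subst (asm) mult_le_cancel_left_pos) auto
qed auto

lemma phase_class_exp_avg: "u \<in> phase_class d \<Longrightarrow> (\<lambda>n. exp_avg (u n)) \<in> phase_class d"
  unfolding exp_avg_def by (rule phase_class_power_series[OF _ summable_exp_avg])

lemma integral_power_01: "integral {0..1} (\<lambda>t::real. t ^ k) = 1 / real (Suc k)"
proof -
  have "((\<lambda>t::real. t ^ k) has_integral (1 ^ Suc k / real (Suc k) - 0 ^ Suc k / real (Suc k))) {0..1}"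
    by (rule fundamental_theorem_of_calculus)
      (auto intro!: derivative_eq_intros simp: has_real_derivative_iff_has_vector_derivative[symmetric] simp del: power_Suc)
  then show ?thesis by (simp add: integral_unique)
qed

text \<open>
  Integrating out \<open>v\<close>: expand the exponential, and replace each moment \<open>v^k\<close> by \<open>1 / (k + 1)\<close>.
\<close>

lemma unif_indep_exp:
  assumes v: "unif_indep d v" and f: "f \<in> phase_class d" and u: "u \<in> phase_class d"
  shows "(\<lambda>N. mean (\<lambda>n. f n * exp (u n * of_real (v n))) N - mean (\<lambda>n. f n * exp_avg (u n)) N) \<longlonglongrightarrow> 0"
proof (rule tendsto_zero_by_approx)
  fix \<epsilon> :: real assume eps: "\<epsilon> > 0"
  from phase_class_bounded[OF f] obtain A where A: "A > 0" "\<And>n. cmod (f n) \<le> A" by blast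
  from phase_class_bounded[OF u] obtain B where B: "B > 0" "\<And>n. cmod (u n) \<le> B" by blast
  define \<eta> where "\<eta> = \<epsilon> / (2 * A)"
  have eta: "\<eta> > 0" "A * \<eta> + A * \<eta> = \<epsilon>" using A eps by (auto simp: \<eta>_def field_simps)
  have se: "summable (\<lambda>k. norm (inverse (fact k) * z ^ k :: complex))" for z
    using summable_norm_exp[of z] by (simp add: norm_mult norm_inverse)
  have ex: "exp z = (\<Sum>k. inverse (fact k) * z ^ k)" for z :: complex
    by (simp add: exp_def scaleR_conv_of_real)
  from eventually_happens'[OF sequentially_bot eventually_conj[OF power_series_uniform[OF se B(1) eta(1)]
      power_series_uniform[OF summable_exp_avg B(1) eta(1)]]]
  obtain K where K1: "\<And>z. cmod z \<le> B \<Longrightarrow> cmod (exp z - (\<Sum>k<K. inverse (fact k) * z ^ k)) \<le> \<eta>"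
    and K2: "\<And>z. cmod z \<le> B \<Longrightarrow> cmod (exp_avg z - (\<Sum>k<K. inverse (fact (Suc k)) * z ^ k)) \<le> \<eta>"
    unfolding ex exp_avg_def by blast
  define P where "P n = (\<Sum>k<K. inverse (fact k) * (u n * of_real (v n)) ^ k)" for n
  define Q where "Q n = (\<Sum>k<K. inverse (fact (Suc k)) * u n ^ k)" for n
  define F where "F k n = inverse (fact k) * (f n * u n ^ k)" for k n
  have F: "F k \<in> phase_class d" for k
    unfolding F_def[abs_def] by (intro phase_class_cmult phase_class_mult f phase_class_power u)
  have "(\<lambda>N. \<Sum>k<K. mean (\<lambda>n. F k n * of_real (v n ^ k)) N - mean (F k) N * of_real (integral {0..1} (\<lambda>t. t ^ k))) \<longlonglongrightarrow> (\<Sum>k<K. 0)"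
    by (intro tendsto_sum unif_indepD[OF v F] continuous_intros)
  moreover have "mean (\<lambda>n. f n * P n) N = (\<Sum>k<K. mean (\<lambda>n. F k n * of_real (v n ^ k)) N)" for N
    unfolding mean_sum[symmetric] P_def F_def
    by (simp add: sum_distrib_left power_mult_distrib mult_ac)
  moreover have "mean (\<lambda>n. f n * Q n) N = (\<Sum>k<K. mean (F k) N * of_real (integral {0..1} (\<lambda>t. t ^ k)))" for N
  proof -
    have "mean (\<lambda>n. f n * Q n) N = mean (\<lambda>n. \<Sum>k<K. of_real (integral {0..1} (\<lambda>t. t ^ k)) * F k n) N"
      unfolding Q_def F_def integral_power_01
      by (simp add: sum_distrib_left field_simps)
    then show ?thesis unfolding mean_sum mean_cmult by (simp only: mult.commute)
  qed
  ultimately have lim: "(\<lambda>N. mean (\<lambda>n. f n * P n) N - mean (\<lambda>n. f n * Q n) N) \<longlonglongrightarrow> 0"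
    by (simp add: sum_subtractf)
  have b1: "cmod (mean (\<lambda>n. f n * (exp (u n * of_real (v n)) - P n)) N) \<le> A * \<eta>" for N
  proof (rule mean_bound)
    fix n
    have "\<bar>v n\<bar> \<le> 1" using v by (auto simp: unif_indep_def)
    then have "cmod (u n * of_real (v n)) \<le> B * 1"
      unfolding norm_mult using B by (intro mult_mono) auto
    then have "cmod (exp (u n * of_real (v n)) - P n) \<le> \<eta>"
      unfolding P_def by (intro K1) simp
    then show "cmod (f n * (exp (u n * of_real (v n)) - P n)) \<le> A * \<eta>"
      unfolding norm_mult using A by (intro mult_mono) auto
  qed (use A eta in auto)
  have b2: "cmod (mean (\<lambda>n. f n * (exp_avg (u n) - Q n)) N) \<le> A * \<eta>" for N
  proof (rule mean_bound)
    fix n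
    have "cmod (exp_avg (u n) - Q n) \<le> \<eta>"
      unfolding Q_def by (intro K2 B)
    then show "cmod (f n * (exp_avg (u n) - Q n)) \<le> A * \<eta>"
      unfolding norm_mult using A by (intro mult_mono) auto
  qed (use A eta in auto)
  have "cmod (mean (\<lambda>n. f n * exp (u n * of_real (v n))) N - mean (\<lambda>n. f n * exp_avg (u n)) N
      - (mean (\<lambda>n. f n * P n) N - mean (\<lambda>n. f n * Q n) N)) \<le> \<epsilon>" for N
    using b1[of N] b2[of N] eta(2) norm_triangle_ineq4[of "mean (\<lambda>n. f n * (exp (u n * of_real (v n)) - P n)) N"
        "mean (\<lambda>n. f n * (exp_avg (u n) - Q n)) N"]
    by (simp add: right_diff_distrib mean_diff algebra_simps)
  with lim show "\<exists>t. t \<longlonglongrightarrow> 0 \<and> (\<forall>\<^sub>F N in sequentially. cmod (mean (\<lambda>n. f n * exp (u n * of_real (v n))) N -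
      mean (\<lambda>n. f n * exp_avg (u n)) N - t N) \<le> \<epsilon>)"
    by (intro exI[of _ "\<lambda>N. mean (\<lambda>n. f n * P n) N - mean (\<lambda>n. f n * Q n) N"]) auto
qed

text \<open>
  Peel off the factor of largest index, which is independent of all the others.
\<close>

lemma tendsto_mean_prod:
  assumes v: "\<And>i. i < s \<Longrightarrow> unif_indep i (v i)" "\<And>i. i < s \<Longrightarrow> (\<lambda>n. of_real (v i n)) \<in> phase_class (Suc i)"
    and g: "\<And>i. i < s \<Longrightarrow> continuous_on {0..1} (g i :: real \<Rightarrow> real)"
  shows "mean (\<lambda>n. \<Prod>i<s. g i (v i n)) \<longlonglongrightarrow> (\<Prod>i<s. integral {0..1} (g i))"
proof -
  have "mean (\<lambda>n. complex_of_real (\<Prod>i<s. g i (v i n))) \<longlonglongrightarrow> of_real (\<Prod>i<s. integral {0..1} (g i))"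
    using assms
  proof (induction s)
    case 0
    show ?case using tendsto_mean_const[of "1::complex"] by simp
  next
    case (Suc s)
    let ?f = "\<lambda>n. complex_of_real (\<Prod>i<s. g i (v i n))"
    have IH: "mean ?f \<longlonglongrightarrow> of_real (\<Prod>i<s. integral {0..1} (g i))"
    proof (rule Suc.IH)
      fix i assume "i < s"
      then have i: "i < Suc s" by simp
      from Suc.prems(1)[OF i] show "unif_indep i (v i)" .
      from Suc.prems(2)[OF i] show "(\<lambda>n. of_real (v i n)) \<in> phase_class (Suc i)" .
      from Suc.prems(3)[OF i] show "continuous_on {0..1} (g i)" .
    qed
    have gv: "(\<lambda>n. of_real (g i (v i n))) \<in> phase_class s" if "i < s" for i
    proof (rule phase_class_mono)
      have "i < Suc s" using that by simp
      then show "(\<lambda>n. of_real (g i (v i n))) \<in> phase_class (Suc i)"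
        using Suc.prems(1)[of i]
        by (intro phase_class_continuous_Icc[OF Suc.prems(2) _ Suc.prems(3)]) (simp_all add: unif_indep_def)
    qed (use that in simp)
    have fs: "?f \<in> phase_class s"
      unfolding of_real_prod by (intro phase_class_prod gv) simp
    have "(\<lambda>N. mean (\<lambda>n. ?f n * of_real (g s (v s n))) N - mean ?f N * of_real (integral {0..1} (g s))) \<longlonglongrightarrow> 0"
      by (rule unif_indepD[OF Suc.prems(1)[OF lessI] fs Suc.prems(3)[OF lessI]])
    from tendsto_add[OF this tendsto_mult_right[OF IH, of "of_real (integral {0..1} (g s))"]]
    show ?case by (simp only: diff_add_cancel add_0_left prod.lessThan_Suc of_real_mult)
  qed
  then show ?thesis by (simp only: mean_of_real[abs_def] tendsto_of_real_iff)
qed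

section \<open>A logarithmic identity for nested integer parts\<close>

text \<open>
  This is \<open>- X d/dX log (1 - R)\<close>. It turns products into sums without leaving the formal power
  series with the denominators that the logarithm itself would bring in.
\<close>

definition log_deriv :: "real fps \<Rightarrow> real fps" where
  "log_deriv R = fps_X * fps_deriv R * inverse (1 - R)"

lemma log_deriv_eq:
  assumes "fps_nth R 0 = 0"
  shows "log_deriv R = fps_X * fps_deriv R + R * log_deriv R"
proof -
  have "log_deriv R * (1 - R) = fps_X * fps_deriv R"
    unfolding log_deriv_def using assms by (simp add: mult.assoc inverse_mult_eq_1)
  then show ?thesis by (simp add: algebra_simps)
qed

lemma log_deriv_nth:
  assumes "fps_nth R 0 = 0"
  shows "fps_nth (log_deriv R) j = real j * fps_nth R j + (\<Sum>i=1..<j. fps_nth R i * fps_nth (log_deriv R) (j - i))"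
proof (cases j)
  case 0
  then show ?thesis by (simp add: log_deriv_def)
next
  case (Suc k)
  have z: "fps_nth (log_deriv R) 0 = 0" by (simp add: log_deriv_def)
  have "{0..j} = insert 0 (insert j {1..<j})" using Suc by auto
  then have "fps_nth (R * log_deriv R) j = (\<Sum>i=1..<j. fps_nth R i * fps_nth (log_deriv R) (j - i))"
    unfolding fps_mult_nth using Suc assms z by simp
  moreover have "fps_nth (fps_X * fps_deriv R) j = real j * fps_nth R j"
    using Suc by simp
  ultimately show ?thesis
    using log_deriv_eq[OF assms] by (metis fps_add_nth)
qed

lemma log_deriv_mult:
  assumes R: "fps_nth R 0 = 0" and S: "fps_nth S 0 = 0" and T: "1 - T = (1 - R) * (1 - S)"
  shows "log_deriv T = log_deriv R + log_deriv S"
proof -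
  have "fps_deriv (1 - T) = fps_deriv ((1 - R) * (1 - S))" by (simp only: T)
  then have dT: "fps_deriv T = fps_deriv R * (1 - S) + fps_deriv S * (1 - R)"
    by (simp add: algebra_simps)
  have iT: "inverse (1 - T) = inverse (1 - R) * inverse (1 - S)"
    by (simp only: T fps_inverse_mult)
  have "inverse (1 - R) * (1 - R) = 1" "inverse (1 - S) * (1 - S) = 1"
    using R S by (auto intro!: inverse_mult_eq_1)
  then show ?thesis
    unfolding log_deriv_def dT iT by algebra
qed

lemma log_deriv_linear: "j \<ge> 1 \<Longrightarrow> fps_nth (log_deriv (fps_const c * fps_X)) j = c ^ j"
proof (induction j rule: nat_induct_at_least)
  case base
  then show ?case by (subst log_deriv_nth) auto
next
  case (Suc j)
  have "fps_nth (log_deriv (fps_const c * fps_X)) (Suc j) =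
      fps_nth (fps_X * fps_deriv (fps_const c * fps_X) + fps_const c * fps_X * log_deriv (fps_const c * fps_X)) (Suc j)"
    by (subst log_deriv_eq) auto
  also have "\<dots> = c * fps_nth (log_deriv (fps_const c * fps_X)) j"
    using Suc.hyps by (simp add: mult.assoc)
  finally show ?case using Suc.IH by simp
qed

definition gen_fps :: "(nat \<Rightarrow> real) \<Rightarrow> real fps" where
  "gen_fps r = Abs_fps (\<lambda>i. if i = 0 then 0 else r i)"

lemma gen_fps_nth: "fps_nth (gen_fps r) i = (if i = 0 then 0 else r i)"
  by (simp add: gen_fps_def)

text \<open>
  If \<open>1 - R = \<Prod> (1 - t_i X)\<close>, then these are the power sums \<open>\<Sum> t_i^j\<close>, and \<open>log_deriv_nth\<close> is
  Newton's recursion. In particular they are integer polynomials in \<open>r_1, \<dots>, r_j\<close>.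
\<close>

definition psum :: "(nat \<Rightarrow> real) \<Rightarrow> nat \<Rightarrow> real" where
  "psum r j = fps_nth (log_deriv (gen_fps r)) j"

text \<open>
  The part of \<open>psum r j\<close> that involves only entries of index below \<open>j\<close>.
\<close>

definition psum_lower :: "(nat \<Rightarrow> real) \<Rightarrow> nat \<Rightarrow> real" where
  "psum_lower r j = (\<Sum>i=1..<j. r i * psum r (j - i))"

lemma psum_rec: "j \<ge> 1 \<Longrightarrow> psum r j = real j * r j + psum_lower r j"
  unfolding psum_def psum_lower_def by (subst log_deriv_nth) (auto simp: gen_fps_nth)

text \<open>
  By Newton's recursion, any class of sequences that contains the natural constants and is closed
  under sums and products is closed under power sums. It is applied to fractional parts as well as to
  residues of integer parts.
\<close>

lemma psum_closed:
  fixes Q :: "('a \<Rightarrow> real) \<Rightarrow> bool"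
  assumes const: "\<And>k::nat. Q (\<lambda>n. real k)"
    and add: "\<And>f g. Q f \<Longrightarrow> Q g \<Longrightarrow> Q (\<lambda>n. f n + g n)"
    and mult: "\<And>f g. Q f \<Longrightarrow> Q g \<Longrightarrow> Q (\<lambda>n. f n * g n)"
  shows "(\<And>i. 1 \<le> i \<Longrightarrow> i \<le> j \<Longrightarrow> Q (r i)) \<Longrightarrow> j \<ge> 1 \<Longrightarrow> Q (\<lambda>n. psum (\<lambda>i. r i n) j)"
    and "(\<And>i. 1 \<le> i \<Longrightarrow> i < j \<Longrightarrow> Q (r i)) \<Longrightarrow> Q (\<lambda>n. psum_lower (\<lambda>i. r i n) j)"
proof -
  have sum: "Q (\<lambda>n. \<Sum>i\<in>A. f i n)" if "finite A" "\<And>i. i \<in> A \<Longrightarrow> Q (f i)" for A :: "nat set" and f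
    using that
  proof (induction A rule: finite_induct)
    case empty
    show ?case using const[of 0] by simp
  next
    case (insert x A)
    have "Q (\<lambda>n. f x n + (\<Sum>i\<in>A. f i n))"
      by (rule add) (use insert in auto)
    then show ?case using insert.hyps by simp
  qed
  have p: "Q (\<lambda>n. psum (\<lambda>i. r i n) j)" if "\<And>i. 1 \<le> i \<Longrightarrow> i \<le> j \<Longrightarrow> Q (r i)" "j \<ge> 1" for j
    using that
  proof (induction j rule: less_induct)
    case (less j)
    have "Q (\<lambda>n. real j * r j n + (\<Sum>i=1..<j. r i n * psum (\<lambda>i. r i n) (j - i)))"
      using less.prems by (intro add mult const sum less.IH) auto
    then show ?case using less.prems by (simp add: psum_rec psum_lower_def)
  qed
  show "(\<And>i. 1 \<le> i \<Longrightarrow> i \<le> j \<Longrightarrow> Q (r i)) \<Longrightarrow> j \<ge> 1 \<Longrightarrow> Q (\<lambda>n. psum (\<lambda>i. r i n) j)"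
    by (rule p)
  show "Q (\<lambda>n. psum_lower (\<lambda>i. r i n) j)" if "\<And>i. 1 \<le> i \<Longrightarrow> i < j \<Longrightarrow> Q (r i)"
    unfolding psum_lower_def using that by (intro sum mult p) auto
qed

text \<open>
  The recursion says \<open>1 - R = (1 - x X) A\<close>; now take logarithmic derivatives.
\<close>

lemma psum_identity:
  assumes a0: "a 0 = 1" and rec: "\<And>j. a (Suc j) + r (Suc j) = x * a j" and j: "j \<ge> 1"
  shows "psum r j = x ^ j + psum (\<lambda>i. - a i) j"
proof -
  have "1 - gen_fps r = (1 - fps_const x * fps_X) * (1 - gen_fps (\<lambda>i. - a i))"
  proof (rule fps_ext)
    fix n
    show "fps_nth (1 - gen_fps r) n = fps_nth ((1 - fps_const x * fps_X) * (1 - gen_fps (\<lambda>i. - a i))) n"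
    proof (cases n)
      case (Suc m)
      have "a (Suc m) = x * a m - r (Suc m)" using rec[of m] by simp
      then show ?thesis using Suc a0
        by (cases m) (simp_all add: left_diff_distrib gen_fps_nth mult.assoc)
    qed (simp add: gen_fps_nth)
  qed
  from log_deriv_mult[OF _ _ this] show ?thesis
    using log_deriv_linear[OF j, of x] by (simp add: psum_def gen_fps_nth)
qed

definition int_part :: "real \<Rightarrow> nat \<Rightarrow> nat \<Rightarrow> real" where
  "int_part \<alpha> j n = of_int \<lfloor>nested_floor (\<alpha> * real n) j\<rfloor>"

definition frac_part :: "real \<Rightarrow> nat \<Rightarrow> nat \<Rightarrow> real" where
  "frac_part \<alpha> j n = frac (nested_floor (\<alpha> * real n) j)"

lemma nested_floor_split: "nested_floor (\<alpha> * real n) j = int_part \<alpha> j n + frac_part \<alpha> j n"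
  by (simp add: int_part_def frac_part_def frac_def)

lemma frac_part_bounds: "0 \<le> frac_part \<alpha> j n" "frac_part \<alpha> j n < 1"
  by (simp_all add: frac_part_def frac_lt_1)

lemma nested_floor_identity:
  assumes "j \<ge> 1"
  shows "real j * nested_floor (\<alpha> * real n) j = (\<alpha> * real n) ^ j
     + psum_lower (\<lambda>i. - int_part \<alpha> i n) j - psum_lower (\<lambda>i. frac_part \<alpha> i n) j"
proof -
  have "psum (\<lambda>i. frac_part \<alpha> i n) j = (\<alpha> * real n) ^ j + psum (\<lambda>i. - int_part \<alpha> i n) j"
    by (rule psum_identity[OF _ _ assms])
      (simp_all add: int_part_def frac_part_def frac_def)
  then show ?thesis
    using assms by (simp add: psum_rec nested_floor_split algebra_simps)
qed

text \<open>
  Isolates the entry of largest index. It occurs twice in the recursion, with the factors \<open>r_1\<close> and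
  \<open>(j - 1) r_1\<close>. For \<open>j = 2\<close> the two occurrences coincide, and there is no such formula.
\<close>

lemma psum_lower_split:
  assumes "j \<ge> 3"
  shows "psum_lower r j = real j * r 1 * r (j - 1) + (r 1 * psum_lower r (j - 1) + (\<Sum>i=2..<j-1. r i * psum r (j - i)))"
proof -
  have "{1..<j} = insert 1 (insert (j - 1) {2..<j-1})" using assms by auto
  then have "psum_lower r j = r 1 * psum r (j - 1) + (r (j - 1) * psum r 1 + (\<Sum>i=2..<j-1. r i * psum r (j - i)))"
    unfolding psum_lower_def using assms by simp
  moreover have "psum r 1 = r 1" by (simp add: psum_rec psum_lower_def)
  ultimately show ?thesis using assms by (simp add: psum_rec algebra_simps of_nat_diff)
qed

lemma psum_lower_2: "psum_lower r 2 = r 1 * r 1"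
proof -
  have "{1..<2::nat} = {1}" by auto
  then show ?thesis by (simp add: psum_lower_def psum_rec)
qed

section \<open>Fractional and integer parts lie in the phase classes\<close>

definition real_class :: "nat \<Rightarrow> (nat \<Rightarrow> real) \<Rightarrow> bool" where
  "real_class d u \<longleftrightarrow> (\<lambda>n. of_real (u n)) \<in> phase_class d"

text \<open>
  Membership for all moduli \<open>M\<close> at once: the identity for index \<open>j\<close> divides by \<open>j\<close>, so that a
  statement modulo \<open>M\<close> for the \<open>j\<close>-th integer part uses the earlier ones modulo \<open>j M\<close>.
\<close>

definition int_class :: "nat \<Rightarrow> (nat \<Rightarrow> real) \<Rightarrow> bool" where
  "int_class d u \<longleftrightarrow> (\<forall>n. u n \<in> \<int>) \<and> (\<forall>M::nat. M \<ge> 1 \<longrightarrow> (\<lambda>n. ee (u n / real M)) \<in> phase_class d)"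

lemma real_class_const: "real_class d (\<lambda>n. c)"
  by (simp add: real_class_def phase_class_const)

lemma real_class_add: "real_class d u \<Longrightarrow> real_class d v \<Longrightarrow> real_class d (\<lambda>n. u n + v n)"
  by (simp add: real_class_def phase_class_add)

lemma real_class_mult: "real_class d u \<Longrightarrow> real_class d v \<Longrightarrow> real_class d (\<lambda>n. u n * v n)"
  by (simp add: real_class_def phase_class_mult)

lemma real_class_mono: "real_class d u \<Longrightarrow> d \<le> d' \<Longrightarrow> real_class d' u"
  unfolding real_class_def by (rule phase_class_mono)

lemma real_class_sum: "(\<And>i. i \<in> A \<Longrightarrow> real_class d (u i)) \<Longrightarrow> real_class d (\<lambda>n. \<Sum>i\<in>A. u i n)"
  unfolding real_class_def of_real_sum by (rule phase_class_sum)

lemma int_class_const: "int_class d (\<lambda>n. of_int c)"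
  by (simp add: int_class_def phase_class_const)

lemma int_class_add: "int_class d u \<Longrightarrow> int_class d v \<Longrightarrow> int_class d (\<lambda>n. u n + v n)"
  by (simp add: int_class_def add_divide_distrib ee_add phase_class_mult)

lemma int_class_mono: "int_class d u \<Longrightarrow> d \<le> d' \<Longrightarrow> int_class d' u"
  unfolding int_class_def using phase_class_mono by blast

lemma roots_of_unity_filter:
  assumes "M \<ge> 1" "t \<in> \<int>"
  shows "(\<Sum>l<M. ee (real l * t / real M)) = of_nat M * of_bool (t / real M \<in> \<int>)"
proof -
  let ?z = "ee (t / real M)"
  have e: "ee (real l * t / real M) = ?z ^ l" for l
    using ee_mult_nat[of l "t / real M"] by simp
  have "?z ^ M = ee (real M * (t / real M))" by (simp only: ee_mult_nat)
  then have "?z ^ M = 1" using assms by (simp add: ee_eq_1_iff)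
  then have "(\<Sum>l<M. ?z ^ l) = of_nat M * of_bool (t / real M \<in> \<int>)"
  proof (cases "?z = 1")
    case True
    moreover have "t / real M \<in> \<int>" using True by (simp only: ee_eq_1_iff)
    ultimately show ?thesis by simp
  next
    case False
    then have "t / real M \<notin> \<int>" by (simp only: ee_eq_1_iff not_False_eq_True)
    with False \<open>?z ^ M = 1\<close> show ?thesis by (simp add: geometric_sum)
  qed
  then show ?thesis by (simp only: e)
qed

text \<open>
  Indicator functions of residue classes are averages of characters, hence belong to the class; on
  each residue class of \<open>u\<close> the character of \<open>u v\<close> is a power of the character of \<open>v\<close>.
\<close>

lemma int_class_mult:
  assumes u: "int_class d u" and v: "int_class d v"
  shows "int_class d (\<lambda>n. u n * v n)"
  unfolding int_class_def
proof (intro conjI allI impI)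
  show "u n * v n \<in> \<int>" for n using u v by (auto simp: int_class_def)
  fix M :: nat assume M: "M \<ge> 1"
  have eu: "(\<lambda>n. ee (u n / real M)) \<in> phase_class d" and ev: "(\<lambda>n. ee (v n / real M)) \<in> phase_class d"
    using u v M by (auto simp: int_class_def)
  have "ee (u n * v n / real M) =
     (\<Sum>c<M. ((\<Sum>l<M. ee (u n / real M) ^ l * cnj (ee (real l * real c / real M))) / of_nat M) * ee (v n / real M) ^ c)" for n
  proof -
    have "u n \<in> \<int>" using u by (simp add: int_class_def)
    then obtain k :: int where k: "u n = of_int k" by (auto elim: Ints_cases)
    have vn: "v n \<in> \<int>" using v by (simp add: int_class_def)
    \<comment> \<open>Only the residue class of \<open>u n\<close> survives in the outer sum.\<close>
    define c0 where "c0 = nat (k mod int M)"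
    have c0: "c0 < M" "int c0 = k mod int M"
      using M by (auto simp: c0_def nat_less_iff)
    have ind: "(\<Sum>l<M. ee (u n / real M) ^ l * cnj (ee (real l * real c / real M))) / of_nat M = of_bool (c = c0)"
      if "c < M" for c
    proof -
      have "(\<Sum>l<M. ee (u n / real M) ^ l * cnj (ee (real l * real c / real M)))
        = (\<Sum>l<M. ee (real l * (u n - real c) / real M))"
        by (intro sum.cong refl) (simp add: ee_mult_nat[symmetric] ee_diff[symmetric] diff_divide_distrib right_diff_distrib)
      also have "\<dots> = of_nat M * of_bool ((u n - real c) / real M \<in> \<int>)"
        using M k by (intro roots_of_unity_filter) auto
      also have "(u n - real c) / real M \<in> \<int> \<longleftrightarrow> int M dvd (k - int c)"
      proof
        assume "(u n - real c) / real M \<in> \<int>"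
        then obtain l :: int where "(u n - real c) / real M = of_int l" by (auto elim: Ints_cases)
        then have "of_int (k - int c) = (of_int (l * int M) :: real)" using M k by (simp add: field_simps)
        then have "k - int c = l * int M" by (simp only: of_int_eq_iff)
        then show "int M dvd (k - int c)" by simp
      next
        assume "int M dvd (k - int c)"
        then obtain l where "k - int c = int M * l" by (auto elim: dvdE)
        then have "of_int (k - int c) = (of_int (int M * l) :: real)" by simp
        then have "(u n - real c) / real M = of_int l" using M k by (simp add: field_simps)
        then show "(u n - real c) / real M \<in> \<int>" by simp
      qed
      also have "int M dvd (k - int c) \<longleftrightarrow> k mod int M = int c mod int M"
        by (simp add: mod_eq_dvd_iff)
      also have "\<dots> \<longleftrightarrow> c = c0" using that c0 by auto
      finally show ?thesis using M by simp
    qed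
    have "(\<Sum>c<M. ((\<Sum>l<M. ee (u n / real M) ^ l * cnj (ee (real l * real c / real M))) / of_nat M) * ee (v n / real M) ^ c)
      = (\<Sum>c<M. if c = c0 then ee (v n / real M) ^ c else 0)"
      by (intro sum.cong refl) (auto simp: ind)
    also have "\<dots> = ee (v n / real M) ^ c0" using c0 by simp
    also have "\<dots> = ee (real c0 * (v n / real M))" by (simp only: ee_mult_nat)
    also have "\<dots> = ee (u n * v n / real M)"
    proof (rule ee_cong_Ints)
      have "k = int M * (k div int M) + int c0" using c0 by simp
      then have "of_int k = (of_int (int M * (k div int M) + int c0) :: real)" by (rule arg_cong)
      then have "u n = real M * of_int (k div int M) + real c0" using k by simp
      then have "real c0 * (v n / real M) - u n * v n / real M = - (of_int (k div int M) * v n)"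
        using M by (simp add: field_simps)
      then show "real c0 * (v n / real M) - u n * v n / real M \<in> \<int>" using vn by auto
    qed
    finally show ?thesis by (rule sym)
  qed
  moreover have "(\<lambda>n. \<Sum>c<M. ((\<Sum>l<M. ee (u n / real M) ^ l * cnj (ee (real l * real c / real M))) / of_nat M) * ee (v n / real M) ^ c)
    \<in> phase_class d"
    unfolding divide_inverse
    by (intro phase_class_sum phase_class_mult phase_class_power phase_class_const
        eu[unfolded divide_inverse] ev[unfolded divide_inverse])
  ultimately show "(\<lambda>n. ee (u n * v n / real M)) \<in> phase_class d" by (simp only:)
qed

text \<open>
  If \<open>y\<close> is near an integer, then so is \<open>L y\<close>, up to the factor \<open>L\<close> in the distance.
\<close>

lemma no_concentration_multiple:
  assumes z: "no_concentration z" and L: "L \<ge> 1" and yz: "\<And>n. real L * y n + z n \<in> \<int>"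
  shows "no_concentration y"
  unfolding no_concentration_def
proof (intro allI impI)
  fix \<epsilon> :: real assume "\<epsilon> > 0"
  with z obtain \<delta> where \<delta>: "\<delta> > 0"
    "\<forall>\<^sub>F N in sequentially. mean (\<lambda>n. of_bool (cmod (ee (z n) - 1) < \<delta>)) N \<le> \<epsilon>"
    by (auto simp: no_concentration_def)
  have *: "cmod (ee (z n) - 1) \<le> real L * cmod (ee (y n) - 1)" for n
  proof -
    have "ee (real L * y n + z n) = 1" using yz by (simp add: ee_eq_1_iff)
    then have "ee (z n) = cnj (ee (y n) ^ L)"
      unfolding ee_add ee_mult_nat
      by (metis complex_cnj_cancel_iff complex_cnj_mult ee_minus ee_mult_nat mult.left_neutral mult.right_neutral mult.assoc ee_add add.left_inverse ee_0 add.commute)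
    then have "cmod (ee (z n) - 1) = cmod (ee (y n) ^ L - 1 ^ L)"
      by (metis complex_cnj_diff complex_cnj_one complex_mod_cnj power_one)
    also have "\<dots> \<le> real L * cmod (ee (y n) - 1)" by (rule norm_power_diff) auto
    finally show ?thesis .
  qed
  have "mean (\<lambda>n. of_bool (cmod (ee (y n) - 1) < \<delta> / real L)) N \<le> (mean (\<lambda>n. of_bool (cmod (ee (z n) - 1) < \<delta>)) N :: real)" for N
  proof (rule mean_mono)
    fix n
    have "cmod (ee (z n) - 1) < \<delta>" if "cmod (ee (y n) - 1) < \<delta> / real L"
      using *[of n] that L by (simp add: field_simps)
    then show "of_bool (cmod (ee (y n) - 1) < \<delta> / real L) \<le> (of_bool (cmod (ee (z n) - 1) < \<delta>) :: real)" by auto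
  qed
  then have "\<forall>\<^sub>F N in sequentially. mean (\<lambda>n. of_bool (cmod (ee (y n) - 1) < \<delta> / real L)) N \<le> \<epsilon>"
    using \<delta>(2) by (auto elim!: eventually_mono intro: order_trans)
  then show "\<exists>\<delta>>0. \<forall>\<^sub>F N in sequentially. mean (\<lambda>n. of_bool (cmod (ee (y n) - 1) < \<delta>)) N \<le> \<epsilon>"
    using \<delta>(1) L by (intro exI[of _ "\<delta> / real L"]) auto
qed

lemma real_class_ee: "real_class d u \<Longrightarrow> (\<lambda>n. ee (c * u n)) \<in> phase_class d"
  unfolding real_class_def by (rule phase_class_ee)

lemma real_class_psum_lower:
  "(\<And>i. 1 \<le> i \<Longrightarrow> i < j \<Longrightarrow> real_class d (r i)) \<Longrightarrow> real_class d (\<lambda>n. psum_lower (\<lambda>i. r i n) j)"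
  by (rule psum_closed(2)[where Q = "real_class d"]) (auto intro: real_class_const real_class_add real_class_mult)

lemma real_class_psum:
  "(\<And>i. 1 \<le> i \<Longrightarrow> i \<le> j \<Longrightarrow> real_class d (r i)) \<Longrightarrow> j \<ge> 1 \<Longrightarrow> real_class d (\<lambda>n. psum (\<lambda>i. r i n) j)"
  by (rule psum_closed(1)[where Q = "real_class d"]) (auto intro: real_class_const real_class_add real_class_mult)

lemma int_class_psum_lower:
  assumes "\<And>i. 1 \<le> i \<Longrightarrow> i < j \<Longrightarrow> int_class d (a i)"
  shows "int_class d (\<lambda>n. psum_lower (\<lambda>i. - a i n) j)"
proof (rule psum_closed(2)[where Q = "int_class d" and r = "\<lambda>i n. - a i n"])
  show "int_class d (\<lambda>n. real k)" for k using int_class_const[of d "int k"] by simp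
  show "int_class d (\<lambda>n. - a i n)" if "1 \<le> i" "i < j" for i
    using int_class_mult[OF int_class_const[of d "- 1"] assms[OF that]] by simp
qed (auto intro: int_class_add int_class_mult)

text \<open>
  Up to a factor from the class generated by earlier parts, the character of the \<open>j\<close>-th expression
  is a pure phase of degree \<open>j\<close>.
\<close>

lemma nested_floor_phase:
  assumes j: "j \<ge> 1" and M: "M \<ge> 1"
    and r: "\<And>i. 1 \<le> i \<Longrightarrow> i < j \<Longrightarrow> real_class d (frac_part \<alpha> i)"
    and a: "\<And>i. 1 \<le> i \<Longrightarrow> i < j \<Longrightarrow> int_class d (int_part \<alpha> i)"
  shows "\<exists>g\<in>phase_class d. \<forall>n. ee (of_int m * nested_floor (\<alpha> * real n) j / real M)
      = g n * ee ((of_int m * \<alpha> ^ j / (real j * real M)) * real n ^ j)"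
proof (intro bexI allI)
  let ?P = "\<lambda>n. psum_lower (\<lambda>i. - int_part \<alpha> i n) j" and ?R = "\<lambda>n. psum_lower (\<lambda>i. frac_part \<alpha> i n) j"
  define c where "c = - (of_int m / (real j * real M))"
  let ?g = "\<lambda>n. ee (of_int m * ?P n / real (j * M)) * ee (c * ?R n)"
  have "int_class d ?P"
    by (intro int_class_psum_lower a)
  then have "int_class d (\<lambda>n. of_int m * ?P n)"
    by (rule int_class_mult[OF int_class_const])
  moreover have "j * M \<ge> 1" using j M by simp
  ultimately have "(\<lambda>n. ee (of_int m * ?P n / real (j * M))) \<in> phase_class d"
    unfolding int_class_def by blast
  then show "?g \<in> phase_class d"
    by (intro phase_class_mult real_class_ee real_class_psum_lower r)
  fix n
  have y: "nested_floor (\<alpha> * real n) j = ((\<alpha> * real n) ^ j + ?P n - ?R n) / real j"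
    using nested_floor_identity[OF j, of \<alpha> n] j by (simp add: field_simps)
  have "of_int m * nested_floor (\<alpha> * real n) j / real M
      = of_int m * ?P n / real (j * M) + c * ?R n + (of_int m * \<alpha> ^ j / (real j * real M)) * real n ^ j"
    unfolding y using j M by (simp add: c_def field_simps power_mult_distrib)
  then show "ee (of_int m * nested_floor (\<alpha> * real n) j / real M)
      = ?g n * ee ((of_int m * \<alpha> ^ j / (real j * real M)) * real n ^ j)"
    by (simp only: ee_add)
qed

definition parts_in_class :: "real \<Rightarrow> nat \<Rightarrow> bool" where
  "parts_in_class \<alpha> j \<longleftrightarrow> real_class j (frac_part \<alpha> j) \<and> int_class j (int_part \<alpha> j)"

lemma parts_in_classD:
  assumes "parts_in_class \<alpha> i" "i \<le> d"
  shows "real_class d (frac_part \<alpha> i)" "int_class d (int_part \<alpha> i)"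
  using assms real_class_mono[of i "frac_part \<alpha> i" d] int_class_mono[of i "int_part \<alpha> i" d]
  by (auto simp: parts_in_class_def)

lemma nested_floor_orthogonal:
  assumes irr: "\<alpha> ^ j \<notin> \<rat>" and j: "j \<ge> 1"
    and parts: "\<And>i. 1 \<le> i \<Longrightarrow> i < j \<Longrightarrow> parts_in_class \<alpha> i"
    and f: "f \<in> phase_class (j - 1)" and m: "m \<noteq> (0::int)"
  shows "mean (\<lambda>n. f n * ee (of_int m * nested_floor (\<alpha> * real n) j)) \<longlonglongrightarrow> 0"
proof -
  have "\<exists>g\<in>phase_class (j - 1). \<forall>n. ee (of_int m * nested_floor (\<alpha> * real n) j / real 1)
      = g n * ee ((of_int m * \<alpha> ^ j / (real j * real 1)) * real n ^ j)"
    by (rule nested_floor_phase[OF j order_refl]) (rule parts_in_classD[OF parts]; simp)+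
  then obtain g where g: "g \<in> phase_class (j - 1)"
    "\<And>n. ee (of_int m * nested_floor (\<alpha> * real n) j / real 1) = g n * ee ((of_int m * \<alpha> ^ j / (real j * real 1)) * real n ^ j)"
    by blast
  have "(of_int m / real j) * \<alpha> ^ j \<notin> \<rat>"
    using m j by (intro irrational_mult_rational irr) auto
  then have "of_int m * \<alpha> ^ j / real j \<notin> \<rat>" by simp
  from phase_class_weyl[OF phase_class_mult[OF f g(1)] _ this, of j] show ?thesis
    using j g(2) by (simp add: mult.assoc)
qed

lemma frac_part_unif_indep:
  assumes "\<alpha> ^ j \<notin> \<rat>" "j \<ge> 1" "\<And>i. 1 \<le> i \<Longrightarrow> i < j \<Longrightarrow> parts_in_class \<alpha> i"
  shows "unif_indep (j - 1) (frac_part \<alpha> j)"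
  unfolding frac_part_def[abs_def]
  by (rule unif_indep_frac) (rule nested_floor_orthogonal[OF assms])

lemma nested_floor_weyl_sums:
  assumes "\<alpha> ^ j \<notin> \<rat>" "j \<ge> 1" "\<And>i. 1 \<le> i \<Longrightarrow> i < j \<Longrightarrow> parts_in_class \<alpha> i" "m \<noteq> (0::int)"
  shows "mean (\<lambda>n. ee (of_int m * nested_floor (\<alpha> * real n) j)) \<longlonglongrightarrow> 0"
  using nested_floor_orthogonal[OF assms(1-3) phase_class_const[of 1] assms(4)] by simp

lemma exp_avg_ii_le: "cmod (exp_avg (\<i> * of_real y)) \<le> 3 / (1 + \<bar>y\<bar>)"
proof (cases "y = 0")
  case False
  then have "cmod (exp_avg (\<i> * of_real y)) * (1 + \<bar>y\<bar>) \<le> 1 + 2"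
    using exp_avg_ii_bound[of y] exp_avg_ii_le_1[of y] by (simp add: algebra_simps)
  then show ?thesis by (simp add: field_simps)
qed simp

lemma integral_reciprocal:
  assumes "c > (0::real)"
  shows "integral {0..1} (\<lambda>t. 1 / (1 + c * t)) = ln (1 + c) / c"
proof -
  have "((\<lambda>t. 1 / (1 + c * t)) has_integral (ln (1 + c * 1) / c - ln (1 + c * 0) / c)) {0..1}"
  proof (rule fundamental_theorem_of_calculus[of 0 1 "\<lambda>t. ln (1 + c * t) / c"])
    fix t :: real assume "t \<in> {0..1}"
    then have "1 + c * t > 0" using assms by (auto intro: add_pos_nonneg)
    then show "((\<lambda>t. ln (1 + c * t) / c) has_vector_derivative 1 / (1 + c * t)) (at t within {0..1})"
      using assms unfolding has_real_derivative_iff_has_vector_derivative[symmetric]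
      by (auto intro!: derivative_eq_intros)
  qed simp
  then show ?thesis by (simp add: integral_unique)
qed

lemma irrational_root: "\<alpha> ^ j \<notin> \<rat> \<Longrightarrow> \<alpha> \<notin> (\<rat> :: real set)"
  by auto

lemma irrational_predecessor:
  assumes "\<alpha> \<notin> \<rat>" "\<alpha> ^ Suc j \<in> \<rat>"
  shows "\<alpha> ^ j \<notin> (\<rat> :: real set)"
proof
  assume "\<alpha> ^ j \<in> \<rat>"
  with assms(2) have "\<alpha> ^ Suc j / \<alpha> ^ j \<in> \<rat>" by (rule Rats_divide)
  moreover have "\<alpha> \<noteq> 0" using assms(1) by auto
  ultimately show False using assms(1) by simp
qed

text \<open>
  The top entry \<open>r_(j-1)\<close> occurs only in the product with \<open>j r_1\<close> and is independent of the rest.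
  Averaging over it produces the factor \<open>exp_avg\<close> at \<open>2 \<pi> i m q j r_1\<close>, which is small for large
  frequencies \<open>m\<close> unless \<open>r_1\<close> is small, which is rare.
\<close>

lemma no_concentration_bilinear:
  assumes \<alpha>: "\<alpha> \<notin> \<rat>" and irr: "\<alpha> ^ (j - 1) \<notin> \<rat>" and j: "j \<ge> 3" and q: "q \<ge> (1::nat)"
    and parts: "\<And>i. 1 \<le> i \<Longrightarrow> i < j \<Longrightarrow> parts_in_class \<alpha> i"
  shows "no_concentration (\<lambda>n. real q * psum_lower (\<lambda>i. frac_part \<alpha> i n) j)"
proof (rule weyl_sums_no_concentration)
  fix \<epsilon> :: real assume eps: "\<epsilon> > 0"
  let ?r = "frac_part \<alpha>"
  define X where "X n = ?r 1 n * psum_lower (\<lambda>i. ?r i n) (j - 1) + (\<Sum>i=2..<j-1. ?r i n * psum (\<lambda>i. ?r i n) (j - i))" for n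
  note rc = parts_in_classD(1)[OF parts]
  have X: "real_class (j - 2) X"
    unfolding X_def[abs_def]
    by (intro real_class_add real_class_mult real_class_sum real_class_psum_lower real_class_psum rc) (use j in auto)
  have ind: "unif_indep (j - 2) (?r (j - 1))"
    using frac_part_unif_indep[of \<alpha> "j - 1"] irr j parts by (simp add: numeral_2_eq_2)
  have r1: "(\<lambda>n. of_real (?r 1 n)) \<in> phase_class (j - 2)"
    using rc[of 1 "j - 2"] j by (simp add: real_class_def)
  have "(\<lambda>n. ln (real n) / real n) \<longlonglongrightarrow> 0" by (rule lim_ln_over_n)
  from order_tendstoD(2)[OF this, of "\<epsilon> / 12"] eps obtain m1 where
    m1: "\<And>n. n \<ge> m1 \<Longrightarrow> ln (real n) / real n < \<epsilon> / 12" by (auto simp: eventually_sequentially)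
  show "\<exists>m0. \<forall>m::int. \<bar>m\<bar> \<ge> int m0 \<longrightarrow>
     (\<forall>\<^sub>F N in sequentially. cmod (mean (\<lambda>n. ee (of_int m * (real q * psum_lower (\<lambda>i. ?r i n) j))) N) \<le> \<epsilon>)"
  proof (intro exI[of _ "m1 + 1"] allI impI)
    fix m :: int assume m: "\<bar>m\<bar> \<ge> int (m1 + 1)"
    define c where "c = \<bar>of_int m :: real\<bar>"
    have c: "c \<ge> 1" using m by (simp add: c_def)
    define f where "f n = ee ((of_int m * real q) * X n)" for n
    define u where "u n = (\<i> * of_real (2 * pi * of_int m * real q * real j)) * of_real (?r 1 n)" for n
    have f: "f \<in> phase_class (j - 2)" unfolding f_def[abs_def] by (rule real_class_ee[OF X])
    have u: "u \<in> phase_class (j - 2)" unfolding u_def[abs_def] by (intro phase_class_cmult r1)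
    have eq: "ee (of_int m * (real q * psum_lower (\<lambda>i. ?r i n) j)) = f n * exp (u n * of_real (?r (j - 1) n))" for n
    proof -
      have "of_int m * (real q * psum_lower (\<lambda>i. ?r i n) j) =
          (of_int m * real q) * X n + of_int m * real q * real j * ?r 1 n * ?r (j - 1) n"
        unfolding psum_lower_split[OF j] X_def by (simp add: algebra_simps)
      then have "ee (of_int m * (real q * psum_lower (\<lambda>i. ?r i n) j))
          = f n * ee (of_int m * real q * real j * ?r 1 n * ?r (j - 1) n)"
        by (simp only: ee_add f_def)
      also have "ee (of_int m * real q * real j * ?r 1 n * ?r (j - 1) n) = exp (u n * of_real (?r (j - 1) n))"
        by (simp add: ee_def cis_conv_exp u_def mult_ac)
      finally show ?thesis .
    qed
    define g where "g t = 3 * (1 / (1 + c * t))" for t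
    have cg: "continuous_on {0..1} g"
      proof -
      have "1 + c * t > 0" if "t \<in> {0..1}" for t using that c by (auto intro: add_pos_nonneg)
      then show ?thesis unfolding g_def by (intro continuous_intros) fastforce
    qed
    have bnd: "cmod (f n * exp_avg (u n)) \<le> g (?r 1 n)" for n
    proof -
      define y where "y = 2 * pi * of_int m * real q * real j * ?r 1 n"
      have "1 * 1 * 1 \<le> (2 * pi) * real q * real j"
        using q j pi_ge_two by (intro mult_mono) auto
      then have "c * ?r 1 n * 1 \<le> c * ?r 1 n * ((2 * pi) * real q * real j)"
        using c frac_part_bounds[of \<alpha> 1 n] by (intro mult_left_mono) auto
      also have "\<dots> = \<bar>y\<bar>"
        using frac_part_bounds[of \<alpha> 1 n] by (simp add: y_def c_def abs_mult)
      finally have y: "c * ?r 1 n \<le> \<bar>y\<bar>" by simp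
      have "cmod (f n * exp_avg (u n)) = cmod (exp_avg (\<i> * of_real y))"
        by (simp add: norm_mult f_def u_def y_def mult_ac)
      also have "\<dots> \<le> 3 / (1 + \<bar>y\<bar>)" by (rule exp_avg_ii_le)
      also have "\<dots> \<le> 3 / (1 + c * ?r 1 n)"
        using y c frac_part_bounds[of \<alpha> 1 n] by (intro divide_left_mono mult_pos_pos add_pos_nonneg) auto
      finally show ?thesis by (simp add: g_def)
    qed
    have "integral {0..1} g \<le> \<epsilon> / 2"
    proof -
      have "integral {0..1} g = 3 * (ln (1 + c) / c)"
        unfolding g_def integral_mult_right using c integral_reciprocal[of c] by simp
      also have "ln (1 + c) / c = ln (real (nat \<bar>m\<bar> + 1)) / c"
        by (simp add: c_def add.commute)
      also have "\<dots> \<le> ln (real (nat \<bar>m\<bar> + 1)) / (real (nat \<bar>m\<bar> + 1) / 2)"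
        using c by (intro divide_left_mono) (auto simp: c_def)
      also have "\<dots> = 2 * (ln (real (nat \<bar>m\<bar> + 1)) / real (nat \<bar>m\<bar> + 1))" by simp
      also have "\<dots> \<le> 2 * (\<epsilon> / 12)"
        using m1[of "nat \<bar>m\<bar> + 1"] m by (intro mult_left_mono less_imp_le) auto
      finally show ?thesis by simp
    qed
    then have lt: "integral {0..1} g < 3 / 4 * \<epsilon>" using eps by simp
    have "mean (\<lambda>n. g (?r 1 n)) \<longlonglongrightarrow> integral {0..1} g"
      unfolding frac_part_def using \<alpha> j parts
      by (intro tendsto_mean_frac[OF nested_floor_weyl_sums cg]) auto
    then have 1: "\<forall>\<^sub>F N in sequentially. mean (\<lambda>n. g (?r 1 n)) N < 3 / 4 * \<epsilon>"
      using lt by (rule order_tendstoD(2))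
    have 2: "\<forall>\<^sub>F N in sequentially. cmod (mean (\<lambda>n. f n * exp (u n * of_real (?r (j - 1) n))) N - mean (\<lambda>n. f n * exp_avg (u n)) N) < \<epsilon> / 4"
      using tendstoD[OF unif_indep_exp[OF ind f u], of "\<epsilon> / 4"] eps by simp
    show "\<forall>\<^sub>F N in sequentially. cmod (mean (\<lambda>n. ee (of_int m * (real q * psum_lower (\<lambda>i. ?r i n) j))) N) \<le> \<epsilon>"
      unfolding eq using 1 2
    proof eventually_elim
      case (elim N)
      have "cmod (mean (\<lambda>n. f n * exp_avg (u n)) N) \<le> mean (\<lambda>n. cmod (f n * exp_avg (u n))) N"
        by (rule norm_mean_le)
      also have "\<dots> \<le> mean (\<lambda>n. g (?r 1 n)) N" by (rule mean_mono) (rule bnd)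
      finally show ?case
        using elim norm_triangle_sub[of "mean (\<lambda>n. f n * exp (u n * of_real (?r (j - 1) n))) N" "mean (\<lambda>n. f n * exp_avg (u n)) N"]
        by linarith
    qed
  qed
qed

text \<open>
  The level set \<open>q t\<^sup>2 \<in> \<int>\<close> is finite, so shrinking neighbourhoods of it have measure tending to 0.
\<close>

lemma no_concentration_square:
  assumes \<alpha>: "\<alpha> \<notin> \<rat>" and q: "q \<ge> (1::nat)"
  shows "no_concentration (\<lambda>n. real q * (frac_part \<alpha> 1 n * frac_part \<alpha> 1 n))"
  unfolding no_concentration_def
proof (intro allI impI)
  fix \<epsilon> :: real assume eps: "\<epsilon> > 0"
  define \<phi> where "\<phi> t = ee (real q * (t * t))" for t
  \<comment> \<open>Continuous majorants of the indicator functions of shrinking neighbourhoods of \<open>S\<close>.\<close>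
  define g where "g l t = max 0 (2 - real (Suc l) * cmod (\<phi> t - 1))" for l t
  define S where "S = {t \<in> {0..1}. \<phi> t = 1}"
  have "S \<subseteq> (\<lambda>i::int. sqrt (of_int i / real q)) ` {0..int q}"
  proof
    fix t assume t: "t \<in> S"
    then have "real q * (t * t) \<in> \<int>" by (simp add: S_def \<phi>_def ee_eq_1_iff)
    then obtain i :: int where i: "real q * (t * t) = of_int i" by (auto elim: Ints_cases)
    have "t * t \<le> 1" "0 \<le> t" using t by (auto simp: S_def intro: mult_le_one)
    then have "0 \<le> real q * (t * t)" "real q * (t * t) \<le> real q * 1"
      by (simp, intro mult_left_mono) auto
    then have "i \<in> {0..int q}" unfolding i by simp
    moreover have "t = sqrt (of_int i / real q)"
      using i q \<open>0 \<le> t\<close> by (simp add: i[symmetric])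
    ultimately show "t \<in> (\<lambda>i::int. sqrt (of_int i / real q)) ` {0..int q}" by (rule rev_image_eqI)
  qed
  then have fS: "finite S" by (rule finite_subset) simp
  have cg: "continuous_on {0..1} (g l)" for l
    unfolding g_def \<phi>_def by (intro continuous_intros continuous_ee)
  have "(\<lambda>l. integral {0..1} (g l)) \<longlonglongrightarrow> integral {0..1} (\<lambda>t. if t \<in> S then 2 else 0)"
  proof (rule dominated_convergence(2))
    show "g l integrable_on {0..1}" for l by (intro integrable_continuous_interval cg)
    show "(\<lambda>t. 2 :: real) integrable_on {0..1::real}" by (intro integrable_continuous_interval continuous_intros)
    show "norm (g l t) \<le> 2" if "t \<in> {0..1}" for l t
      by (simp add: g_def)
    show "(\<lambda>l. g l t) \<longlonglongrightarrow> (if t \<in> S then 2 else 0)" if t: "t \<in> {0..1}" for t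
    proof (cases "t \<in> S")
      case False
      then have d: "cmod (\<phi> t - 1) > 0" using t by (auto simp: S_def)
      obtain L :: nat where L: "2 / cmod (\<phi> t - 1) < real L" using reals_Archimedean2 by blast
      have "g l t = 0" if "l \<ge> L" for l
      proof -
        have "2 \<le> real L * cmod (\<phi> t - 1)" using L d by (simp add: field_simps)
        also have "\<dots> \<le> real (Suc l) * cmod (\<phi> t - 1)" using that by (intro mult_right_mono) auto
        finally show ?thesis by (simp add: g_def)
      qed
      then have "\<forall>\<^sub>F l in sequentially. g l t = 0" by (auto simp: eventually_sequentially)
      then show ?thesis using False by (simp add: tendsto_eventually)
    qed (simp add: g_def S_def)
  qed
  moreover have "((\<lambda>t. if t \<in> S then 2 else 0 :: real) has_integral 0) {0..1}"
    by (rule has_integral_spike_finite[OF fS, of "{0..1}" _ "\<lambda>t. 0"]) auto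
  ultimately have "(\<lambda>l. integral {0..1} (g l)) \<longlonglongrightarrow> 0" by (simp add: integral_unique)
  from order_tendstoD(2)[OF this eps] obtain l where l: "integral {0..1} (g l) < \<epsilon>"
    by (auto simp: eventually_sequentially)
  have "mean (\<lambda>n. g l (frac_part \<alpha> 1 n)) \<longlonglongrightarrow> integral {0..1} (g l)"
    unfolding frac_part_def using \<alpha> by (intro tendsto_mean_frac[OF nested_floor_weyl_sums cg]) auto
  then have "\<forall>\<^sub>F N in sequentially. mean (\<lambda>n. g l (frac_part \<alpha> 1 n)) N < \<epsilon>"
    using l by (simp add: order_tendsto_iff)
  then have "\<forall>\<^sub>F N in sequentially. mean (\<lambda>n. of_bool (cmod (ee (real q * (frac_part \<alpha> 1 n * frac_part \<alpha> 1 n)) - 1) < 1 / real (Suc l))) N \<le> \<epsilon>"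
  proof eventually_elim
    case (elim N)
    have "mean (\<lambda>n. of_bool (cmod (ee (real q * (frac_part \<alpha> 1 n * frac_part \<alpha> 1 n)) - 1) < 1 / real (Suc l))) N
      \<le> mean (\<lambda>n. g l (frac_part \<alpha> 1 n)) N"
      by (rule mean_mono) (auto simp: g_def \<phi>_def field_simps)
    with elim show ?case by simp
  qed
  then show "\<exists>\<delta>>0. \<forall>\<^sub>F N in sequentially. mean (\<lambda>n. of_bool (cmod (ee (real q * (frac_part \<alpha> 1 n * frac_part \<alpha> 1 n)) - 1) < \<delta>)) N \<le> \<epsilon>"
    by (intro exI[of _ "1 / real (Suc l)"]) auto
qed

lemma Rats_fractionE:
  assumes "x \<in> (\<rat> :: real set)"
  obtains p :: int and q :: nat where "q \<ge> 1" "x = of_int p / real q"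
proof -
  from assms obtain a b :: int where "b > 0" "x = of_int a / of_int b"
    by (auto elim: Rats_cases')
  then show thesis using that[of "nat b" a] by simp
qed

text \<open>
  In the case of rational \<open>\<alpha>^j\<close>, multiplication by \<open>j q\<close> makes the power and the contribution of
  the integer parts integral, so that only the polynomial in the fractional parts remains. Then
  \<open>\<alpha>^(j-1)\<close> is irrational, so that \<open>r_(j-1)\<close> is uniform.
\<close>

theorem parts_in_class_all:
  assumes \<alpha>: "\<alpha> \<notin> \<rat>" and "j \<ge> 1"
  shows "parts_in_class \<alpha> j"
  using \<open>j \<ge> 1\<close>
proof (induction j rule: less_induct)
  case (less j)
  have parts: "parts_in_class \<alpha> i" if "1 \<le> i" "i < j" for i using less.IH that by blast
  let ?y = "\<lambda>n. nested_floor (\<alpha> * real n) j"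
  have nc: "no_concentration ?y"
  proof (cases "\<alpha> ^ j \<in> \<rat>")
    case False
    show ?thesis
    proof (rule weyl_sums_no_concentration, intro exI allI impI)
      fix \<epsilon> :: real and m :: int assume "\<epsilon> > 0" "int 1 \<le> \<bar>m\<bar>"
      then have "mean (\<lambda>n. ee (of_int m * ?y n)) \<longlonglongrightarrow> 0"
        by (intro nested_floor_weyl_sums False less.prems parts) auto
      from tendstoD[OF this \<open>\<epsilon> > 0\<close>]
      show "\<forall>\<^sub>F N in sequentially. cmod (mean (\<lambda>n. ee (of_int m * ?y n)) N) \<le> \<epsilon>"
        by (auto elim: eventually_mono)
    qed
  next
    case True
    then obtain p :: int and q :: nat where pq: "q \<ge> 1" "\<alpha> ^ j = of_int p / real q"
      by (rule Rats_fractionE)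
    have "j \<noteq> 1" using True \<alpha> by auto
    then have j2: "j \<ge> 2" using less.prems by simp
    define z where "z n = real q * psum_lower (\<lambda>i. frac_part \<alpha> i n) j" for n
    have nz: "no_concentration z"
    proof (cases "j = 2")
      case True
      then show ?thesis
        unfolding z_def[abs_def] using no_concentration_square[OF \<alpha> pq(1)] by (simp add: psum_lower_2)
    next
      case False
      have "\<alpha> ^ (j - 1) \<notin> \<rat>" using irrational_predecessor[OF \<alpha>, of "j - 1"] True less.prems by simp
      then show ?thesis
        unfolding z_def[abs_def] using j2 False
        by (intro no_concentration_bilinear \<alpha> pq(1) parts) auto
    qed
    have yz: "real (j * q) * ?y n + z n \<in> \<int>" for n
    proof -
      have "int_class (j - 1) (\<lambda>n. psum_lower (\<lambda>i. - int_part \<alpha> i n) j)"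
        by (intro int_class_psum_lower parts_in_classD(2)[OF parts]) auto
      then have "psum_lower (\<lambda>i. - int_part \<alpha> i n) j \<in> \<int>" by (simp add: int_class_def)
      moreover have "real (j * q) * ?y n + z n = of_int p * real n ^ j + real q * psum_lower (\<lambda>i. - int_part \<alpha> i n) j"
      proof -
        have "real (j * q) * ?y n + z n = real q * (real j * ?y n) + z n" by simp
        also have "\<dots> = real q * \<alpha> ^ j * real n ^ j + real q * psum_lower (\<lambda>i. - int_part \<alpha> i n) j"
          unfolding nested_floor_identity[OF less.prems] z_def by (simp add: algebra_simps power_mult_distrib)
        finally show ?thesis using pq by simp
      qed
      ultimately show ?thesis by auto
    qed
    have "j * q \<ge> 1" using j2 pq(1) by simp
    from no_concentration_multiple[OF nz this yz] show ?thesis .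
  qed
  have ph: "(\<lambda>n. ee (?y n / real M)) \<in> phase_class j" if M: "M \<ge> 1" for M
  proof -
    have "\<exists>g\<in>phase_class j. \<forall>n. ee (of_int 1 * ?y n / real M)
        = g n * ee ((of_int 1 * \<alpha> ^ j / (real j * real M)) * real n ^ j)"
      by (rule nested_floor_phase[OF less.prems M]) (rule parts_in_classD[OF parts]; simp)+
    then obtain g where g: "g \<in> phase_class j"
      "\<And>n. ee (of_int 1 * ?y n / real M) = g n * ee ((of_int 1 * \<alpha> ^ j / (real j * real M)) * real n ^ j)"
      by blast
    have "(\<lambda>n. ee (poly (monom (of_int 1 * \<alpha> ^ j / (real j * real M)) j) (real n))) \<in> phase_class j"
      by (intro phase_class_phase) auto
    from phase_class_mult[OF g(1) this] show ?thesis using g(2) by (simp add: poly_monom)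
  qed
  have r: "real_class j (frac_part \<alpha> j)"
    unfolding real_class_def frac_part_def
    using ph[of 1] by (intro phase_class_frac nc) simp
  moreover have "int_class j (int_part \<alpha> j)"
    unfolding int_class_def
  proof (intro conjI allI impI)
    show "int_part \<alpha> j n \<in> \<int>" for n by (simp add: int_part_def)
    fix M :: nat assume M: "M \<ge> 1"
    have "(\<lambda>n. ee (?y n / real M) * ee (- (1 / real M) * frac_part \<alpha> j n)) \<in> phase_class j"
      by (intro phase_class_mult ph[OF M] real_class_ee r)
    then show "(\<lambda>n. ee (int_part \<alpha> j n / real M)) \<in> phase_class j"
      unfolding ee_add[symmetric] nested_floor_split by (simp add: add_divide_distrib)
  qed
  ultimately show ?case by (simp add: parts_in_class_def)
qed

theorem unif_dist_nested_floor:
  assumes "\<alpha> ^ k \<notin> \<rat>" "k \<ge> 1"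
  shows "unif_dist_mod1 (\<lambda>n. nested_floor (\<alpha> * real n) k)"
  using assms parts_in_class_all[OF irrational_root[OF assms(1)]]
  by (intro weyl_sums_imp_unif_dist nested_floor_weyl_sums) auto

section \<open>Rational powers: small cases\<close>

text \<open>
  All values lie in the lattice of multiples of \<open>1/q\<close>, so an interval strictly between two lattice
  points is never visited.
\<close>

lemma not_unif_dist_rational:
  assumes "\<alpha> \<in> \<rat>" "k \<ge> 1"
  shows "\<not> unif_dist_mod1 (\<lambda>n. nested_floor (\<alpha> * real n) k)"
proof
  assume ud: "unif_dist_mod1 (\<lambda>n. nested_floor (\<alpha> * real n) k)"
  obtain p :: int and q :: nat where pq: "q \<ge> 1" "\<alpha> = of_int p / real q"
    using assms(1) by (rule Rats_fractionE)
  obtain j where k: "k = Suc j" using assms(2) by (cases k) auto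
  let ?x = "\<lambda>n. frac (nested_floor (\<alpha> * real n) k)"
  have no: "\<not> (1 / (3 * real q) \<le> ?x n \<and> ?x n < 2 / (3 * real q))" for n
  proof
    assume A: "1 / (3 * real q) \<le> ?x n \<and> ?x n < 2 / (3 * real q)"
    have "real q * nested_floor (\<alpha> * real n) k \<in> \<int>"
      using pq by (simp add: k)
    then have "real q * ?x n \<in> \<int>"
      unfolding frac_def right_diff_distrib by (intro Ints_diff) auto
    then obtain l :: int where l: "real q * ?x n = of_int l" by (auto elim: Ints_cases)
    have "1 / 3 \<le> real q * ?x n" "real q * ?x n < 2 / 3"
      using A pq(1) by (auto simp: field_simps)
    then have "0 < real_of_int l" "real_of_int l < 1" unfolding l by linarith+
    then show False by simp
  qed
  have "0 < 1 / (3 * real q)" "1 / (3 * real q) < 2 / (3 * real q)" "2 / (3 * real q) \<le> 1"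
    using pq(1) by (auto simp: divide_strict_right_mono)
  then have "mean (\<lambda>n. of_bool (1 / (3 * real q) \<le> ?x n \<and> ?x n < 2 / (3 * real q)))
      \<longlonglongrightarrow> 2 / (3 * real q) - 1 / (3 * real q)"
    using ud unfolding unif_dist_mod1_mean by (meson less_imp_le)
  moreover have "mean (\<lambda>n. of_bool (1 / (3 * real q) \<le> ?x n \<and> ?x n < 2 / (3 * real q)) :: real) = (\<lambda>N. 0)"
    by (rule ext) (simp add: no mean_def)
  ultimately have "2 / (3 * real q) - 1 / (3 * real q) = (0::real)"
    by (metis LIMSEQ_const_iff)
  then show False using pq(1) by (simp add: field_simps)
qed

text \<open>
  As \<open>i\<close> and \<open>k\<close> are coprime, Bezout's identity expresses \<open>\<alpha>\<close> through \<open>\<alpha>^i\<close> and \<open>\<alpha>^k\<close>.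
\<close>

lemma irrational_lower_power:
  assumes k: "prime k" and \<alpha>: "\<alpha> \<notin> \<rat>" and r: "\<alpha> ^ k \<in> \<rat>" and i: "0 < i" "i < k"
  shows "\<alpha> ^ i \<notin> (\<rat> :: real set)"
proof
  assume ri: "\<alpha> ^ i \<in> \<rat>"
  have "coprime i k" using k i by (metis coprime_commute nat_dvd_not_less prime_imp_coprime)
  moreover obtain d x y where d: "d dvd i" "d dvd k" "i * x = k * y + d"
    using bezout_add_strong_nat[of i k] i by auto
  ultimately have "i * x = k * y + 1" by (metis coprime_common_divisor_nat)
  then have "\<alpha> = (\<alpha> ^ i) ^ x / (\<alpha> ^ k) ^ y"
    using \<alpha> by (simp add: power_mult[symmetric] power_add)
  then have "\<alpha> \<in> \<rat>" using ri r by (metis Rats_divide Rats_power)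
  with \<alpha> show False by simp
qed

text \<open>
  The multiple \<open>- k q\<close> of the nested expression is congruent to \<open>q psum_lower r k\<close> modulo 1.
\<close>

lemma psum_lower_weyl_sums:
  assumes \<alpha>: "\<alpha> \<notin> \<rat>" and k: "k \<ge> 1" and q: "\<alpha> ^ k = of_int p / real q" "q \<ge> 1"
    and ud: "unif_dist_mod1 (\<lambda>n. nested_floor (\<alpha> * real n) k)" and m: "m \<noteq> (0::int)"
  shows "mean (\<lambda>n. ee (of_int m * (real q * psum_lower (\<lambda>i. frac_part \<alpha> i n) k))) \<longlonglongrightarrow> 0"
proof -
  have "ee (of_int m * (real q * psum_lower (\<lambda>i. frac_part \<alpha> i n) k))
      = ee (of_int (- m * int (k * q)) * nested_floor (\<alpha> * real n) k)" for n
  proof (rule ee_cong_Ints)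
    have "int_class (k - 1) (\<lambda>n. psum_lower (\<lambda>i. - int_part \<alpha> i n) k)"
      by (intro int_class_psum_lower parts_in_classD(2)[OF parts_in_class_all[OF \<alpha>]]) auto
    then have I: "psum_lower (\<lambda>i. - int_part \<alpha> i n) k \<in> \<int>" by (simp add: int_class_def)
    have "of_int m * (real q * psum_lower (\<lambda>i. frac_part \<alpha> i n) k)
        - of_int (- m * int (k * q)) * nested_floor (\<alpha> * real n) k
        = of_int m * (real q * (real k * nested_floor (\<alpha> * real n) k) + real q * psum_lower (\<lambda>i. frac_part \<alpha> i n) k)"
      by (simp add: algebra_simps)
    also have "\<dots> = of_int m * ((real q * \<alpha> ^ k) * real n ^ k + real q * psum_lower (\<lambda>i. - int_part \<alpha> i n) k)"
      unfolding nested_floor_identity[OF k] by (simp add: algebra_simps power_mult_distrib)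
    also have "real q * \<alpha> ^ k = of_int p" using q by simp
    also have "of_int m * (of_int p * real n ^ k + real q * psum_lower (\<lambda>i. - int_part \<alpha> i n) k) \<in> \<int>"
      using I by auto
    finally show "of_int m * (real q * psum_lower (\<lambda>i. frac_part \<alpha> i n) k)
        - of_int (- m * int (k * q)) * nested_floor (\<alpha> * real n) k \<in> \<int>" .
  qed
  moreover have "- m * int (k * q) \<noteq> 0" using m k q(2) by simp
  from unif_dist_imp_weyl_sums[OF ud this]
  have "mean (\<lambda>n. ee (of_int (- m * int (k * q)) * nested_floor (\<alpha> * real n) k)) \<longlonglongrightarrow> 0" .
  ultimately show ?thesis by (simp only:)
qed

lemma continuous_fejer: "continuous_on S f \<Longrightarrow> continuous_on S (\<lambda>t. fejer M (f t))"
  unfolding fejer_def divide_inverse by (intro continuous_intros continuous_ee)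

text \<open>
  The values \<open>q t\<^sup>2\<close> stay within \<open>O(1 / M)\<close> of 0 for a proportion of order \<open>M powr (- 1 / 2)\<close> of
  all \<open>t\<close>, whereas uniform distribution of \<open>q r_1\<^sup>2\<close> would allow only \<open>1 / M\<close>.
\<close>

lemma not_unif_dist_square:
  assumes \<alpha>: "\<alpha> \<notin> \<rat>" and r: "\<alpha>\<^sup>2 \<in> \<rat>"
  shows "\<not> unif_dist_mod1 (\<lambda>n. nested_floor (\<alpha> * real n) 2)"
proof
  assume ud: "unif_dist_mod1 (\<lambda>n. nested_floor (\<alpha> * real n) 2)"
  obtain p :: int and q :: nat where pq: "q \<ge> 1" "\<alpha>\<^sup>2 = of_int p / real q"
    using r by (rule Rats_fractionE)
  let ?r = "\<lambda>n. frac_part \<alpha> 1 n"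
  \<comment> \<open>The two estimates compare as \<open>1 / (16 sqrt (q M)) \<le> 1 / M\<close>, that is, \<open>M \<le> 256 q\<close>.\<close>
  define M where "M = 257 * q"
  have M: "M > 0" using pq by (simp add: M_def)
  have "mean (\<lambda>n. ee (of_int m * (real q * (?r n * ?r n)))) \<longlonglongrightarrow> 0" if "m \<noteq> 0" for m :: int
    using psum_lower_weyl_sums[OF \<alpha> _ pq(2,1) ud that] by (simp add: psum_lower_2)
  from tendsto_fejer_mean[OF this M]
  have 1: "mean (\<lambda>n. fejer M (real q * (?r n * ?r n))) \<longlonglongrightarrow> 1 / real M" .
  define G where "G t = fejer M (real q * (t * t))" for t
  have cG: "continuous_on S G" for S
    unfolding G_def by (intro continuous_fejer continuous_intros)
  have "mean (\<lambda>n. G (?r n)) \<longlonglongrightarrow> integral {0..1} G"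
    unfolding frac_part_def using \<alpha> by (intro tendsto_mean_frac[OF nested_floor_weyl_sums cG]) auto
  with 1 have I: "integral {0..1} G = 1 / real M"
    unfolding G_def by (rule LIMSEQ_unique[rotated])
  define \<tau> where "\<tau> = 1 / (4 * sqrt (real q * real M))"
  have qM: "sqrt (real q * real M) > 0" "real q * real M \<ge> 1"
    using pq(1) M by (simp_all add: Suc_leI mult_ge1_I flip: of_nat_mult)
  then have "sqrt (real q * real M) \<ge> 1" by simp
  then have "4 * sqrt (real q * real M) \<ge> 1" by linarith
  then have \<tau>: "0 < \<tau>" "\<tau> \<le> 1"
    unfolding \<tau>_def using qM(1) by (simp_all only: divide_le_eq_1_pos zero_less_divide_1_iff mult_pos_pos zero_less_numeral)
  have "integral {0..\<tau>} (\<lambda>t. 1 / 4) \<le> integral {0..\<tau>} G"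
  proof (rule integral_le)
    fix t assume t: "t \<in> {0..\<tau>}"
    have "t * t \<le> \<tau> * \<tau>" using t by (intro mult_mono) auto
    also have "\<tau> * \<tau> = 1 / (16 * (real q * real M))"
      using qM by (simp add: \<tau>_def)
    finally have tt: "(t * t) * (16 * (real q * real M)) \<le> 1"
      using qM by (simp add: field_simps)
    have "cmod (ee (real q * (t * t)) - ee 0) \<le> 2 * pi * \<bar>real q * (t * t) - 0\<bar>" by (rule dist_ee_le)
    also have "\<dots> \<le> 2 * 4 * (real q * (t * t))"
      using pi_less_4 by (simp add: mult_right_mono)
    finally have "real M * cmod (ee (real q * (t * t)) - 1) \<le> real M * (2 * 4 * (real q * (t * t)))"
      by (intro mult_left_mono) auto
    also have "\<dots> \<le> 1 / 2" using tt by (simp add: mult_ac)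
    finally show "1 / 4 \<le> G t" unfolding G_def using M by (rule fejer_ge)
  qed (auto intro: integrable_continuous_interval cG)
  also have "\<dots> \<le> integral {0..1} G"
    using \<tau> by (intro integral_subset_le integrable_continuous_interval cG) (auto simp: G_def fejer_nonneg)
  finally have "\<tau> / 4 \<le> 1 / real M" using \<tau> I by simp
  then have "real M \<le> 16 * sqrt (real q * real M)"
    using M qM by (simp add: \<tau>_def field_simps)
  then have "(real M)\<^sup>2 \<le> (16 * sqrt (real q * real M))\<^sup>2" by (intro power_mono) auto
  then have "real M * real M \<le> 256 * (real q * real M)"
    using qM by (simp add: power_mult_distrib power2_eq_square)
  then have "real M \<le> 256 * real q" using M by simp
  then show False using pq(1) by (simp add: M_def)
qed

section \<open>Splitting off the high-index fractional parts\<close>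

definition inv_coeff :: "(nat \<Rightarrow> real) \<Rightarrow> nat \<Rightarrow> real" where
  "inv_coeff r i = fps_nth (inverse (1 - gen_fps r)) i"

lemma inv_coeff_0: "inv_coeff r 0 = 1"
  by (simp add: inv_coeff_def gen_fps_nth)

lemma inv_coeff_rec:
  assumes "i \<ge> 1"
  shows "inv_coeff r i = r i + (\<Sum>l=1..<i. r l * inv_coeff r (i - l))"
proof -
  let ?U = "inverse (1 - gen_fps r)"
  have "?U * (1 - gen_fps r) = 1" by (intro inverse_mult_eq_1) (simp add: gen_fps_nth)
  then have "?U = 1 + gen_fps r * ?U" by (simp add: algebra_simps)
  then have "inv_coeff r i = fps_nth (1 + gen_fps r * ?U) i"
    unfolding inv_coeff_def by (rule arg_cong)
  also have "\<dots> = (\<Sum>l=0..i. fps_nth (gen_fps r) l * inv_coeff r (i - l))"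
    using assms by (simp add: fps_mult_nth inv_coeff_def)
  also have "{0..i} = insert 0 (insert i {1..<i})" using assms by auto
  also have "(\<Sum>l\<in>insert 0 (insert i {1..<i}). fps_nth (gen_fps r) l * inv_coeff r (i - l))
      = r i + (\<Sum>l=1..<i. r l * inv_coeff r (i - l))"
    using assms by (simp add: gen_fps_nth inv_coeff_0)
  finally show ?thesis .
qed

text \<open>
  The entries of index at most \<open>s\<close>, that is, less than \<open>k / 2\<close> when \<open>k = 2 s + 1\<close>.
\<close>

definition low_part :: "nat \<Rightarrow> (nat \<Rightarrow> real) \<Rightarrow> nat \<Rightarrow> real" where
  "low_part s r i = (if i \<le> s then r i else 0)"

text \<open>
  Factor \<open>1 - R = (1 - L) (1 - V)\<close>, where \<open>L\<close> is the low part and \<open>V\<close> starts at index \<open>s + 1\<close>.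
  Products of two entries of \<open>V\<close> have index above \<open>k\<close>, so up to index \<open>k\<close> the factor \<open>1 - V\<close> contributes
  linearly in the high entries.
\<close>

lemma psum_lower_high:
  assumes k: "k = 2 * s + 1"
  shows "psum_lower r k = psum (low_part s r) k
     + real k * (\<Sum>i<s. inv_coeff (low_part s r) (Suc i) * r (k - Suc i))"
proof -
  let ?L = "gen_fps (low_part s r)"
  define H where "H = gen_fps r - ?L"
  define V where "V = H * inverse (1 - ?L)"
  have H: "fps_nth H i = (if i \<le> s then 0 else r i)" for i
    by (simp add: H_def gen_fps_nth low_part_def)
  have VU: "fps_nth V i = (\<Sum>l=0..i. fps_nth H l * inv_coeff (low_part s r) (i - l))" for i
    by (simp add: V_def fps_mult_nth inv_coeff_def)
  have V0: "fps_nth V i = 0" if "i \<le> s" for i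
    unfolding VU using that by (intro sum.neutral) (auto simp: H)
  have "1 - gen_fps r = (1 - ?L) * (1 - V)"
  proof -
    have "inverse (1 - ?L) * (1 - ?L) = 1" by (intro inverse_mult_eq_1) (simp add: gen_fps_nth)
    then have "V * (1 - ?L) = H" by (simp add: V_def mult.assoc)
    then show ?thesis by (simp add: H_def algebra_simps)
  qed
  from log_deriv_mult[OF _ V0 this]
  have "psum r k = psum (low_part s r) k + fps_nth (log_deriv V) k"
    by (simp add: psum_def gen_fps_nth)
  moreover have "fps_nth (log_deriv V) k = real k * fps_nth V k"
  proof -
    have small: "fps_nth (log_deriv V) m = 0" if "m \<le> s" for m
    proof -
      have "(\<Sum>i=1..<m. fps_nth V i * fps_nth (log_deriv V) (m - i)) = 0"
        using that by (intro sum.neutral) (auto simp: V0)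
      then show ?thesis using log_deriv_nth[OF V0, of m] V0[OF that] by simp
    qed
    have "(\<Sum>i=1..<k. fps_nth V i * fps_nth (log_deriv V) (k - i)) = 0"
    proof (intro sum.neutral ballI)
      fix i assume "i \<in> {1..<k}"
      then show "fps_nth V i * fps_nth (log_deriv V) (k - i) = 0"
        using k by (cases "i \<le> s") (auto simp: V0 small)
    qed
    then show ?thesis using log_deriv_nth[OF V0, of k] by simp
  qed
  moreover have "fps_nth V k = r k + (\<Sum>i<s. inv_coeff (low_part s r) (Suc i) * r (k - Suc i))"
  proof -
    have "fps_nth V k = (\<Sum>l\<in>insert k ((\<lambda>i. k - Suc i) ` {..<s}). fps_nth H l * inv_coeff (low_part s r) (k - l))"
      unfolding VU
    proof (intro sum.mono_neutral_right ballI)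
      show "insert k ((\<lambda>i. k - Suc i) ` {..<s}) \<subseteq> {0..k}" by auto
      fix l assume l: "l \<in> {0..k} - insert k ((\<lambda>i. k - Suc i) ` {..<s})"
      have "l \<le> s"
      proof (rule ccontr)
        assume "\<not> l \<le> s"
        then have "k - 1 - l < s" "l = k - Suc (k - 1 - l)" using l k by auto
        then show False using l by blast
      qed
      then show "fps_nth H l * inv_coeff (low_part s r) (k - l) = 0" by (simp add: H)
    qed simp
    also have "\<dots> = fps_nth H k * inv_coeff (low_part s r) (k - k)
        + (\<Sum>l\<in>(\<lambda>i. k - Suc i) ` {..<s}. fps_nth H l * inv_coeff (low_part s r) (k - l))"
      using k by (subst sum.insert) auto
    also have "(\<Sum>l\<in>(\<lambda>i. k - Suc i) ` {..<s}. fps_nth H l * inv_coeff (low_part s r) (k - l))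
        = (\<Sum>i<s. fps_nth H (k - Suc i) * inv_coeff (low_part s r) (k - (k - Suc i)))"
      using k by (subst sum.reindex) (auto simp: inj_on_def)
    also have "\<dots> = (\<Sum>i<s. inv_coeff (low_part s r) (Suc i) * r (k - Suc i))"
      using k by (intro sum.cong) (auto simp: H)
    finally show ?thesis using k by (simp add: H inv_coeff_0)
  qed
  ultimately show ?thesis using psum_rec[of k r] k by (simp add: distrib_left)
qed

lemma inv_coeff_closed:
  fixes Q :: "('a \<Rightarrow> real) \<Rightarrow> bool"
  assumes const: "\<And>k::nat. Q (\<lambda>n. real k)"
    and add: "\<And>f g. Q f \<Longrightarrow> Q g \<Longrightarrow> Q (\<lambda>n. f n + g n)"
    and mult: "\<And>f g. Q f \<Longrightarrow> Q g \<Longrightarrow> Q (\<lambda>n. f n * g n)"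
    and r: "\<And>i. 1 \<le> i \<Longrightarrow> i \<le> j \<Longrightarrow> Q (r i)" and j: "j \<ge> 1"
  shows "Q (\<lambda>n. inv_coeff (\<lambda>i. r i n) j)"
proof -
  have sum: "Q (\<lambda>n. \<Sum>i\<in>A. f i n)" if "finite A" "\<And>i. i \<in> A \<Longrightarrow> Q (f i)" for A :: "nat set" and f
    using that
  proof (induction A rule: finite_induct)
    case empty
    show ?case using const[of 0] by simp
  next
    case (insert x A)
    have "Q (\<lambda>n. f x n + (\<Sum>i\<in>A. f i n))"
      by (rule add) (use insert in auto)
    then show ?case using insert.hyps by simp
  qed
  from r j show ?thesis
  proof (induction j rule: less_induct)
    case (less j)
    have "Q (\<lambda>n. r j n + (\<Sum>i=1..<j. r i n * inv_coeff (\<lambda>i. r i n) (j - i)))"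
      using less.prems by (intro add mult const sum less.IH) auto
    then show ?case using less.prems by (simp add: inv_coeff_rec)
  qed
qed

lemma inv_coeff_nonneg: "(\<And>i. r i \<ge> 0) \<Longrightarrow> inv_coeff r i \<ge> 0"
proof (induction i rule: less_induct)
  case (less i)
  then show ?case
    by (cases "i = 0") (auto simp: inv_coeff_0 inv_coeff_rec intro!: add_nonneg_nonneg sum_nonneg mult_nonneg_nonneg)
qed

lemma inv_coeff_ge: "(\<And>i. r i \<ge> 0) \<Longrightarrow> i \<ge> 1 \<Longrightarrow> r i \<le> inv_coeff r i"
  by (simp add: inv_coeff_rec sum_nonneg inv_coeff_nonneg)

lemma psum_nonneg: "(\<And>i. r i \<ge> 0) \<Longrightarrow> i \<ge> 1 \<Longrightarrow> psum r i \<ge> 0"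
proof (induction i rule: less_induct)
  case (less i)
  have "0 \<le> (\<Sum>l=1..<i. r l * psum r (i - l))"
  proof (intro sum_nonneg mult_nonneg_nonneg less.prems)
    fix l assume "l \<in> {1..<i}"
    then show "0 \<le> psum r (i - l)" by (intro less.IH less.prems) auto
  qed
  then show ?case using less.prems by (simp add: psum_rec psum_lower_def)
qed

text \<open>
  The induction needs the stronger bound with \<open>2 i\<close>, as the step adds 2 on one side only.
\<close>

lemma sum_power4_le: "real i + (\<Sum>l=1..<i. 4 ^ (i - l)) \<le> 4 ^ i"
proof -
  have "2 * real i + (\<Sum>l=1..<i. 4 ^ (i - l)) \<le> 4 ^ i"
  proof (induction i)
    case (Suc i)
    have "(\<Sum>l=1..<Suc i. 4 ^ (Suc i - l) :: real) = (\<Sum>l=1..<i. 4 * 4 ^ (i - l)) + of_bool (i \<ge> 1) * 4"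
    proof (cases "i \<ge> 1")
      case True
      then have "(\<Sum>l=1..<Suc i. 4 ^ (Suc i - l) :: real) = (\<Sum>l=1..<i. 4 ^ (Suc i - l)) + 4"
        by (simp add: sum.atLeastLessThan_Suc)
      also have "(\<Sum>l=1..<i. 4 ^ (Suc i - l) :: real) = (\<Sum>l=1..<i. 4 * 4 ^ (i - l))"
        by (intro sum.cong) (auto simp: Suc_diff_le)
      finally show ?thesis using True by simp
    qed auto
    also have "\<dots> = 4 * (\<Sum>l=1..<i. 4 ^ (i - l)) + of_bool (i \<ge> 1) * 4" by (simp add: sum_distrib_left)
    finally show ?case using Suc.IH by (cases "i = 0") (auto simp: of_bool_def)
  qed simp
  then show ?thesis by linarith
qed

text \<open>
  The crude constant \<open>4^i\<close> is chosen to make both recursions close at once; see \<open>sum_power4_le\<close>.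
\<close>

lemma coeff_linear_bound:
  assumes r: "\<And>i. 0 \<le> r i" "\<And>i. r i \<le> \<tau>" and \<tau>: "\<tau> \<le> 1" and i: "i \<ge> 1"
  shows "inv_coeff r i \<le> 4 ^ i * \<tau> \<and> psum r i \<le> 4 ^ i * \<tau>"
  using i
proof (induction i rule: less_induct)
  case (less i)
  have t0: "\<tau> \<ge> 0" using r[of 0] by linarith
  have *: "(\<Sum>l=1..<i. r l * F (i - l)) \<le> (\<Sum>l=1..<i. 4 ^ (i - l)) * \<tau>"
    if F: "\<And>m. 1 \<le> m \<Longrightarrow> m < i \<Longrightarrow> 0 \<le> F m \<and> F m \<le> 4 ^ m * \<tau>" for F
  proof -
    have "(\<Sum>l=1..<i. r l * F (i - l)) \<le> (\<Sum>l=1..<i. 1 * (4 ^ (i - l) * \<tau>))"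
      using F r \<tau> by (intro sum_mono mult_mono) (auto intro: order_trans)
    then show ?thesis by (simp add: sum_distrib_right)
  qed
  have IH: "0 \<le> inv_coeff r m \<and> inv_coeff r m \<le> 4 ^ m * \<tau>" "0 \<le> psum r m \<and> psum r m \<le> 4 ^ m * \<tau>"
    if "1 \<le> m" "m < i" for m
    using less.IH[of m] that inv_coeff_nonneg[of r m] psum_nonneg[of r m] r(1) by blast+
  have "inv_coeff r i \<le> 1 * \<tau> + (\<Sum>l=1..<i. 4 ^ (i - l)) * \<tau>"
    unfolding inv_coeff_rec[OF less.prems] mult_1_left by (intro add_mono * r IH)
  also have "\<dots> \<le> real i * \<tau> + (\<Sum>l=1..<i. 4 ^ (i - l)) * \<tau>"
    using less.prems t0 by (intro add_right_mono mult_right_mono) auto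
  also have "\<dots> \<le> 4 ^ i * \<tau>"
    unfolding distrib_right[symmetric] using sum_power4_le[of i] t0 by (rule mult_right_mono)
  finally have 1: "inv_coeff r i \<le> 4 ^ i * \<tau>" .
  have "psum r i \<le> real i * \<tau> + (\<Sum>l=1..<i. 4 ^ (i - l)) * \<tau>"
    unfolding psum_rec[OF less.prems] psum_lower_def by (intro add_mono mult_left_mono * r IH) simp_all
  also have "\<dots> \<le> 4 ^ i * \<tau>"
    unfolding distrib_right[symmetric] using sum_power4_le[of i] t0 by (rule mult_right_mono)
  finally show ?case using 1 by simp
qed

lemma inv_coeff_quadratic:
  assumes r: "\<And>i. 0 \<le> r i" "\<And>i. r i \<le> \<tau>" and \<tau>: "\<tau> \<le> 1" and i: "i \<ge> 1"
  shows "inv_coeff r i \<le> r i + real i * 4 ^ i * \<tau>\<^sup>2"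
proof -
  have t0: "\<tau> \<ge> 0" using r[of 0] by linarith
  have "(\<Sum>l=1..<i. r l * inv_coeff r (i - l)) \<le> (\<Sum>l=1..<i. \<tau> * (4 ^ i * \<tau>))"
  proof (intro sum_mono mult_mono)
    fix l assume l: "l \<in> {1..<i}"
    then have "inv_coeff r (i - l) \<le> 4 ^ (i - l) * \<tau>"
      using coeff_linear_bound[of r, OF r \<tau>, of "i - l"] by auto
    also have "\<dots> \<le> 4 ^ i * \<tau>" using t0 by (intro mult_right_mono power_increasing) auto
    finally show "inv_coeff r (i - l) \<le> 4 ^ i * \<tau>" .
  qed (use r t0 inv_coeff_nonneg[of r, OF r(1)] in auto)
  also have "\<dots> = real (i - 1) * (4 ^ i * \<tau>\<^sup>2)" by (simp add: power2_eq_square)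
  also have "\<dots> \<le> real i * (4 ^ i * \<tau>\<^sup>2)" by (intro mult_right_mono) auto
  finally show ?thesis using i by (simp add: inv_coeff_rec mult.assoc)
qed

text \<open>
  All parts are at most \<open>s < k / 2\<close>, so every monomial of total index \<open>k\<close> has at least three factors.
\<close>

lemma psum_cubic:
  assumes r: "\<And>i. 0 \<le> r i" "\<And>i. r i \<le> \<tau>" and \<tau>: "\<tau> \<le> 1"
    and k: "k = 2 * s + 1" "s \<ge> 1" and high: "\<And>i. i > s \<Longrightarrow> r i = 0"
  shows "psum r k \<le> real k ^ 2 * 4 ^ k * \<tau> ^ 3"
proof -
  have t0: "\<tau> \<ge> 0" using r[of 0] by linarith
  have quad: "psum r m \<le> real k * 4 ^ k * \<tau>\<^sup>2" if m: "s < m" "m \<le> k" for m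
  proof -
    have "psum r m = (\<Sum>l=1..<m. r l * psum r (m - l))"
      using m by (simp add: psum_rec psum_lower_def high)
    also have "\<dots> \<le> (\<Sum>l=1..<m. \<tau> * (4 ^ k * \<tau>))"
    proof (intro sum_mono mult_mono)
      fix l assume l: "l \<in> {1..<m}"
      then have "psum r (m - l) \<le> 4 ^ (m - l) * \<tau>"
        using coeff_linear_bound[of r, OF r \<tau>, of "m - l"] by auto
      also have "\<dots> \<le> 4 ^ k * \<tau>" using t0 m by (intro mult_right_mono power_increasing) auto
      finally show "psum r (m - l) \<le> 4 ^ k * \<tau>" .
      show "0 \<le> psum r (m - l)" using l by (intro psum_nonneg r) auto
    qed (use r t0 in auto)
    also have "\<dots> = real (m - 1) * (4 ^ k * \<tau>\<^sup>2)" by (simp add: power2_eq_square)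
    also have "\<dots> \<le> real k * (4 ^ k * \<tau>\<^sup>2)" using m by (intro mult_right_mono) auto
    finally show ?thesis by (simp add: mult.assoc)
  qed
  have "psum r k = (\<Sum>l=1..<k. r l * psum r (k - l))"
    using k by (simp add: psum_rec psum_lower_def high)
  also have "\<dots> \<le> (\<Sum>l=1..<k. \<tau> * (real k * 4 ^ k * \<tau>\<^sup>2))"
  proof (rule sum_mono)
    fix l assume l: "l \<in> {1..<k}"
    show "r l * psum r (k - l) \<le> \<tau> * (real k * 4 ^ k * \<tau>\<^sup>2)"
    proof (cases "l \<le> s")
      case True
      then show ?thesis using l k quad[of "k - l"] r t0
        by (intro mult_mono psum_nonneg) auto
    next
      case False
      then show ?thesis using t0 by (simp add: high)
    qed
  qed
  also have "\<dots> = real (k - 1) * (real k * 4 ^ k * \<tau> ^ 3)" by (simp add: power2_eq_square power3_eq_cube)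
  also have "\<dots> \<le> real k * (real k * 4 ^ k * \<tau> ^ 3)" using t0 by (intro mult_right_mono) auto
  finally show ?thesis by (simp add: power2_eq_square mult.assoc)
qed

section \<open>A kernel with a logarithmic lower bound\<close>

text \<open>
  This is \<open>(exp (i y b) - 1) / b\<close>, continued to \<open>b = 0\<close>.
\<close>

definition edge_factor :: "real \<Rightarrow> real \<Rightarrow> complex" where
  "edge_factor y b = \<i> * of_real y * exp_avg (\<i> * of_real (y * b))"

lemma edge_factor_le: "cmod (edge_factor y b) \<le> \<bar>y\<bar>"
  using mult_left_mono[OF exp_avg_ii_le_1[of "y * b"], of "\<bar>y\<bar>"]
  by (simp add: edge_factor_def norm_mult)

lemma edge_factor_mult_le: "\<bar>b\<bar> * cmod (edge_factor y b) \<le> 2"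
  using exp_avg_ii_bound[of "y * b"] by (simp add: edge_factor_def norm_mult abs_mult mult_ac)

lemma edge_factor_mult: "edge_factor (2 * pi * x) b * of_real b = ee (x * b) - 1"
proof -
  have "edge_factor (2 * pi * x) b * of_real b
      = \<i> * of_real (2 * pi * x * b) * exp_avg (\<i> * of_real (2 * pi * x * b))"
    by (simp add: edge_factor_def mult_ac)
  also have "\<dots> = exp (\<i> * of_real (2 * pi * x * b)) - 1" by (rule exp_avg_mult)
  finally show ?thesis by (simp add: ee_def cis_conv_exp mult_ac)
qed

text \<open>
  Summand by summand: the Weyl sum of frequency \<open>i - j\<close> after integrating out the high variables,
  rescaled by the \<open>s\<close>-th power of the frequency, and weighted as in the Fejer kernel.
\<close>

definition edge_kernel :: "nat \<Rightarrow> real \<Rightarrow> nat \<Rightarrow> real \<Rightarrow> (nat \<Rightarrow> real) \<Rightarrow> complex" where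
  "edge_kernel M c s S b = (\<Sum>i<M. \<Sum>j<M. ee ((real i - real j) * S) *
     (\<Prod>l<s. edge_factor (2 * pi * ((real i - real j) * c)) (b l))) / of_nat M ^ 2"

lemma edge_kernel_bound:
  assumes c: "c \<ge> 0" and M: "M > 0"
    and B: "\<And>l y. l < s \<Longrightarrow> \<bar>y\<bar> \<le> 2 * pi * c * real M \<Longrightarrow> cmod (edge_factor y (b l)) \<le> B l"
  shows "cmod (edge_kernel M c s S b) \<le> (\<Prod>l<s. B l)"
proof -
  have "cmod (\<Sum>i<M. \<Sum>j<M. ee ((real i - real j) * S) * (\<Prod>l<s. edge_factor (2 * pi * ((real i - real j) * c)) (b l)))
     \<le> (\<Sum>i<M. \<Sum>j<M. (\<Prod>l<s. B l))"
  proof (intro sum_norm_le)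
    fix i j assume "i \<in> {..<M}" "j \<in> {..<M}"
    then have "\<bar>real i - real j\<bar> * c \<le> real M * c" using c by (intro mult_right_mono) auto
    then have "2 * pi * (\<bar>real i - real j\<bar> * c) \<le> 2 * pi * (real M * c)" by (intro mult_left_mono) auto
    moreover have "\<bar>2 * pi * ((real i - real j) * c)\<bar> = 2 * pi * (\<bar>real i - real j\<bar> * c)"
      unfolding abs_mult using c by simp
    ultimately have y: "\<bar>2 * pi * ((real i - real j) * c)\<bar> \<le> 2 * pi * c * real M"
      by (simp only: mult_ac)
    show "cmod (ee ((real i - real j) * S) * (\<Prod>l<s. edge_factor (2 * pi * ((real i - real j) * c)) (b l))) \<le> (\<Prod>l<s. B l)"
      unfolding norm_mult norm_ee mult_1_left prod_norm[symmetric]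
      using y by (intro prod_mono conjI B) auto
  qed
  also have "\<dots> = real M ^ 2 * (\<Prod>l<s. B l)" by (simp add: power2_eq_square)
  finally show ?thesis
    using M by (simp add: edge_kernel_def norm_divide norm_power divide_le_eq mult.commute)
qed

lemma sum_rotate: "(\<Sum>i\<in>I. \<Sum>j\<in>J. \<Sum>a\<in>A. f a i j) = (\<Sum>a\<in>A. \<Sum>i\<in>I. \<Sum>j\<in>J. f a i j)"
proof -
  have "(\<Sum>i\<in>I. \<Sum>j\<in>J. \<Sum>a\<in>A. f a i j) = (\<Sum>i\<in>I. \<Sum>a\<in>A. \<Sum>j\<in>J. f a i j)"
    by (intro sum.cong refl sum.swap)
  also have "\<dots> = (\<Sum>a\<in>A. \<Sum>i\<in>I. \<Sum>j\<in>J. f a i j)" by (rule sum.swap)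
  finally show ?thesis .
qed

text \<open>
  Multiplied by \<open>\<Prod> b_l\<close>, the kernel is the mixed finite difference with steps \<open>c b_l\<close> of the
  Fejer kernel at \<open>S\<close>.
\<close>

lemma edge_kernel_expand:
  "edge_kernel M c s S b * of_real (\<Prod>l<s. b l) =
     (\<Sum>A\<in>Pow {..<s}. (-1) ^ card ({..<s} - A) * of_real (fejer M (S + c * (\<Sum>l\<in>A. b l))))"
proof -
  have expand: "ee (D * S) * (\<Prod>l<s. edge_factor (2 * pi * (D * c)) (b l)) * of_real (\<Prod>l<s. b l)
     = (\<Sum>A\<in>Pow {..<s}. (-1) ^ card ({..<s} - A) * ee (D * (S + c * (\<Sum>l\<in>A. b l))))" for D
  proof -
    have "(\<Prod>l<s. edge_factor (2 * pi * (D * c)) (b l)) * of_real (\<Prod>l<s. b l)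
        = (\<Prod>l<s. ee (D * c * b l) + (-1))"
      by (simp only: of_real_prod prod.distrib[symmetric] edge_factor_mult) simp
    also have "\<dots> = (\<Sum>A\<in>Pow {..<s}. (\<Prod>l\<in>A. ee (D * c * b l)) * (\<Prod>l\<in>{..<s}-A. -1))"
      by (rule prod_add) simp
    finally have "ee (D * S) * (\<Prod>l<s. edge_factor (2 * pi * (D * c)) (b l)) * of_real (\<Prod>l<s. b l)
        = (\<Sum>A\<in>Pow {..<s}. ee (D * S) * ((\<Prod>l\<in>A. ee (D * c * b l)) * (\<Prod>l\<in>{..<s}-A. -1)))"
      by (simp only: mult.assoc sum_distrib_left)
    also have "\<dots> = (\<Sum>A\<in>Pow {..<s}. (-1) ^ card ({..<s} - A) * ee (D * (S + c * (\<Sum>l\<in>A. b l))))"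
    proof (intro sum.cong refl)
      fix A assume "A \<in> Pow {..<s}"
      then have "finite A" by (auto intro: finite_subset)
      then have "ee (D * (S + c * (\<Sum>l\<in>A. b l))) = ee (D * S) * (\<Prod>l\<in>A. ee (D * c * b l))"
        by (simp add: distrib_left ee_add ee_sum[symmetric] sum_distrib_left mult.assoc)
      then show "ee (D * S) * ((\<Prod>l\<in>A. ee (D * c * b l)) * (\<Prod>l\<in>{..<s}-A. -1))
          = (-1) ^ card ({..<s} - A) * ee (D * (S + c * (\<Sum>l\<in>A. b l)))"
        by simp
    qed
    finally show ?thesis .
  qed
  have "edge_kernel M c s S b * of_real (\<Prod>l<s. b l)
     = (\<Sum>i<M. \<Sum>j<M. \<Sum>A\<in>Pow {..<s}. (-1) ^ card ({..<s} - A) * ee ((real i - real j) * (S + c * (\<Sum>l\<in>A. b l)))) / of_nat M ^ 2"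
    unfolding edge_kernel_def times_divide_eq_left sum_distrib_right by (simp only: expand)
  also have "(\<Sum>i<M. \<Sum>j<M. \<Sum>A\<in>Pow {..<s}. (-1) ^ card ({..<s} - A) * ee ((real i - real j) * (S + c * (\<Sum>l\<in>A. b l))))
     = (\<Sum>A\<in>Pow {..<s}. (-1) ^ card ({..<s} - A) * (\<Sum>i<M. \<Sum>j<M. ee ((real i - real j) * (S + c * (\<Sum>l\<in>A. b l)))))"
    unfolding sum_distrib_left by (rule sum_rotate)
  finally show ?thesis
    unfolding fejer_expand times_divide_eq_right sum_divide_distrib[of _ "Pow {..<s}"] .
qed

lemma edge_kernel_Re:
  "Re ((-1) ^ s * edge_kernel M c s S b) * (\<Prod>l<s. b l) =
     (\<Sum>A\<in>Pow {..<s}. (-1) ^ card A * fejer M (S + c * (\<Sum>l\<in>A. b l)))"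
proof -
  have "(-1) ^ s * edge_kernel M c s S b * of_real (\<Prod>l<s. b l)
     = (\<Sum>A\<in>Pow {..<s}. (-1) ^ s * ((-1) ^ card ({..<s} - A) * of_real (fejer M (S + c * (\<Sum>l\<in>A. b l)))))"
    by (simp only: mult.assoc edge_kernel_expand sum_distrib_left)
  also have "\<dots> = (\<Sum>A\<in>Pow {..<s}. of_real ((-1) ^ card A * fejer M (S + c * (\<Sum>l\<in>A. b l))))"
  proof (intro sum.cong refl)
    fix A assume A: "A \<in> Pow {..<s}"
    then have fA: "finite A" by (auto intro: finite_subset)
    have "card ({..<s} - A) + card A = s"
      using A card_Diff_subset[OF fA, of "{..<s}"] card_mono[of "{..<s}" A] by auto
    then have "s + card ({..<s} - A) = card A + 2 * card ({..<s} - A)" by linarith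
    then have "(-1) ^ s * (-1) ^ card ({..<s} - A) = ((-1) ^ card A :: complex)"
      unfolding power_add[symmetric] by (simp only:) (simp add: power_add power_mult)
    then show "(-1) ^ s * ((-1) ^ card ({..<s} - A) * complex_of_real (fejer M (S + c * (\<Sum>l\<in>A. b l))))
       = of_real ((-1) ^ card A * fejer M (S + c * (\<Sum>l\<in>A. b l)))"
      by (simp add: mult.assoc[symmetric])
  qed
  finally have "Re ((-1) ^ s * edge_kernel M c s S b * of_real (\<Prod>l<s. b l))
     = (\<Sum>A\<in>Pow {..<s}. (-1) ^ card A * fejer M (S + c * (\<Sum>l\<in>A. b l)))"
    by (simp only: of_real_sum[symmetric] Re_complex_of_real)
  moreover have "Re (z * of_real x) = Re z * x" for z x by simp
  ultimately show ?thesis by (simp only:)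
qed

text \<open>
  A geometric sum, with \<open>|ee t - 1| \<ge> t\<close> from the cubic Taylor bound for the sine.
\<close>

lemma fejer_decay:
  assumes t: "0 < t" "t \<le> 1 / 2" and M: "M > 0"
  shows "fejer M t \<le> 4 / (real M * t)\<^sup>2"
proof -
  let ?z = "ee t"
  have "pi * t \<le> 4 * (1 / 2)" using t pi_less_4 by (intro mult_mono) auto
  then have x: "0 < pi * t" "pi * t \<le> 2" using t by auto
  have "\<bar>sin (pi * t) - (\<Sum>m<3. sin_coeff m * (pi * t) ^ m)\<bar> \<le> inverse (fact 3) * \<bar>pi * t\<bar> ^ 3"
    by (rule Maclaurin_sin_bound)
  moreover have "(\<Sum>m<3. sin_coeff m * (pi * t) ^ m) = pi * t"
    by (simp add: sin_coeff_def eval_nat_numeral)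
  moreover have "inverse (fact 3) * \<bar>pi * t\<bar> ^ 3 = (pi * t) ^ 3 / 6"
    using x by (simp add: fact_numeral)
  ultimately have "\<bar>sin (pi * t) - pi * t\<bar> \<le> (pi * t) ^ 3 / 6" by (simp only:)
  then have "sin (pi * t) \<ge> pi * t - (pi * t) ^ 3 / 6" by linarith
  moreover have "(pi * t) ^ 3 \<le> 4 * (pi * t)"
    using x mult_mono[of "pi * t" 2 "pi * t" 2] by (simp add: power3_eq_cube mult_right_mono)
  ultimately have "sin (pi * t) \<ge> pi * t / 3" by simp
  moreover have "pi * t / 3 \<ge> 2 * t / 3" using pi_ge_two t by simp
  ultimately have s: "2 * sin (pi * t) \<ge> t" using t by linarith
  have "cmod (?z - 1) = 2 * \<bar>sin (2 * pi * t / 2)\<bar>"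
    unfolding ee_def cis_conv_exp dist_exp_i_1 ..
  then have z: "cmod (?z - 1) \<ge> t" using s by simp
  then have "?z \<noteq> 1" using t by auto
  then have "(\<Sum>m<M. ee (real m * t)) = (?z ^ M - 1) / (?z - 1)"
    unfolding ee_mult_nat by (rule geometric_sum)
  moreover have "cmod (?z ^ M - 1) \<le> 2"
    using norm_triangle_ineq4[of "?z ^ M" 1] by (simp add: norm_power)
  then have "cmod (?z ^ M - 1) / cmod (?z - 1) / real M \<le> 2 / t / real M"
    using z t by (intro divide_right_mono frac_le) auto
  ultimately have "cmod ((\<Sum>m<M. ee (real m * t)) / of_nat M) \<le> 2 / t / real M"
    by (simp only: norm_divide norm_of_nat)
  then have "fejer M t \<le> (2 / t / real M)\<^sup>2"
    unfolding fejer_def by (intro power_mono) auto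
  then show ?thesis by (simp add: power_divide power_mult_distrib field_simps)
qed

text \<open>
  With \<open>\<epsilon> = 1/M\<close>, the three weights describe one variable of the kernel: \<open>pole_weight\<close>, with
  integral about \<open>log M\<close>, bounds the kernel from above; \<open>cut_pole_weight\<close>, with integral about
  \<open>(log M) / 2\<close> and supported below \<open>1 / sqrt M\<close>, bounds it from below; and \<open>spread_weight\<close>, with
  bounded integral, dominates \<open>pole_weight\<close> both where the variable is of order at most \<open>1/M\<close>
  and where it is bounded away from 0, up to constants.
\<close>

definition pole_weight :: "real \<Rightarrow> real \<Rightarrow> real" where "pole_weight \<epsilon> t = 1 / (t + \<epsilon>)"
definition spread_weight :: "real \<Rightarrow> real \<Rightarrow> real" where "spread_weight \<epsilon> t = 1 + \<epsilon>\<^sup>2 / (t + \<epsilon>) ^ 3"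
definition cut_pole_weight :: "real \<Rightarrow> real \<Rightarrow> real" where "cut_pole_weight \<epsilon> t = max 0 (1 / (t + \<epsilon>) - 1 / (sqrt \<epsilon> + \<epsilon>))"

text \<open>
  In each summand one variable carries the weight with bounded integral, so that the mean over
  independent uniform variables is of order \<open>(log M)^(s-1)\<close>.
\<close>

definition edge_error :: "real \<Rightarrow> nat \<Rightarrow> (nat \<Rightarrow> real) \<Rightarrow> real" where
  "edge_error \<epsilon> s \<rho> = (\<Sum>j<s. spread_weight \<epsilon> (\<rho> j) * (\<Prod>i\<in>{..<s}-{j}. pole_weight \<epsilon> (\<rho> i)))"

lemma pole_weight_nonneg: "\<epsilon> > 0 \<Longrightarrow> t \<ge> 0 \<Longrightarrow> pole_weight \<epsilon> t \<ge> 0"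
  by (simp add: pole_weight_def)

lemma spread_weight_ge_1: "\<epsilon> > 0 \<Longrightarrow> t \<ge> 0 \<Longrightarrow> spread_weight \<epsilon> t \<ge> 1"
  by (simp add: spread_weight_def)

lemma cut_pole_weight_le: "\<epsilon> > 0 \<Longrightarrow> t \<ge> 0 \<Longrightarrow> 0 \<le> cut_pole_weight \<epsilon> t \<and> cut_pole_weight \<epsilon> t \<le> pole_weight \<epsilon> t"
  by (simp add: cut_pole_weight_def pole_weight_def)

lemma cut_pole_weight_eq_0: "\<epsilon> > 0 \<Longrightarrow> t \<ge> sqrt \<epsilon> \<Longrightarrow> cut_pole_weight \<epsilon> t = 0"
proof -
  assume e: "\<epsilon> > 0" and t: "t \<ge> sqrt \<epsilon>"
  have "1 / (t + \<epsilon>) \<le> 1 / (sqrt \<epsilon> + \<epsilon>)"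
    using e t by (intro divide_left_mono mult_pos_pos add_pos_pos) (auto intro: less_le_trans[of _ "sqrt \<epsilon>"])
  then show ?thesis by (simp add: cut_pole_weight_def)
qed

lemma edge_error_ge:
  assumes "\<epsilon> > 0" "\<And>i. i < s \<Longrightarrow> \<rho> i \<ge> 0" "j < s"
  shows "spread_weight \<epsilon> (\<rho> j) * (\<Prod>i\<in>{..<s}-{j}. pole_weight \<epsilon> (\<rho> i)) \<le> edge_error \<epsilon> s \<rho>"
  unfolding edge_error_def
proof (rule member_le_sum)
  fix i assume "i \<in> {..<s} - {j}"
  then show "0 \<le> spread_weight \<epsilon> (\<rho> i) * (\<Prod>i\<in>{..<s}-{i}. pole_weight \<epsilon> (\<rho> i))"
    using assms spread_weight_ge_1[of \<epsilon> "\<rho> i"] by (intro mult_nonneg_nonneg prod_nonneg pole_weight_nonneg) auto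
qed (use assms in auto)

lemma edge_error_nonneg:
  assumes "\<epsilon> > 0" "\<And>i. i < s \<Longrightarrow> \<rho> i \<ge> 0"
  shows "edge_error \<epsilon> s \<rho> \<ge> 0"
  unfolding edge_error_def
proof (rule sum_nonneg)
  fix i assume "i \<in> {..<s}"
  then show "0 \<le> spread_weight \<epsilon> (\<rho> i) * (\<Prod>i\<in>{..<s}-{i}. pole_weight \<epsilon> (\<rho> i))"
    using assms spread_weight_ge_1[of \<epsilon> "\<rho> i"] by (intro mult_nonneg_nonneg prod_nonneg pole_weight_nonneg) auto
qed

lemma edge_factor_le_pole:
  assumes M: "M > 0" and c: "c \<ge> 1" and \<rho>: "0 \<le> \<rho>" "\<rho> \<le> b" and y: "\<bar>y\<bar> \<le> 2 * pi * c * real M"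
  shows "cmod (edge_factor y b) \<le> 4 * pi * c * pole_weight (1 / real M) \<rho>"
proof (cases "\<rho> \<le> 1 / real M")
  case True
  have "cmod (edge_factor y b) \<le> 2 * pi * c * real M" using edge_factor_le y by (rule order_trans)
  also have "\<dots> = 4 * pi * c * (1 / (2 / real M))" using M by simp
  also have "\<dots> \<le> 4 * pi * c * (1 / (\<rho> + 1 / real M))"
    using True M c \<rho> by (intro mult_left_mono divide_left_mono mult_pos_pos add_nonneg_pos) auto
  finally show ?thesis by (simp add: pole_weight_def)
next
  case False
  then have pos: "\<rho> > 0" using M by (auto intro: less_trans[of _ "1 / real M"])
  have "\<rho> * cmod (edge_factor y b) \<le> b * cmod (edge_factor y b)" using \<rho> by (intro mult_right_mono) auto
  also have "\<dots> \<le> 2" using edge_factor_mult_le[of b y] \<rho> by simp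
  finally have "cmod (edge_factor y b) \<le> 2 / \<rho>" using pos by (simp add: field_simps)
  also have "\<dots> = 4 * (1 / (2 * \<rho>))" by simp
  also have "\<dots> \<le> 4 * (1 / (\<rho> + 1 / real M))"
    using False pos M by (intro mult_left_mono divide_left_mono mult_pos_pos add_pos_nonneg) auto
  also have "\<dots> \<le> 4 * pi * c * (1 / (\<rho> + 1 / real M))"
  proof (rule mult_right_mono)
    have "1 * 1 \<le> pi * c" using c pi_ge_two by (intro mult_mono) auto
    then show "4 \<le> 4 * pi * c" by simp
  qed (use pos in auto)
  finally show ?thesis by (simp add: pole_weight_def)
qed

lemma prod_remove: "j < s \<Longrightarrow> (\<Prod>i<s. f i) = f j * (\<Prod>i\<in>{..<s::nat}-{j}. f i :: real)"
  by (rule prod.remove) auto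

lemma prod_pole_le_error:
  assumes "\<epsilon> > 0" "\<And>i. i < s \<Longrightarrow> \<rho> i \<ge> 0" "j < s" "\<rho> j \<le> \<epsilon>"
  shows "(\<Prod>i<s. pole_weight \<epsilon> (\<rho> i)) \<le> 8 * edge_error \<epsilon> s \<rho>"
proof -
  have r: "0 \<le> \<rho> j" using assms by simp
  have "pole_weight \<epsilon> (\<rho> j) \<le> 1 / \<epsilon>"
    unfolding pole_weight_def using assms(1) r by (intro divide_left_mono) auto
  also have "\<dots> = 8 * (\<epsilon>\<^sup>2 / (2 * \<epsilon>) ^ 3)"
    using assms(1) by (simp add: power2_eq_square power3_eq_cube)
  also have "\<epsilon>\<^sup>2 / (2 * \<epsilon>) ^ 3 \<le> \<epsilon>\<^sup>2 / (\<rho> j + \<epsilon>) ^ 3"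
    using assms(1,4) r by (intro divide_left_mono power_mono mult_pos_pos zero_less_power add_nonneg_pos) auto
  also have "\<dots> \<le> spread_weight \<epsilon> (\<rho> j)" by (simp add: spread_weight_def)
  finally have "pole_weight \<epsilon> (\<rho> j) \<le> 8 * spread_weight \<epsilon> (\<rho> j)" by simp
  then have "pole_weight \<epsilon> (\<rho> j) * (\<Prod>i\<in>{..<s}-{j}. pole_weight \<epsilon> (\<rho> i)) \<le> 8 * spread_weight \<epsilon> (\<rho> j) * (\<Prod>i\<in>{..<s}-{j}. pole_weight \<epsilon> (\<rho> i))"
    using assms by (intro mult_right_mono prod_nonneg pole_weight_nonneg) auto
  also have "\<dots> \<le> 8 * edge_error \<epsilon> s \<rho>"
    using edge_error_ge[of \<epsilon> s \<rho> j] assms by simp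
  finally show ?thesis using prod_remove[OF assms(3), of "\<lambda>i. pole_weight \<epsilon> (\<rho> i)"] by simp
qed

text \<open>
  A variable below \<open>1/M\<close> saves a logarithm.
\<close>

lemma edge_kernel_small:
  assumes M: "M > 0" and c: "c \<ge> 1" and \<rho>: "\<And>i. i < s \<Longrightarrow> 0 \<le> \<rho> i \<and> \<rho> i \<le> b i"
    and j: "j < s" "\<rho> j \<le> 1 / real M"
  shows "cmod (edge_kernel M c s S b) \<le> (4 * pi * c) ^ s * (8 * edge_error (1 / real M) s \<rho>)"
proof -
  have "cmod (edge_kernel M c s S b) \<le> (\<Prod>l<s. 4 * pi * c * pole_weight (1 / real M) (\<rho> l))"
    using c M \<rho> by (intro edge_kernel_bound edge_factor_le_pole) auto
  also have "\<dots> = (4 * pi * c) ^ s * (\<Prod>l<s. pole_weight (1 / real M) (\<rho> l))" by (simp add: prod.distrib)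
  also have "\<dots> \<le> (4 * pi * c) ^ s * (8 * edge_error (1 / real M) s \<rho>)"
    using c M \<rho> j by (intro mult_left_mono prod_pole_le_error) auto
  finally show ?thesis .
qed

text \<open>
  So does a variable bounded away from 0, because then the pole is cut off at \<open>\<delta>\<close>.
\<close>

lemma edge_kernel_large:
  assumes M: "M > 0" and c: "c \<ge> 1" and \<rho>: "\<And>i. i < s \<Longrightarrow> 0 \<le> \<rho> i \<and> \<rho> i \<le> b i"
    and j: "j < s" "b j \<ge> \<delta>" "\<delta> > 0"
  shows "cmod (edge_kernel M c s S b) \<le> (2 / \<delta>) * (4 * pi * c) ^ s * edge_error (1 / real M) s \<rho>"
proof -
  define B where "B l = (if l = j then 2 / \<delta> else 4 * pi * c * pole_weight (1 / real M) (\<rho> l))" for l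
  have pc: "4 * pi * c \<ge> 1"
  proof -
    have "1 * 1 \<le> pi * c" using c pi_ge_two by (intro mult_mono) auto
    then show ?thesis by simp
  qed
  have g0: "(\<Prod>i\<in>{..<s}-{j}. pole_weight (1 / real M) (\<rho> i)) \<ge> 0"
    using M \<rho> by (intro prod_nonneg pole_weight_nonneg) auto
  have "cmod (edge_kernel M c s S b) \<le> (\<Prod>l<s. B l)"
  proof (rule edge_kernel_bound)
    fix l y assume l: "l < s" and y: "\<bar>y\<bar> \<le> 2 * pi * c * real M"
    show "cmod (edge_factor y (b l)) \<le> B l"
    proof (cases "l = j")
      case True
      have "\<delta> * cmod (edge_factor y (b j)) \<le> b j * cmod (edge_factor y (b j))"
        using j by (intro mult_right_mono) auto
      also have "\<dots> \<le> 2" using edge_factor_mult_le[of "b j" y] j by simp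
      finally show ?thesis using j True by (simp add: B_def field_simps)
    next
      case False
      then show ?thesis using edge_factor_le_pole[OF M c _ _ y, of "\<rho> l" "b l"] \<rho>[OF l] by (simp add: B_def)
    qed
  qed (use c M in auto)
  also have "\<dots> = B j * (\<Prod>l\<in>{..<s}-{j}. B l)" by (rule prod_remove[OF j(1)])
  also have "(\<Prod>l\<in>{..<s}-{j}. B l) = (\<Prod>l\<in>{..<s}-{j}. 4 * pi * c * pole_weight (1 / real M) (\<rho> l))"
    by (intro prod.cong) (auto simp: B_def)
  also have "\<dots> = (4 * pi * c) ^ card ({..<s}-{j}) * (\<Prod>l\<in>{..<s}-{j}. pole_weight (1 / real M) (\<rho> l))"
    by (simp add: prod.distrib power_mult_distrib)
  also have "\<dots> \<le> (4 * pi * c) ^ s * (\<Prod>l\<in>{..<s}-{j}. pole_weight (1 / real M) (\<rho> l))"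
    using pc g0 card_Diff1_le[of "{..<s}" j] by (intro mult_right_mono power_increasing) auto
  also have "\<dots> \<le> (4 * pi * c) ^ s * (spread_weight (1 / real M) (\<rho> j) * (\<Prod>l\<in>{..<s}-{j}. pole_weight (1 / real M) (\<rho> l)))"
    using pc g0 mult_right_mono[OF spread_weight_ge_1 g0, of "1 / real M" "\<rho> j"] M \<rho> j(1)
    by (intro mult_left_mono) auto
  also have "\<dots> \<le> (4 * pi * c) ^ s * edge_error (1 / real M) s \<rho>"
    using pc M \<rho> j(1) by (intro mult_left_mono edge_error_ge) auto
  finally show ?thesis using j(3) by (simp add: B_def mult.assoc mult_left_mono divide_right_mono)
qed

text \<open>
  In the finite difference expansion the Fejer kernel at \<open>S\<close> itself has the sign \<open>(-1)^s\<close>. At every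
  other vertex the argument is at least some \<open>b_j\<close> and at most \<open>1/2\<close>, and the quadratic decay of the
  Fejer kernel makes the contribution integrable in that variable.
\<close>

lemma edge_kernel_middle:
  assumes M: "M > 0" and c: "c \<ge> 1" and \<rho>: "\<And>i. i < s \<Longrightarrow> 0 \<le> \<rho> i \<and> \<rho> i \<le> b i"
    and lo: "\<And>i. i < s \<Longrightarrow> 1 / real M \<le> b i" and S: "S \<ge> 0"
    and half: "S + c * (\<Sum>i<s. b i) \<le> 1 / 2"
  shows "fejer M S / (\<Prod>l<s. b l) - 32 * 4 ^ s * edge_error (1 / real M) s \<rho>
     \<le> Re ((-1) ^ s * edge_kernel M c s S b)"
proof -
  let ?\<epsilon> = "1 / real M" and ?P = "\<Prod>l<s. b l"
  have e: "?\<epsilon> > 0" using M by simp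
  have b0: "b i > 0" if "i < s" for i using lo[OF that] e by linarith
  have P: "?P > 0" using b0 by (intro prod_pos) auto
  define Q where "Q = (\<Sum>j<s. 4 / (real M * b j)\<^sup>2)"
  have far: "fejer M (S + c * (\<Sum>l\<in>A. b l)) \<le> Q" if A: "A \<in> Pow {..<s} - {{}}" for A
  proof -
    from A obtain j where j: "j \<in> A" "j < s" by auto
    have fA: "finite A" using A by (auto intro: finite_subset)
    have bA: "0 \<le> b l" if "l \<in> A" for l using A that b0[of l] by auto
    let ?t = "S + c * (\<Sum>l\<in>A. b l)"
    have "1 * b j \<le> c * (\<Sum>l\<in>A. b l)"
      using c b0[OF j(2)] member_le_sum[OF j(1), of b] fA bA by (intro mult_mono) auto
    then have t1: "b j \<le> ?t" using S by simp
    have "(\<Sum>l\<in>A. b l) \<le> (\<Sum>i<s. b i)"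
      using A b0 by (intro sum_mono2) (auto intro: less_imp_le)
    then have "c * (\<Sum>l\<in>A. b l) \<le> c * (\<Sum>i<s. b i)" using c by (intro mult_left_mono) auto
    then have t2: "?t \<le> 1 / 2" using half by linarith
    have "fejer M ?t \<le> 4 / (real M * ?t)\<^sup>2"
      using t1 t2 b0[OF j(2)] M by (intro fejer_decay) auto
    also have "\<dots> \<le> 4 / (real M * b j)\<^sup>2"
      using t1 b0[OF j(2)] M by (intro divide_left_mono power_mono mult_left_mono mult_pos_pos zero_less_power) auto
    also have "\<dots> \<le> Q"
      unfolding Q_def using j by (intro member_le_sum[of j "{..<s}" "\<lambda>j. 4 / (real M * b j)\<^sup>2"]) auto
    finally show ?thesis .
  qed
  have "Re ((-1) ^ s * edge_kernel M c s S b) * ?P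
      = (\<Sum>A\<in>Pow {..<s}. (-1) ^ card A * fejer M (S + c * (\<Sum>l\<in>A. b l)))"
    by (rule edge_kernel_Re)
  also have "\<dots> = fejer M S + (\<Sum>A\<in>Pow {..<s} - {{}}. (-1) ^ card A * fejer M (S + c * (\<Sum>l\<in>A. b l)))"
    by (subst sum.remove[of _ "{}"]) auto
  finally have split: "Re ((-1) ^ s * edge_kernel M c s S b) * ?P
      = fejer M S + (\<Sum>A\<in>Pow {..<s} - {{}}. (-1) ^ card A * fejer M (S + c * (\<Sum>l\<in>A. b l)))" .
  have rest: "(\<Sum>A\<in>Pow {..<s} - {{}}. (-1) ^ card A * fejer M (S + c * (\<Sum>l\<in>A. b l))) \<ge> (\<Sum>A\<in>Pow {..<s} - {{}}. - Q)"
  proof (rule sum_mono)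
    fix A assume A: "A \<in> Pow {..<s} - {{}}"
    have "\<bar>(-1) ^ card A * fejer M (S + c * (\<Sum>l\<in>A. b l))\<bar> \<le> Q"
      using far[OF A] fejer_nonneg[of M] by (simp add: abs_mult power_abs)
    then show "- Q \<le> (-1) ^ card A * fejer M (S + c * (\<Sum>l\<in>A. b l))" by linarith
  qed
  have "(\<Sum>A\<in>Pow {..<s} - {{}}. - Q) \<ge> - (2 ^ s * Q)"
  proof -
    have "card (Pow {..<s} - {{}}) \<le> 2 ^ s" by (simp add: card_Diff_subset card_Pow)
    then have "real (card (Pow {..<s} - {{}})) \<le> 2 ^ s"
      by (metis of_nat_le_iff of_nat_numeral of_nat_power)
    moreover have "Q \<ge> 0" unfolding Q_def by (intro sum_nonneg) auto
    ultimately have "real (card (Pow {..<s} - {{}})) * Q \<le> 2 ^ s * Q" by (rule mult_right_mono)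
    then show ?thesis by simp
  qed
  with split rest have "fejer M S - 2 ^ s * Q \<le> Re ((-1) ^ s * edge_kernel M c s S b) * ?P" by linarith
  then have "(fejer M S - 2 ^ s * Q) / ?P \<le> Re ((-1) ^ s * edge_kernel M c s S b)"
    using P by (simp add: divide_le_eq)
  moreover have "Q / ?P \<le> 32 * 2 ^ s * edge_error ?\<epsilon> s \<rho>"
  proof -
    have inv: "1 / b i \<le> 2 * pole_weight ?\<epsilon> (\<rho> i)" if "i < s" for i
    proof -
      have "\<rho> i + ?\<epsilon> \<le> 2 * b i" using lo[OF that] \<rho>[OF that] by linarith
      then have "1 / (2 * b i) \<le> 1 / (\<rho> i + ?\<epsilon>)"
        using \<rho>[OF that] e b0[OF that] by (intro divide_left_mono mult_pos_pos add_nonneg_pos) auto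
      then show ?thesis by (simp add: pole_weight_def)
    qed
    have summand: "4 / (real M * b j)\<^sup>2 / ?P \<le> 32 * 2 ^ s * (spread_weight ?\<epsilon> (\<rho> j) * (\<Prod>i\<in>{..<s}-{j}. pole_weight ?\<epsilon> (\<rho> i)))" if j: "j < s" for j
    proof -
      have "\<rho> j + ?\<epsilon> \<le> 2 * b j" using lo[OF j] \<rho>[OF j] by linarith
      then have "?\<epsilon>\<^sup>2 / (2 * b j) ^ 3 \<le> ?\<epsilon>\<^sup>2 / (\<rho> j + ?\<epsilon>) ^ 3"
        using \<rho>[OF j] e b0[OF j] by (intro divide_left_mono power_mono mult_pos_pos zero_less_power add_nonneg_pos) auto
      also have "\<dots> \<le> spread_weight ?\<epsilon> (\<rho> j)" by (simp add: spread_weight_def)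
      finally have 1: "4 / (real M * b j)\<^sup>2 * (1 / b j) \<le> 32 * spread_weight ?\<epsilon> (\<rho> j)"
        using M b0[OF j] by (simp add: power2_eq_square power3_eq_cube field_simps)
      have "(\<Prod>i\<in>{..<s}-{j}. 1 / b i) \<le> (\<Prod>i\<in>{..<s}-{j}. 2 * pole_weight ?\<epsilon> (\<rho> i))"
        using inv b0 by (intro prod_mono) (auto intro: less_imp_le)
      also have "\<dots> = 2 ^ card ({..<s}-{j}) * (\<Prod>i\<in>{..<s}-{j}. pole_weight ?\<epsilon> (\<rho> i))"
        by (simp add: prod.distrib)
      also have "\<dots> \<le> 2 ^ s * (\<Prod>i\<in>{..<s}-{j}. pole_weight ?\<epsilon> (\<rho> i))"
        using \<rho> e card_Diff1_le[of "{..<s}" j] by (intro mult_right_mono power_increasing prod_nonneg pole_weight_nonneg) auto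
      finally have 2: "(\<Prod>i\<in>{..<s}-{j}. 1 / b i) \<le> 2 ^ s * (\<Prod>i\<in>{..<s}-{j}. pole_weight ?\<epsilon> (\<rho> i))" .
      have "4 / (real M * b j)\<^sup>2 / ?P = (4 / (real M * b j)\<^sup>2 * (1 / b j)) * (\<Prod>i\<in>{..<s}-{j}. 1 / b i)"
        unfolding prod_remove[OF j] by (simp add: prod_dividef)
      also have "\<dots> \<le> (32 * spread_weight ?\<epsilon> (\<rho> j)) * (2 ^ s * (\<Prod>i\<in>{..<s}-{j}. pole_weight ?\<epsilon> (\<rho> i)))"
      proof (rule mult_mono[OF 1 2])
        show "0 \<le> 32 * spread_weight ?\<epsilon> (\<rho> j)" using spread_weight_ge_1[OF e, of "\<rho> j"] \<rho>[OF j] by simp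
        show "0 \<le> (\<Prod>i\<in>{..<s}-{j}. 1 / b i)" using b0 by (intro prod_nonneg) (auto intro: less_imp_le)
      qed
      finally show ?thesis by (simp add: mult_ac)
    qed
    have "Q / ?P = (\<Sum>j<s. 4 / (real M * b j)\<^sup>2 / ?P)" by (simp add: Q_def sum_divide_distrib)
    also have "\<dots> \<le> (\<Sum>j<s. 32 * 2 ^ s * (spread_weight ?\<epsilon> (\<rho> j) * (\<Prod>i\<in>{..<s}-{j}. pole_weight ?\<epsilon> (\<rho> i))))"
      by (intro sum_mono summand) auto
    also have "\<dots> = 32 * 2 ^ s * edge_error ?\<epsilon> s \<rho>" by (simp add: edge_error_def sum_distrib_left)
    finally show ?thesis .
  qed
  then have "2 ^ s * (Q / ?P) \<le> 2 ^ s * (32 * 2 ^ s * edge_error ?\<epsilon> s \<rho>)" by (intro mult_left_mono) auto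
  moreover have "(2::real) ^ s * (32 * 2 ^ s * x) = 32 * 4 ^ s * x" for x
    by (simp add: power_mult_distrib[symmetric])
  ultimately show ?thesis by (simp add: diff_divide_distrib)
qed

text \<open>
  What is needed of \<open>b_i = \<rho>_i + \<dots>\<close> and \<open>S\<close>: the omitted monomials of \<open>b_i\<close> are at least
  quadratic, and those of \<open>S\<close> at least cubic. With \<open>\<tau> = 1 / sqrt M\<close> the former are of order \<open>1/M\<close>
  and the latter of smaller order.
\<close>

definition edge_admissible :: "real \<Rightarrow> nat \<Rightarrow> (nat \<Rightarrow> real) \<Rightarrow> (nat \<Rightarrow> real) \<Rightarrow> real \<Rightarrow> bool" where
  "edge_admissible K s \<rho> b S \<longleftrightarrow> (\<forall>i<s. 0 \<le> \<rho> i \<and> \<rho> i \<le> b i) \<and> 0 \<le> S \<and>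
     (\<forall>\<tau>. 0 \<le> \<tau> \<and> \<tau> \<le> 1 \<and> (\<forall>i<s. \<rho> i \<le> \<tau>) \<longrightarrow> S \<le> K * \<tau> ^ 3 \<and> (\<forall>i<s. b i \<le> \<rho> i + K * \<tau>\<^sup>2))"

text \<open>
  On the support of \<open>cut_pole_weight\<close> one has \<open>S = O(M powr (- 3 / 2))\<close>, so the Fejer kernel at
  \<open>S\<close> is at least \<open>1/4\<close>, and \<open>1 / b_i\<close> is comparable with \<open>1 / (\<rho>_i + 1/M)\<close>.
\<close>

lemma edge_kernel_lower:
  assumes c: "c \<ge> 1" and K: "K \<ge> 1"
  obtains c1 C2 :: real and M0 :: nat where "c1 > 0" "C2 \<ge> 0"
    "\<And>M \<rho> b S. M \<ge> M0 \<Longrightarrow> M > 0 \<Longrightarrow> edge_admissible K s \<rho> b S \<Longrightarrow>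
       c1 * (\<Prod>i<s. cut_pole_weight (1 / real M) (\<rho> i)) - C2 * edge_error (1 / real M) s \<rho>
         \<le> Re ((-1) ^ s * edge_kernel M c s S b)"
proof -
  \<comment> \<open>If all \<open>b i\<close> are below \<open>\<delta>\<close>, then \<open>S + c \<Sum> b i \<le> 1/2\<close>, as \<open>edge_kernel_middle\<close> requires.\<close>
  define \<delta> where "\<delta> = 1 / (2 * (K + c * real s))"
  have Kcs: "K + c * real s \<ge> 1" using K c by (simp add: add_increasing2)
  have \<delta>: "0 < \<delta>" "\<delta> \<le> 1" "(K + c * real s) * \<delta> = 1 / 2"
    using Kcs by (auto simp: \<delta>_def field_simps)
  \<comment> \<open>The bound for \<open>\<tau> = 1 / sqrt M\<close>: small enough for \<open>(1 + K) \<tau> < \<delta>\<close> and \<open>2 \<pi> K \<tau> \<le> 1/2\<close>.\<close>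
  define x where "x = min (\<delta> / (2 * (1 + K))) (1 / (4 * pi * K))"
  have piK: "4 * pi * K \<ge> 1"
  proof -
    have "1 * 1 \<le> pi * K" using K pi_ge_two by (intro mult_mono) auto
    then show ?thesis by simp
  qed
  have x: "x > 0" using \<delta> K piK by (simp add: x_def)
  have x1: "x \<le> 1"
  proof -
    have "\<delta> / (2 * (1 + K)) \<le> 1" using \<delta> K by (simp add: field_simps)
    then show ?thesis by (simp add: x_def)
  qed
  define M0 where "M0 = nat \<lceil>1 / x\<^sup>2\<rceil>"
  define c1 where "c1 = 1 / (4 * (1 + K) ^ s)"
  have c1: "c1 > 0" "c1 \<le> 1"
  proof -
    have "(1 + K) ^ s \<ge> 1" using K by (intro one_le_power) auto
    then show "c1 > 0" "c1 \<le> 1" by (auto simp: c1_def field_simps)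
  qed
  define A where "A = (4 * pi * c) ^ s"
  have A: "A \<ge> 0" using c by (simp add: A_def)
  \<comment> \<open>The first two summands serve the case \<open>A\<close> below, the others the cases \<open>B\<close> and \<open>C\<close>.\<close>
  define C2 where "C2 = 8 * A + 8 + (2 / \<delta>) * A + 32 * 4 ^ s"
  have C2: "C2 \<ge> 0" "8 * A + 8 \<le> C2" "(2 / \<delta>) * A \<le> C2" "32 * 4 ^ s \<le> C2"
    using A \<delta> by (auto simp: C2_def add_nonneg_nonneg)
  show thesis
  proof (rule that[OF c1(1) C2(1)])
    fix M :: nat and \<rho> b :: "nat \<Rightarrow> real" and S
    assume M0: "M \<ge> M0" and M: "M > 0" and adm: "edge_admissible K s \<rho> b S"
    let ?\<epsilon> = "1 / real M"
    define \<tau> where "\<tau> = sqrt ?\<epsilon>"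
    have e: "?\<epsilon> > 0" using M by simp
    have \<tau>: "\<tau> > 0" "\<tau>\<^sup>2 = ?\<epsilon>" using e by (auto simp: \<tau>_def)
    have "1 / x\<^sup>2 \<le> real M" using M0 unfolding M0_def by linarith
    then have "?\<epsilon> \<le> x\<^sup>2" using x M by (simp add: field_simps)
    then have \<tau>x: "\<tau> \<le> x" unfolding \<tau>_def using x by (intro real_le_lsqrt) auto
    have \<tau>1: "\<tau> \<le> 1" using \<tau>x x1 by simp
    have \<tau>\<delta>: "(1 + K) * \<tau> < \<delta>"
    proof -
      have "(1 + K) * \<tau> \<le> (1 + K) * (\<delta> / (2 * (1 + K)))"
        using \<tau>x K by (intro mult_left_mono) (auto simp: x_def)
      also have "\<dots> = \<delta> / 2" using K by (simp add: field_simps)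
      also have "\<dots> < \<delta>" using \<delta> by simp
      finally show ?thesis .
    qed
    have \<tau>\<pi>: "2 * pi * K * \<tau> \<le> 1 / 2"
    proof -
      have "2 * pi * K * \<tau> \<le> 2 * pi * K * (1 / (4 * pi * K))"
        using \<tau>x K by (intro mult_left_mono) (auto simp: x_def)
      also have "\<dots> = 1 / 2" using K by simp
      finally show ?thesis .
    qed
    have \<rho>: "0 \<le> \<rho> i \<and> \<rho> i \<le> b i" if "i < s" for i using adm that by (simp add: edge_admissible_def)
    have S: "S \<ge> 0" using adm by (simp add: edge_admissible_def)
    have bound: "S \<le> K * u ^ 3 \<and> (\<forall>i<s. b i \<le> \<rho> i + K * u\<^sup>2)" if "0 \<le> u" "u \<le> 1" "\<And>i. i < s \<Longrightarrow> \<rho> i \<le> u" for u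
      using adm that unfolding edge_admissible_def by blast
    have err: "edge_error ?\<epsilon> s \<rho> \<ge> 0" using e \<rho> by (intro edge_error_nonneg) auto
    have h0: "(\<Prod>i<s. cut_pole_weight ?\<epsilon> (\<rho> i)) \<ge> 0" using cut_pole_weight_le[OF e] \<rho> by (intro prod_nonneg) auto
    have hbig: "(\<Prod>i<s. cut_pole_weight ?\<epsilon> (\<rho> i)) = 0" if "i < s" "\<rho> i > \<tau>" for i
      using cut_pole_weight_eq_0[OF e, of "\<rho> i"] that by (intro prod_zero) (auto simp: \<tau>_def)
    have Re_ge: "Re ((-1) ^ s * edge_kernel M c s S b) \<ge> - cmod (edge_kernel M c s S b)"
      using abs_Re_le_cmod[of "(-1) ^ s * edge_kernel M c s S b"] by (simp add: norm_mult norm_power)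
    consider (A) j where "j < s" "b j < ?\<epsilon>" | (B) j where "j < s" "b j \<ge> \<delta>"
      | (C) "\<And>i. i < s \<Longrightarrow> ?\<epsilon> \<le> b i \<and> b i < \<delta>" by force
    then show "c1 * (\<Prod>i<s. cut_pole_weight ?\<epsilon> (\<rho> i)) - C2 * edge_error ?\<epsilon> s \<rho> \<le> Re ((-1) ^ s * edge_kernel M c s S b)"
    proof cases
      case A
      then have rj: "\<rho> j \<le> ?\<epsilon>" using \<rho>[of j] by linarith
      have "cmod (edge_kernel M c s S b) \<le> A * (8 * edge_error ?\<epsilon> s \<rho>)"
        unfolding A_def using M c A(1) rj \<rho> by (intro edge_kernel_small) auto
      moreover have "(\<Prod>i<s. cut_pole_weight ?\<epsilon> (\<rho> i)) \<le> (\<Prod>i<s. pole_weight ?\<epsilon> (\<rho> i))"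
        using cut_pole_weight_le[OF e] \<rho> by (intro prod_mono) auto
      moreover have "(\<Prod>i<s. pole_weight ?\<epsilon> (\<rho> i)) \<le> 8 * edge_error ?\<epsilon> s \<rho>"
        using e \<rho> A(1) rj by (intro prod_pole_le_error) auto
      moreover have "c1 * (\<Prod>i<s. cut_pole_weight ?\<epsilon> (\<rho> i)) \<le> 1 * (\<Prod>i<s. cut_pole_weight ?\<epsilon> (\<rho> i))"
        using c1 h0 by (intro mult_right_mono) auto
      moreover have "(8 * A + 8) * edge_error ?\<epsilon> s \<rho> \<le> C2 * edge_error ?\<epsilon> s \<rho>"
        using C2 err by (intro mult_right_mono) auto
      ultimately show ?thesis using Re_ge by (simp add: algebra_simps)
    next
      case B
      have z: "(\<Prod>i<s. cut_pole_weight ?\<epsilon> (\<rho> i)) = 0"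
      proof (rule ccontr)
        assume "(\<Prod>i<s. cut_pole_weight ?\<epsilon> (\<rho> i)) \<noteq> 0"
        then have "\<rho> i \<le> \<tau>" if "i < s" for i using hbig[OF that] by force
        with bound[of \<tau>] \<tau> \<tau>1 B(1) have "b j \<le> \<tau> + K * \<tau>\<^sup>2" by force
        also have "\<dots> \<le> \<tau> + K * (\<tau> * 1)"
          using \<tau> \<tau>1 K unfolding power2_eq_square by (intro add_left_mono mult_left_mono) auto
        also have "\<dots> < \<delta>" using \<tau>\<delta> by (simp add: algebra_simps)
        finally show False using B by simp
      qed
      have "cmod (edge_kernel M c s S b) \<le> (2 / \<delta>) * A * edge_error ?\<epsilon> s \<rho>"
        unfolding A_def using M c B \<delta>(1) \<rho> by (intro edge_kernel_large) auto
      moreover have "(2 / \<delta>) * A * edge_error ?\<epsilon> s \<rho> \<le> C2 * edge_error ?\<epsilon> s \<rho>"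
        using C2 err by (intro mult_right_mono) auto
      ultimately show ?thesis unfolding z using Re_ge by linarith
    next
      case C
      have b0: "b i > 0" if "i < s" for i using C[OF that] e by linarith
      then have Pb: "(\<Prod>l<s. b l) > 0" by (intro prod_pos) auto
      have "\<rho> i \<le> \<delta>" if "i < s" for i using C[OF that] \<rho>[OF that] by linarith
      with bound[of \<delta>] \<delta> have "S \<le> K * \<delta> ^ 3" by auto
      also have "\<dots> \<le> K * (\<delta> * 1)"
        using \<delta> K mult_le_one[of "\<delta>" "\<delta>"] unfolding power3_eq_cube mult.assoc by (intro mult_left_mono) auto
      finally have "S \<le> K * \<delta>" by simp
      moreover have "(\<Sum>i<s. b i) \<le> (\<Sum>i<s. \<delta>)" using C by (intro sum_mono) (auto intro: less_imp_le)
      then have "c * (\<Sum>i<s. b i) \<le> c * (real s * \<delta>)" using c by simp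
      ultimately have half: "S + c * (\<Sum>i<s. b i) \<le> 1 / 2" using \<delta>(3) by (simp add: algebra_simps)
      have mid: "fejer M S / (\<Prod>l<s. b l) - 32 * 4 ^ s * edge_error ?\<epsilon> s \<rho> \<le> Re ((-1) ^ s * edge_kernel M c s S b)"
        using M c \<rho> S half C by (intro edge_kernel_middle) auto
      have "32 * 4 ^ s * edge_error ?\<epsilon> s \<rho> \<le> C2 * edge_error ?\<epsilon> s \<rho>"
        using C2 err by (intro mult_right_mono) auto
      moreover have "c1 * (\<Prod>i<s. cut_pole_weight ?\<epsilon> (\<rho> i)) \<le> fejer M S / (\<Prod>l<s. b l)"
      proof (cases "\<exists>i<s. \<rho> i > \<tau>")
        case True
        then have z: "(\<Prod>i<s. cut_pole_weight ?\<epsilon> (\<rho> i)) = 0" using hbig by blast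
        show ?thesis unfolding z using Pb fejer_nonneg[of M S] by simp
      next
        case False
        then have small: "\<rho> i \<le> \<tau>" if "i < s" for i using that by (meson not_le)
        from bound[of \<tau>] \<tau> \<tau>1 small have S3: "S \<le> K * \<tau> ^ 3" and b2: "\<And>i. i < s \<Longrightarrow> b i \<le> \<rho> i + K * \<tau>\<^sup>2" by auto
        have "cmod (ee S - ee 0) \<le> 2 * pi * \<bar>S - 0\<bar>" by (rule dist_ee_le)
        also have "\<dots> \<le> 2 * pi * (K * \<tau> ^ 3)" using S3 S by (intro mult_left_mono) auto
        finally have "real M * cmod (ee S - 1) \<le> real M * (2 * pi * (K * \<tau> ^ 3))"
          by (intro mult_left_mono) auto
        also have "\<dots> = (real M * \<tau>\<^sup>2) * (2 * pi * K * \<tau>)" by (simp add: power2_eq_square power3_eq_cube)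
        also have "\<dots> \<le> 1 / 2" using \<tau>\<pi> M \<tau>(2) by simp
        finally have f: "fejer M S \<ge> 1 / 4" using M by (rule fejer_ge)
        have "(\<Prod>i<s. cut_pole_weight ?\<epsilon> (\<rho> i)) \<le> (\<Prod>i<s. (1 + K) * (1 / b i))"
        proof (intro prod_mono conjI)
          fix i assume "i \<in> {..<s}"
          then have i: "i < s" by simp
          show "0 \<le> cut_pole_weight ?\<epsilon> (\<rho> i)" using cut_pole_weight_le[OF e] \<rho>[OF i] by simp
          have "b i \<le> \<rho> i + K * ?\<epsilon>" using b2[OF i] \<tau>(2) by simp
          also have "\<dots> \<le> (\<rho> i + K * ?\<epsilon>) + (K * \<rho> i + ?\<epsilon>)"
            using K \<rho>[OF i] e by simp
          also have "\<dots> = (1 + K) * (\<rho> i + ?\<epsilon>)"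
            by (simp add: algebra_simps add_divide_distrib)
          finally have bi: "b i \<le> (1 + K) * (\<rho> i + ?\<epsilon>)" .
          have "cut_pole_weight ?\<epsilon> (\<rho> i) \<le> 1 / (\<rho> i + ?\<epsilon>)" using cut_pole_weight_le[OF e, of "\<rho> i"] \<rho>[OF i] by (simp add: pole_weight_def)
          also have "\<dots> = (1 + K) * (1 / ((1 + K) * (\<rho> i + ?\<epsilon>)))" using K by simp
          also have "\<dots> \<le> (1 + K) * (1 / b i)"
            using bi K b0[OF i] e \<rho>[OF i]
            by (intro mult_left_mono divide_left_mono mult_pos_pos add_nonneg_pos) auto
          finally show "cut_pole_weight ?\<epsilon> (\<rho> i) \<le> (1 + K) * (1 / b i)" .
        qed
        also have "\<dots> = (1 + K) ^ s / (\<Prod>i<s. b i)"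
          unfolding prod.distrib by (simp add: prod_dividef)
        finally have "c1 * (\<Prod>i<s. cut_pole_weight ?\<epsilon> (\<rho> i)) \<le> c1 * ((1 + K) ^ s / (\<Prod>i<s. b i))"
          using c1 by (intro mult_left_mono) auto
        also have "\<dots> = (1 / 4) / (\<Prod>i<s. b i)" using K by (simp add: c1_def)
        also have "\<dots> \<le> fejer M S / (\<Prod>i<s. b i)" using f Pb by (intro divide_right_mono) auto
        finally show ?thesis .
      qed
      ultimately show ?thesis using mid by linarith
    qed
  qed
qed

lemma continuous_pole_weight: "\<epsilon> > 0 \<Longrightarrow> continuous_on {0..1} (pole_weight \<epsilon>)"
  unfolding pole_weight_def by (intro continuous_intros) force

lemma continuous_spread_weight: "\<epsilon> > 0 \<Longrightarrow> continuous_on {0..1} (spread_weight \<epsilon>)"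
  unfolding spread_weight_def by (intro continuous_intros) force

lemma continuous_cut_pole_weight: "\<epsilon> > 0 \<Longrightarrow> continuous_on {0..1} (cut_pole_weight \<epsilon>)"
  unfolding cut_pole_weight_def by (intro continuous_intros) force

lemma integral_pole_weight:
  assumes "M > 0"
  shows "integral {0..1} (pole_weight (1 / real M)) = ln (1 + real M)"
proof -
  have e: "1 / real M > 0" using assms by simp
  have "(pole_weight (1 / real M) has_integral (ln (1 + 1 / real M) - ln (0 + 1 / real M))) {0..1}"
  proof (rule fundamental_theorem_of_calculus[of 0 1 "\<lambda>t. ln (t + 1 / real M)"])
    fix t :: real assume "t \<in> {0..1}"
    then have "t + 1 / real M > 0" using e by (auto intro: add_nonneg_pos)
    then show "((\<lambda>t. ln (t + 1 / real M)) has_vector_derivative pole_weight (1 / real M) t) (at t within {0..1})"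
      unfolding has_real_derivative_iff_has_vector_derivative[symmetric] pole_weight_def
      by (auto intro!: derivative_eq_intros)
  qed simp
  moreover have "ln (1 + 1 / real M) - ln (0 + 1 / real M) = ln ((1 + 1 / real M) / (0 + 1 / real M))"
    by (rule ln_divide_pos[symmetric]) (use e in linarith)+
  moreover have "(1 + 1 / real M) / (0 + 1 / real M) = 1 + real M" using assms by (simp add: field_simps)
  ultimately show ?thesis by (simp add: integral_unique)
qed

lemma integral_spread_weight_le:
  assumes e: "\<epsilon> > 0"
  shows "integral {0..1} (spread_weight \<epsilon>) \<le> 3 / 2"
proof -
  define F where "F t = t - \<epsilon>\<^sup>2 / 2 * (1 / (t + \<epsilon>)\<^sup>2)" for t
  have "(spread_weight \<epsilon> has_integral (F 1 - F 0)) {0..1}"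
  proof (rule fundamental_theorem_of_calculus)
    fix t :: real assume "t \<in> {0..1}"
    then have p: "t + \<epsilon> > 0" using e by (auto intro: add_nonneg_pos)
    have "(F has_real_derivative 1 - \<epsilon>\<^sup>2 / 2 * (- (2 * (t + \<epsilon>)) / ((t + \<epsilon>)\<^sup>2 * (t + \<epsilon>)\<^sup>2))) (at t within {0..1})"
    proof -
      have ne: "t + \<epsilon> \<noteq> 0" using p by simp
      have "((\<lambda>t. 1 / (t + \<epsilon>)\<^sup>2) has_real_derivative - (2 * (t + \<epsilon>)) / ((t + \<epsilon>)\<^sup>2 * (t + \<epsilon>)\<^sup>2)) (at t within {0..1})"
        by (rule derivative_eq_intros refl | use ne in simp)+
      from DERIV_diff[OF DERIV_ident DERIV_cmult[OF this, of "\<epsilon>\<^sup>2 / 2"]]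
      show ?thesis by (simp only: F_def[abs_def])
    qed
    also have "1 - \<epsilon>\<^sup>2 / 2 * (- (2 * (t + \<epsilon>)) / ((t + \<epsilon>)\<^sup>2 * (t + \<epsilon>)\<^sup>2)) = spread_weight \<epsilon> t"
    proof -
      have "1 - x / 2 * (- (2 * u) / (u\<^sup>2 * u\<^sup>2)) = 1 + x / u ^ 3" if "u \<noteq> 0" for x u :: real
        using that by (simp add: power2_eq_square power3_eq_cube field_simps)
      moreover have "t + \<epsilon> \<noteq> 0" using p by simp
      ultimately show ?thesis unfolding spread_weight_def by blast
    qed
    finally show "(F has_vector_derivative spread_weight \<epsilon> t) (at t within {0..1})"
      by (simp add: has_real_derivative_iff_has_vector_derivative)
  qed simp
  then have "integral {0..1} (spread_weight \<epsilon>) = F 1 - F 0" by (rule integral_unique)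
  also have "\<dots> = 3 / 2 - \<epsilon>\<^sup>2 / 2 * (1 / (1 + \<epsilon>)\<^sup>2)" using e by (simp add: F_def)
  also have "\<dots> \<le> 3 / 2" by simp
  finally show ?thesis .
qed

text \<open>
  It suffices to integrate up to \<open>1 / sqrt M\<close>, where the logarithm reaches half of \<open>log M\<close>.
\<close>

lemma integral_cut_pole_weight_ge:
  assumes M: "M > 0"
  shows "integral {0..1} (cut_pole_weight (1 / real M)) \<ge> ln (1 + real M) / 2 - 1"
proof -
  define \<epsilon> where "\<epsilon> = 1 / real M"
  define \<tau> where "\<tau> = sqrt \<epsilon>"
  have e: "\<epsilon> > 0" "\<epsilon> \<le> 1" using M by (auto simp: \<epsilon>_def)
  have \<tau>: "\<tau> > 0" "\<tau> \<le> 1" "\<tau> * \<tau> = \<epsilon>" using e by (auto simp: \<tau>_def)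
  define F where "F t = ln (t + \<epsilon>) - t * (1 / (\<tau> + \<epsilon>))" for t
  have I: "((\<lambda>t. 1 / (t + \<epsilon>) - 1 / (\<tau> + \<epsilon>)) has_integral (F \<tau> - F 0)) {0..\<tau>}"
  proof (rule fundamental_theorem_of_calculus)
    fix t :: real assume "t \<in> {0..\<tau>}"
    then have p: "t + \<epsilon> > 0" using e by (auto intro: add_nonneg_pos)
    have "\<tau> + \<epsilon> \<noteq> 0" using \<tau> e by linarith
    with p show "(F has_vector_derivative 1 / (t + \<epsilon>) - 1 / (\<tau> + \<epsilon>)) (at t within {0..\<tau>})"
      unfolding has_real_derivative_iff_has_vector_derivative[symmetric] F_def
      by (auto intro!: derivative_eq_intros)
  qed (use \<tau> in simp)
  have "1 + real M \<le> (1 + 1 / \<tau>)\<^sup>2"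
  proof -
    have "(1 / \<tau>)\<^sup>2 = real M" using \<tau>(3) M by (simp add: power_divide power2_eq_square \<epsilon>_def)
    then show ?thesis using \<tau>(1) by (simp add: power2_sum)
  qed
  then have "ln (1 + real M) \<le> ln ((1 + 1 / \<tau>)\<^sup>2)" by (intro ln_mono) auto
  also have "\<dots> = 2 * ln (1 + 1 / \<tau>)" using \<tau> by (simp add: ln_realpow)
  finally have "ln (1 + real M) / 2 \<le> ln (1 + 1 / \<tau>)" by simp
  also have "1 + 1 / \<tau> = (\<tau> + \<epsilon>) / \<epsilon>" using \<tau> by (simp add: field_simps \<tau>(3)[symmetric])
  also have "ln ((\<tau> + \<epsilon>) / \<epsilon>) = ln (\<tau> + \<epsilon>) - ln \<epsilon>" using \<tau> e by (intro ln_divide_pos) auto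
  finally have "ln (1 + real M) / 2 - 1 \<le> ln (\<tau> + \<epsilon>) - ln \<epsilon> - 1" by simp
  also have "\<dots> \<le> F \<tau> - F 0"
  proof -
    have "\<tau> * (1 / (\<tau> + \<epsilon>)) \<le> 1" using \<tau> e by (simp add: field_simps)
    then show ?thesis by (simp add: F_def)
  qed
  also have "\<dots> = integral {0..\<tau>} (\<lambda>t. 1 / (t + \<epsilon>) - 1 / (\<tau> + \<epsilon>))" using I by (simp add: integral_unique)
  also have "\<dots> \<le> integral {0..\<tau>} (cut_pole_weight \<epsilon>)"
  proof (rule integral_le)
    show "(\<lambda>t. 1 / (t + \<epsilon>) - 1 / (\<tau> + \<epsilon>)) integrable_on {0..\<tau>}" using I by blast
    show "cut_pole_weight \<epsilon> integrable_on {0..\<tau>}"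
      using \<tau> by (intro integrable_continuous_interval continuous_on_subset[OF continuous_cut_pole_weight[OF e(1)]]) auto
  qed (simp add: cut_pole_weight_def \<tau>_def)
  also have "\<dots> \<le> integral {0..1} (cut_pole_weight \<epsilon>)"
    using \<tau> by (intro integral_subset_le integrable_continuous_interval continuous_on_subset[OF continuous_cut_pole_weight[OF e(1)]])
      (auto simp: cut_pole_weight_def)
  finally show ?thesis by (simp add: \<epsilon>_def)
qed

section \<open>Rational powers with odd prime exponent\<close>

text \<open>
  The generating function starts at index 1, so entry 0 can be replaced by 0 to make the bound by
  \<open>\<tau>\<close> hold for the whole sequence.
\<close>

lemma low_part_admissible:
  assumes k: "k = 2 * s + 1" "s \<ge> 1" and r: "\<And>i. 0 \<le> r i" and q: "q \<ge> (1::nat)"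
  shows "edge_admissible (real q * (real k ^ 2 * 4 ^ k)) s (\<lambda>i. low_part s r (Suc i))
     (\<lambda>i. inv_coeff (low_part s r) (Suc i)) (real q * psum (low_part s r) k)"
  unfolding edge_admissible_def
proof (intro conjI allI impI)
  let ?r = "low_part s r" and ?K = "real k ^ 2 * 4 ^ k :: real"
  have r0: "0 \<le> ?r i" for i using r by (simp add: low_part_def)
  show "0 \<le> ?r (Suc i)" for i by (rule r0)
  show "?r (Suc i) \<le> inv_coeff ?r (Suc i)" for i by (rule inv_coeff_ge[OF r0]) simp
  show "0 \<le> real q * psum ?r k" using psum_nonneg[of ?r k, OF r0] k by simp
  fix \<tau> :: real assume A: "0 \<le> \<tau> \<and> \<tau> \<le> 1 \<and> (\<forall>i<s. ?r (Suc i) \<le> \<tau>)"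
  \<comment> \<open>Entry 0 is not bounded by \<open>\<tau>\<close>.\<close>
  define r' where "r' i = (if i = 0 then 0 else ?r i)" for i
  have g: "gen_fps r' = gen_fps ?r" by (rule fps_ext) (simp add: gen_fps_nth r'_def)
  have r'0: "0 \<le> r' i" for i using r0 by (simp add: r'_def)
  have r't: "r' i \<le> \<tau>" for i
  proof (cases "i = 0 \<or> i > s")
    case True
    then show ?thesis using A by (auto simp: r'_def low_part_def)
  next
    case False
    then obtain j where "i = Suc j" "j < s" by (cases i) auto
    then show ?thesis using A by (simp add: r'_def)
  qed
  have "psum r' k \<le> real k ^ 2 * 4 ^ k * \<tau> ^ 3"
    by (rule psum_cubic[OF r'0 r't _ k]) (use A in \<open>auto simp: r'_def low_part_def\<close>)
  then have "psum ?r k \<le> ?K * \<tau> ^ 3" by (simp add: psum_def g)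
  then have "real q * psum ?r k \<le> real q * (?K * \<tau> ^ 3)" by (intro mult_left_mono) auto
  then show "real q * psum ?r k \<le> real q * ?K * \<tau> ^ 3" by (simp only: mult.assoc)
  fix i assume i: "i < s"
  have "inv_coeff r' (Suc i) \<le> r' (Suc i) + real (Suc i) * 4 ^ Suc i * \<tau>\<^sup>2"
    by (rule inv_coeff_quadratic[OF r'0 r't]) (use A in auto)
  then have "inv_coeff ?r (Suc i) \<le> ?r (Suc i) + real (Suc i) * 4 ^ Suc i * \<tau>\<^sup>2"
    by (simp add: inv_coeff_def g r'_def)
  also have "real (Suc i) * 4 ^ Suc i * \<tau>\<^sup>2 \<le> real q * ?K * \<tau>\<^sup>2"
  proof (rule mult_right_mono)
    have "real (Suc i) \<le> real k * real k"
    proof -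
      have "Suc i * 1 \<le> k * k" using i k by (intro mult_mono) auto
      then show ?thesis by (simp flip: of_nat_mult)
    qed
    then have "real (Suc i) * 4 ^ Suc i \<le> real k ^ 2 * 4 ^ k"
      using i k unfolding power2_eq_square by (intro mult_mono power_increasing) auto
    also have "1 * (real k ^ 2 * 4 ^ k) \<le> real q * (real k ^ 2 * 4 ^ k)"
      using q by (intro mult_right_mono) auto
    finally show "real (Suc i) * 4 ^ Suc i \<le> real q * ?K" by simp
  qed simp
  finally show "inv_coeff ?r (Suc i) \<le> ?r (Suc i) + real q * ?K * \<tau>\<^sup>2" by simp
qed

lemma edge_kernel_exp_avg:
  "edge_kernel M c s S b = (\<Sum>i<M. \<Sum>j<M. (\<i> * of_real (2 * pi * ((real i - real j) * c))) ^ s *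
     ((\<Prod>l<s. exp_avg (\<i> * of_real (2 * pi * ((real i - real j) * c) * b l))) * ee ((real i - real j) * S))) / of_nat M ^ 2"
proof -
  have "(\<Prod>l<s. edge_factor y (b l)) = (\<i> * of_real y) ^ s * (\<Prod>l<s. exp_avg (\<i> * of_real (y * b l)))" for y
    by (simp add: edge_factor_def prod.distrib power_mult_distrib)
  then show ?thesis
    unfolding edge_kernel_def by (simp only: mult_ac)
qed

text \<open>
  The terms of frequency 0 vanish because of the factor \<open>0^s\<close> with \<open>s \<ge> 1\<close>.
\<close>

lemma mean_edge_kernel_tendsto_0:
  assumes s: "s \<ge> 1"
    and W: "\<And>m::int. m \<noteq> 0 \<Longrightarrow>
      mean (\<lambda>n. (\<Prod>l<s. exp_avg (\<i> * of_real (2 * pi * (of_int m * c) * b l n))) * ee (of_int m * S n)) \<longlonglongrightarrow> 0"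
  shows "mean (\<lambda>n. edge_kernel M c s (S n) (\<lambda>l. b l n)) \<longlonglongrightarrow> 0"
proof -
  let ?F = "\<lambda>i j n. (\<Prod>l<s. exp_avg (\<i> * of_real (2 * pi * ((real i - real j) * c) * b l n))) * ee ((real i - real j) * S n)"
  let ?C = "\<lambda>i j. (\<i> * complex_of_real (2 * pi * ((real i - real j) * c))) ^ s"
  have "(\<lambda>N. ?C i j * mean (?F i j) N) \<longlonglongrightarrow> 0" for i j
  proof (cases "i = j")
    case True
    then show ?thesis using s by (simp add: power_0_left)
  next
    case False
    then have "mean (?F i j) \<longlonglongrightarrow> 0" using W[of "int i - int j"] by simp
    then show ?thesis by (rule tendsto_mult_right_zero)
  qed
  then have "(\<lambda>N. (\<Sum>i<M. \<Sum>j<M. ?C i j * mean (?F i j) N) / of_nat M ^ 2) \<longlonglongrightarrow> (\<Sum>i<M. \<Sum>j<M. 0) / of_nat M ^ 2"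
    unfolding divide_inverse by (intro tendsto_mult tendsto_sum tendsto_const) auto
  moreover have "mean (\<lambda>n. edge_kernel M c s (S n) (\<lambda>l. b l n)) = (\<lambda>N. (\<Sum>i<M. \<Sum>j<M. ?C i j * mean (?F i j) N) / of_nat M ^ 2)"
    unfolding edge_kernel_exp_avg by (rule ext) (simp only: mean_cdivide mean_sum mean_cmult)
  ultimately show ?thesis by simp
qed

text \<open>
  Integrate out \<open>v_(k-1), v_(k-2), \<dots>, v_(k-s)\<close> in this order. Each one is independent of the
  later ones and of the \<open>b_l\<close> and \<open>S\<close>, whose degree \<open>s\<close> is still below the current index.
\<close>

lemma mean_high_parts_averaged:
  assumes k: "k = 2 * s + 1"
    and v: "\<And>i. 1 \<le> i \<Longrightarrow> i < k \<Longrightarrow> unif_indep (i - 1) (v i)"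
    and rc: "\<And>i. 1 \<le> i \<Longrightarrow> i < k \<Longrightarrow> real_class i (v i)"
    and b: "\<And>l. l < s \<Longrightarrow> real_class s (b l)" and S: "real_class s S"
    and W: "mean (\<lambda>n. ee (x * (S n + c * (\<Sum>l<s. b l n * v (k - Suc l) n)))) \<longlonglongrightarrow> 0"
  shows "mean (\<lambda>n. (\<Prod>l<s. exp_avg (\<i> * of_real (2 * pi * (x * c) * b l n))) * ee (x * S n)) \<longlonglongrightarrow> 0"
proof -
  define E where "E l n = exp_avg (\<i> * of_real (2 * pi * (x * c) * b l n))" for l n
  define R where "R t n = x * S n + x * c * (\<Sum>l\<in>{t..<s}. b l n * v (k - Suc l) n)" for t n
  have u: "(\<lambda>n. \<i> * of_real (2 * pi * (x * c) * b l n)) \<in> phase_class s" if "l < s" for l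
  proof -
    have "(\<lambda>n. (\<i> * of_real (2 * pi * (x * c))) * of_real (b l n)) \<in> phase_class s"
      using b[OF that] unfolding real_class_def by (rule phase_class_cmult)
    then show ?thesis by (simp add: mult_ac)
  qed
  have E: "E l \<in> phase_class s" if "l < s" for l
    unfolding E_def[abs_def] by (rule phase_class_exp_avg[OF u[OF that]])
  have "mean (\<lambda>n. (\<Prod>l<t. E l n) * ee (R t n)) \<longlonglongrightarrow> 0" if "t \<le> s" for t
    using that
  proof (induction t)
    case 0
    then show ?case using W by (simp add: R_def distrib_left mult.assoc atLeast0LessThan)
  next
    case (Suc t)
    \<comment> \<open>The variable integrated out in this step has index \<open>d + 1\<close>.\<close>
    define d where "d = k - Suc t - 1"
    have t: "t < s" and d: "s \<le> d" using Suc.prems k by (auto simp: d_def)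
    define F where "F n = (\<Prod>l<t. E l n) * ee (R (Suc t) n)" for n
    have "real_class d (R (Suc t))"
      unfolding R_def[abs_def]
    proof (intro real_class_add real_class_mult real_class_const real_class_sum)
      show "real_class d S" using S d by (rule real_class_mono)
      fix l assume l: "l \<in> {Suc t..<s}"
      show "real_class d (b l)" using b[of l] d l by (auto intro: real_class_mono)
      show "real_class d (v (k - Suc l))"
        by (rule real_class_mono[OF rc]) (use l k in \<open>auto simp: d_def\<close>)
    qed
    from real_class_ee[OF this, of 1] have "(\<lambda>n. ee (R (Suc t) n)) \<in> phase_class d" by simp
    moreover have "(\<lambda>n. \<Prod>l<t. E l n) \<in> phase_class d"
      using t by (intro phase_class_prod phase_class_mono[OF E d]) auto
    ultimately have F: "F \<in> phase_class d" unfolding F_def[abs_def] by (rule phase_class_mult[rotated])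
    have "unif_indep (k - Suc t - 1) (v (k - Suc t))" using t k by (intro v) auto
    then have vi: "unif_indep d (v (k - Suc t))" by (simp only: d_def)
    have split: "(\<Prod>l<t. E l n) * ee (R t n) = F n * exp ((\<i> * of_real (2 * pi * (x * c) * b t n)) * of_real (v (k - Suc t) n))" for n
    proof -
      have "{t..<s} = insert t {Suc t..<s}" using t by auto
      then have "R t n = R (Suc t) n + x * c * b t n * v (k - Suc t) n"
        by (simp add: R_def distrib_left mult.assoc)
      then have "ee (R t n) = ee (R (Suc t) n) * ee (x * c * b t n * v (k - Suc t) n)" by (simp only: ee_add)
      also have "ee (x * c * b t n * v (k - Suc t) n) = exp ((\<i> * of_real (2 * pi * (x * c) * b t n)) * of_real (v (k - Suc t) n))"
        by (simp add: ee_def cis_conv_exp mult_ac)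
      finally show ?thesis by (simp add: F_def mult.assoc)
    qed
    have "mean (\<lambda>n. (\<Prod>l<t. E l n) * ee (R t n)) \<longlonglongrightarrow> 0" using Suc by simp
    moreover have "(\<lambda>N. mean (\<lambda>n. (\<Prod>l<t. E l n) * ee (R t n)) N - mean (\<lambda>n. F n * E t n) N) \<longlonglongrightarrow> 0"
      unfolding split unfolding E_def using unif_indep_exp[OF vi F phase_class_mono[OF u[OF t] d]] .
    ultimately have "mean (\<lambda>n. F n * E t n) \<longlonglongrightarrow> 0"
      using tendsto_diff by fastforce
    then show ?case by (simp add: F_def mult_ac)
  qed
  from this[of s] show ?thesis by (simp add: E_def R_def)
qed

text \<open>
  With \<open>L = log (1 + M)\<close>, the vanishing mean of the kernel is at least
  \<open>c1 (L/4)^s - C2 s (3/2) L^(s-1)\<close>, which is positive once \<open>L\<close> is large.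
\<close>

lemma not_unif_dist_odd:
  assumes \<alpha>: "\<alpha> \<notin> \<rat>" and k: "k = 2 * s + 1" "s \<ge> 1" and rat: "\<alpha> ^ k \<in> \<rat>"
    and irr: "\<And>i. 0 < i \<Longrightarrow> i < k \<Longrightarrow> \<alpha> ^ i \<notin> \<rat>"
  shows "\<not> unif_dist_mod1 (\<lambda>n. nested_floor (\<alpha> * real n) k)"
proof
  assume ud: "unif_dist_mod1 (\<lambda>n. nested_floor (\<alpha> * real n) k)"
  obtain p :: int and q :: nat where pq: "q \<ge> 1" "\<alpha> ^ k = of_int p / real q"
    using rat by (rule Rats_fractionE)
  let ?r = "frac_part \<alpha>"
  define \<rho> where "\<rho> n = low_part s (\<lambda>i. ?r i n)" for n
  define b where "b l n = inv_coeff (\<rho> n) (Suc l)" for l n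
  define S where "S n = real q * psum (\<rho> n) k" for n
  define c where "c = real k * real q"
  define K where "K = real q * (real k ^ 2 * 4 ^ k)"
  have c1: "c \<ge> 1" unfolding c_def using k pq(1) by (simp add: Suc_leI mult_ge1_I flip: of_nat_mult)
  have K1: "K \<ge> 1"
  proof -
    have "1 * (1 * 1) \<le> real q * (real k ^ 2 * 4 ^ k)"
      using pq(1) k by (intro mult_mono one_le_power) auto
    then show ?thesis by (simp add: K_def)
  qed
  have rc: "real_class i (?r i)" if "1 \<le> i" for i
    using parts_in_class_all[OF \<alpha> that] by (simp add: parts_in_class_def)
  have ind: "unif_indep (i - 1) (?r i)" if "1 \<le> i" "i < k" for i
    using that by (intro frac_part_unif_indep irr parts_in_class_all[OF \<alpha>]) auto
  have \<rho>c: "real_class s (\<lambda>n. \<rho> n i)" if "1 \<le> i" for i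
    using real_class_mono[OF rc[OF that], of s] real_class_const[of s 0]
    by (cases "i \<le> s") (simp_all add: \<rho>_def low_part_def)
  have bc: "real_class s (b l)" for l
    unfolding b_def[abs_def]
    by (rule inv_coeff_closed[of "real_class s" _ "\<lambda>i n. \<rho> n i"])
      (auto intro: real_class_const real_class_add real_class_mult \<rho>c)
  have "real_class s (\<lambda>n. psum (\<lambda>i. \<rho> n i) k)"
    using k by (intro real_class_psum \<rho>c) auto
  then have Sc: "real_class s S"
    unfolding S_def[abs_def] by (intro real_class_mult real_class_const)
  have adm: "edge_admissible K s (\<lambda>i. \<rho> n (Suc i)) (\<lambda>l. b l n) (S n)" for n
    unfolding K_def \<rho>_def b_def S_def using k pq(1) frac_part_bounds by (intro low_part_admissible) auto
  have Wm: "mean (\<lambda>n. (\<Prod>l<s. exp_avg (\<i> * of_real (2 * pi * (of_int m * c) * b l n))) * ee (of_int m * S n)) \<longlonglongrightarrow> 0"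
    if m: "m \<noteq> 0" for m :: int
  proof (rule mean_high_parts_averaged[OF k(1), of ?r b S])
    have eq: "real q * psum_lower (\<lambda>i. ?r i n) k = S n + c * (\<Sum>l<s. b l n * ?r (k - Suc l) n)" for n
      unfolding psum_lower_high[OF k(1)] by (simp add: S_def \<rho>_def b_def c_def distrib_left mult_ac)
    have "k \<ge> 1" using k by simp
    from psum_lower_weyl_sums[OF \<alpha> this pq(2,1) ud m]
    show "mean (\<lambda>n. ee (of_int m * (S n + c * (\<Sum>l<s. b l n * ?r (k - Suc l) n)))) \<longlonglongrightarrow> 0"
      by (simp only: eq)
  qed (use ind rc bc Sc in auto)
  obtain c1 C2 :: real and M0 :: nat where C: "c1 > 0" "C2 \<ge> 0"
    "\<And>M \<rho> b S. M \<ge> M0 \<Longrightarrow> M > 0 \<Longrightarrow> edge_admissible K s \<rho> b S \<Longrightarrow>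
       c1 * (\<Prod>i<s. cut_pole_weight (1 / real M) (\<rho> i)) - C2 * edge_error (1 / real M) s \<rho>
         \<le> Re ((-1) ^ s * edge_kernel M c s S b)"
    using edge_kernel_lower[OF c1 K1] by blast
  \<comment> \<open>Just above the value that the final inequality allows for \<open>log (1 + M)\<close>.\<close>
  define X where "X = max 4 (4 ^ s * (3 / 2 * C2 * real s) / c1) + 1"
  define M where "M = nat \<lceil>exp X\<rceil> + M0 + 1"
  have M: "M \<ge> M0" "M > 0" by (auto simp: M_def)
  let ?\<epsilon> = "1 / real M"
  have e: "?\<epsilon> > 0" using M by simp
  define L where "L = ln (1 + real M)"
  have "exp X \<le> 1 + real M" unfolding M_def by linarith
  then have LX: "L \<ge> X" unfolding L_def using M by (subst ln_ge_iff) auto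
  define H G D where "H = integral {0..1} (cut_pole_weight ?\<epsilon>)" and "G = integral {0..1} (pole_weight ?\<epsilon>)" and "D = integral {0..1} (spread_weight ?\<epsilon>)"
  have rho: "\<rho> n (Suc i) = ?r (Suc i) n" if "i < s" for i n
    using that by (simp add: \<rho>_def low_part_def)
  have prodlim: "mean (\<lambda>n. \<Prod>i<s. g i (\<rho> n (Suc i))) \<longlonglongrightarrow> (\<Prod>i<s. integral {0..1} (g i))"
    if "\<And>i. continuous_on {0..1} (g i)" for g :: "nat \<Rightarrow> real \<Rightarrow> real"
  proof -
    have "mean (\<lambda>n. \<Prod>i<s. g i (?r (Suc i) n)) \<longlonglongrightarrow> (\<Prod>i<s. integral {0..1} (g i))"
    proof (rule tendsto_mean_prod)
      fix i assume i: "i < s"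
      show "unif_indep i (?r (Suc i))" using ind[of "Suc i"] i k by simp
      show "(\<lambda>n. of_real (?r (Suc i) n)) \<in> phase_class (Suc i)" using rc[of "Suc i"] by (simp add: real_class_def)
    qed (rule that)
    then show ?thesis by (simp add: rho)
  qed
  have lim1: "mean (\<lambda>n. \<Prod>i<s. cut_pole_weight ?\<epsilon> (\<rho> n (Suc i))) \<longlonglongrightarrow> H ^ s"
    using prodlim[of "\<lambda>i. cut_pole_weight ?\<epsilon>"] continuous_cut_pole_weight[OF e] by (simp add: H_def)
  have lim2: "mean (\<lambda>n. edge_error ?\<epsilon> s (\<lambda>i. \<rho> n (Suc i))) \<longlonglongrightarrow> real s * (D * G ^ (s - 1))"
  proof -
    have 1: "mean (\<lambda>n. spread_weight ?\<epsilon> (\<rho> n (Suc j)) * (\<Prod>i\<in>{..<s}-{j}. pole_weight ?\<epsilon> (\<rho> n (Suc i)))) \<longlonglongrightarrow> D * G ^ (s - 1)" if j: "j < s" for j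
    proof -
      let ?g = "\<lambda>i. if i = j then spread_weight ?\<epsilon> else pole_weight ?\<epsilon>"
      have "mean (\<lambda>n. \<Prod>i<s. ?g i (\<rho> n (Suc i))) \<longlonglongrightarrow> (\<Prod>i<s. integral {0..1} (?g i))"
        by (rule prodlim) (use continuous_spread_weight[OF e] continuous_pole_weight[OF e] in auto)
      moreover have "(\<Prod>i<s. ?g i (\<rho> n (Suc i))) = spread_weight ?\<epsilon> (\<rho> n (Suc j)) * (\<Prod>i\<in>{..<s}-{j}. pole_weight ?\<epsilon> (\<rho> n (Suc i)))" for n
        unfolding prod_remove[OF j] by (intro arg_cong2[where f = "(*)"] prod.cong) auto
      moreover have "(\<Prod>i<s. integral {0..1} (?g i)) = D * G ^ (s - 1)"
      proof -
        have "(\<Prod>i\<in>{..<s}-{j}. integral {0..1} (?g i)) = (\<Prod>i\<in>{..<s}-{j}. G)"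
          by (intro prod.cong) (auto simp: G_def)
        then show ?thesis unfolding prod_remove[OF j] using j by (simp add: D_def)
      qed
      ultimately show ?thesis by (simp only:)
    qed
    have "(\<lambda>N. \<Sum>j<s. mean (\<lambda>n. spread_weight ?\<epsilon> (\<rho> n (Suc j)) * (\<Prod>i\<in>{..<s}-{j}. pole_weight ?\<epsilon> (\<rho> n (Suc i)))) N) \<longlonglongrightarrow> (\<Sum>j<s. D * G ^ (s - 1))"
      by (intro tendsto_sum 1) auto
    then show ?thesis unfolding edge_error_def mean_sum[abs_def] by simp
  qed
  have lim3: "(\<lambda>N. Re ((-1) ^ s * mean (\<lambda>n. edge_kernel M c s (S n) (\<lambda>l. b l n)) N)) \<longlonglongrightarrow> Re ((-1) ^ s * 0)"
    using k(2) Wm by (intro tendsto_intros mean_edge_kernel_tendsto_0) auto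
  have "c1 * H ^ s - C2 * (real s * (D * G ^ (s - 1))) \<le> Re ((-1) ^ s * 0)"
  proof (rule LIMSEQ_le)
    show "(\<lambda>N. c1 * mean (\<lambda>n. \<Prod>i<s. cut_pole_weight ?\<epsilon> (\<rho> n (Suc i))) N - C2 * mean (\<lambda>n. edge_error ?\<epsilon> s (\<lambda>i. \<rho> n (Suc i))) N)
      \<longlonglongrightarrow> c1 * H ^ s - C2 * (real s * (D * G ^ (s - 1)))"
      by (intro tendsto_intros lim1 lim2)
    have "c1 * mean (\<lambda>n. \<Prod>i<s. cut_pole_weight ?\<epsilon> (\<rho> n (Suc i))) N - C2 * mean (\<lambda>n. edge_error ?\<epsilon> s (\<lambda>i. \<rho> n (Suc i))) N
       \<le> Re ((-1) ^ s * mean (\<lambda>n. edge_kernel M c s (S n) (\<lambda>l. b l n)) N)" for N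
    proof -
      have "c1 * mean (\<lambda>n. \<Prod>i<s. cut_pole_weight ?\<epsilon> (\<rho> n (Suc i))) N - C2 * mean (\<lambda>n. edge_error ?\<epsilon> s (\<lambda>i. \<rho> n (Suc i))) N
        = mean (\<lambda>n. c1 * (\<Prod>i<s. cut_pole_weight ?\<epsilon> (\<rho> n (Suc i))) - C2 * edge_error ?\<epsilon> s (\<lambda>i. \<rho> n (Suc i))) N"
        by (simp only: mean_diff mean_cmult)
      also have "\<dots> \<le> mean (\<lambda>n. Re ((-1) ^ s * edge_kernel M c s (S n) (\<lambda>l. b l n))) N"
        by (rule mean_mono) (rule C(3)[OF M adm])
      also have "\<dots> = Re (mean (\<lambda>n. (-1) ^ s * edge_kernel M c s (S n) (\<lambda>l. b l n)) N)"
        by (simp add: mean_def Re_divide_of_nat Re_sum)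
      finally show ?thesis by (simp only: mean_cmult)
    qed
    then show "\<exists>N. \<forall>n\<ge>N. c1 * mean (\<lambda>n. \<Prod>i<s. cut_pole_weight ?\<epsilon> (\<rho> n (Suc i))) n - C2 * mean (\<lambda>n. edge_error ?\<epsilon> s (\<lambda>i. \<rho> n (Suc i))) n
       \<le> Re ((-1) ^ s * mean (\<lambda>n. edge_kernel M c s (S n) (\<lambda>l. b l n)) n)" by blast
  qed (rule lim3)
  then have main: "c1 * H ^ s \<le> C2 * (real s * (D * G ^ (s - 1)))" by simp
  have L4: "L \<ge> 4" using LX by (simp add: X_def)
  have GL: "G = L" unfolding G_def L_def using M(2) by (rule integral_pole_weight)
  have D: "D \<le> 3 / 2" unfolding D_def by (rule integral_spread_weight_le[OF e])
  have "H \<ge> L / 2 - 1" unfolding H_def L_def using M(2) by (rule integral_cut_pole_weight_ge)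
  then have "L / 4 \<le> H" using L4 by linarith
  then have "(L / 4) ^ s \<le> H ^ s" using L4 by (intro power_mono) auto
  then have "c1 * (L / 4) ^ s \<le> c1 * H ^ s" using C(1) by simp
  also note main
  also have "C2 * (real s * (D * G ^ (s - 1))) \<le> C2 * (real s * (3 / 2 * L ^ (s - 1)))"
    unfolding GL using D C(2) L4 by (intro mult_left_mono mult_right_mono) auto
  finally have "c1 * (L / 4) ^ s \<le> C2 * (real s * (3 / 2 * L ^ (s - 1)))" .
  moreover have "(L / 4) ^ s = L * L ^ (s - 1) / 4 ^ s"
    using k(2) by (cases s) (simp_all add: power_divide)
  ultimately have "c1 * (L * L ^ (s - 1) / 4 ^ s) \<le> C2 * (real s * (3 / 2 * L ^ (s - 1)))"
    by (simp only:)
  then have "4 ^ s * (c1 * (L * L ^ (s - 1) / 4 ^ s)) \<le> 4 ^ s * (C2 * (real s * (3 / 2 * L ^ (s - 1))))"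
    by (intro mult_left_mono) auto
  then have "c1 * L * L ^ (s - 1) \<le> (4 ^ s * (3 / 2 * C2 * real s)) * L ^ (s - 1)"
    by (simp add: mult_ac)
  then have "c1 * L \<le> 4 ^ s * (3 / 2 * C2 * real s)"
    using L4 by (subst (asm) mult_le_cancel_right_pos) auto
  then have "L \<le> 4 ^ s * (3 / 2 * C2 * real s) / c1" using C(1) by (simp add: field_simps)
  also have "\<dots> < X" by (simp add: X_def)
  finally show False using LX by simp
qed

theorem mainTheorem2:
  fixes k :: nat and \<alpha> :: real
  assumes "prime k"
  shows "unif_dist_mod1 (\<lambda>n. nested_floor (\<alpha> * real n) k) \<longleftrightarrow> \<alpha> ^ k \<notin> \<rat>"
proof
  have k1: "k \<ge> 1" using prime_gt_1_nat[OF assms] by simp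
  show "unif_dist_mod1 (\<lambda>n. nested_floor (\<alpha> * real n) k)" if "\<alpha> ^ k \<notin> \<rat>"
    using that k1 by (rule unif_dist_nested_floor)
  show "\<alpha> ^ k \<notin> \<rat>" if ud: "unif_dist_mod1 (\<lambda>n. nested_floor (\<alpha> * real n) k)"
  proof
    assume rat: "\<alpha> ^ k \<in> \<rat>"
    have \<alpha>: "\<alpha> \<notin> \<rat>" using not_unif_dist_rational[OF _ k1] ud by blast
    show False
    proof (cases "k = 2")
      case True
      then show False using not_unif_dist_square[OF \<alpha>] rat ud by simp
    next
      case False
      then have "odd k" using assms by (metis primes_dvd_imp_eq two_is_prime_nat)
      then obtain s where s: "k = 2 * s + 1" by (rule oddE)
      have "s \<ge> 1" using s prime_gt_1_nat[OF assms] by simp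
      then show False
        using not_unif_dist_odd[OF \<alpha> s _ rat irrational_lower_power[OF assms \<alpha> rat]] ud by blast
    qed
  qed
qed

end
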